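(* Let $\eta\in(0,1]$ and $q\in(0,1)$. Then $\tau^\theta$ converges in distribution to $\tau^\infty$ as $\theta\to+\infty$.
   Context: Notation: $\mathbb{N}=\{0,1,2,\ldots\}$, $\mathbb{N}^*=\{1,2,\ldots\}$, $\bar{\mathbb{N}}=\mathbb{N}\cup\{+\infty\}$, $x\vee y=\max(x,y)$, and $0^0=1$. Trees. Let $\mathcal{U}=\bigcup_{n\ge0}(\mathbb{N}^* )^n$ be the set of finite words, with $(\mathbb{N}^* )^0=\{\emptyset\}$; $|u|$ is the length of $u$. A tree is a subset $\mathbf{t}\subset\mathcal{U}$ containing $\emptyset$ (the root), containing with each $u$ all its prefixes (ancestors), and such that for every $u\in\mathbf{t}$ there is $k_u(\mathbf{t})\in\bar{\mathbb{N}}$ (the number of children of $u$) with $ui\in\mathbf{t}\iff 1\le i\le k_u(\mathbf{t})$ for every $i\in\mathbb{N}^*$. Put $k_u(\mathbf{t})=-1$ if $u\notin\mathbf{t}$. $\mathbb{T}_\infty$ is the set of all trees, with the topology in which $\mathbf{t}_n\to\mathbf{t}$ iff $k_u(\mathbf{t}_n)\to k_u(\mathbf{t})$ for all $u\in\mathcal{U}$, where $\{-1\}\cup\bar{\mathbb{N}}$ is the one-point compactification of the discrete space $\{-1\}\cup\mathbb{N}$. Convergence in distribution of random trees is weak convergence in $\mathbb{T}_\infty$. Put $r_h(\mathbf{t})=\{u\in\mathbf{t}:|u|\le h\}$. Offspring distribution. $\mathcal{G}(\eta,q)$ is the distribution $p$ on $\mathbb{N}$ with $p(0)=1-\eta$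 and $p(k)=\eta q(1-q)^{k-1}$ for $k\ge1$. Its mean is $\mu=\eta/q$. Put $\gamma=\frac1{1-q}$, $\kappa=\frac{1-\eta}{1-q}$ and, for $n\ge1$, $\gamma_n=\frac{\kappa-\mu^n}{1-\mu^n}$ if $\mu\ne1$ and $\gamma_n=1+\frac{\gamma-1}{n}$ if $\mu=1$ (so $\gamma_1=\gamma$). The distribution $\mathfrak{p}$. Let $\mathfrak{p}=p$ if $\mu\le1$; if $\mu>1$ let $\mathfrak{p}=\mathcal{G}(q,\eta)$, i.e. $\mathfrak{p}(0)=1-q$ and $\mathfrak{p}(k)=q\eta(1-\eta)^{k-1}$ for $k\ge1$ (equivalently $\mathfrak{p}(n)=\mathfrak{c}^{n-1}p(n)$ with $\mathfrak{c}=\min(1,\kappa)$ when $\mathfrak{c}>0$). For $s\ge1$ its $s$-th order size-biased distribution is $\mathfrak{p}_{[s]}(n)=\binom{n}{s}(q\vee\eta)^{s+1}(1-(q\vee\eta))^{n-s}$, $n\ge s$. The random tree $\tau^\theta$, $\theta\in(0,+\infty)$. It is obtained by forgetting the types in a random tree whose vertices have type $\mathrm{s}$ or $\mathrm{e}$, where $\mathcal{S}_h$ denotes the set of vertices of type $\mathrm{s}$ at level $h$, defined generation by generation as follows. (i) The root has type $\mathrm{s}$: $\mathcal{S}_0=\{\emptyset\}$. (ii) The vertices of type $\mathrm{e}$ reproduce independently of each other and of everything else at lower or same height; a vertex of type $\mathrm{e}$ has only children of type $\mathrm{e}$, their number having distribution $\mathfrak{p}$. (iii) For $h\ge0$, conditionally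 on $r_h(\tau^\theta)$ and $(\mathcal{S}_\ell,0\le\ell\le h)$, the increment $\Delta_h=\#\mathcal{S}_{h+1}-\#\mathcal{S}_h$ is Poisson with mean $\theta\zeta_h$, where $$\zeta_h=\begin{cases}\mu^{-h-1}(1-\mu)(\kappa-1)/\kappa&\text{if }\mu<1,\\ \gamma-1&\text{if }\mu=1,\\ \mu^h(\mu-1)(1-\kappa)&\text{if }\mu>1.\end{cases}$$ Each $u\in\mathcal{S}_h$ has $\kappa^{\mathrm{s}}(u)\ge1$ children of type $\mathrm{s}$; given $\#\mathcal{S}_{h+1}$, all configurations $(\kappa^{\mathrm{s}}(u),u\in\mathcal{S}_h)$ of integers $\ge1$ with sum $\#\mathcal{S}_{h+1}$ are equally likely, each having probability $1/\binom{\#\mathcal{S}_{h+1}-1}{\#\mathcal{S}_h-1}$. Conditionally on $r_h(\tau^\theta)$, $\mathcal{S}_h$ and $(\kappa^{\mathrm{s}}(v)=s_v,v\in\mathcal{S}_h)$, independently for each $u\in\mathcal{S}_h$, the total number of children $k_u(\tau^\theta)$ has distribution $\mathfrak{p}_{[s_u]}$, and the $s_u$ children of type $\mathrm{s}$ are chosen uniformly at random among the $k_u(\tau^\theta)$ children, the others being of type $\mathrm{e}$. The random tree $\tau^\infty$. For $n\ge1$ let $\tilde p_n(k)=\frac{\gamma_{n+1}^k}{\gamma_n}p(k)$, $k\in\mathbb{N}$ (a probability distribution on $\mathbb{N}$), and let $\tilde p_0$ be the Dirac mass at $+\infty$. Then $\tau^\infty$ is the inhomogeneous Galton-Watson tree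 in which all individuals reproduce independently, an individual at generation $h\in\mathbb{N}$ having a number of children with distribution $\tilde p_h$. In particular its root has infinitely many children and all other vertices have finitely many children. *)

theory Defs
  imports "HOL-Probability.Probability"
begin

section \<open>Trees and their topology\<close>

text \<open>Words are lists of positive integers; the \<open>i\<close>-th child of \<open>u\<close> is \<open>u @ [i]\<close>, \<open>i \<ge> 1\<close>.\<close>

type_synonym word = "nat list"

definition words :: "word set" where
  "words = {u. \<forall>i\<in>set u. 1 \<le> i}"

definition ulam_trees :: "word set set" where
  "ulam_trees = {t. t \<subseteq> words \<and> [] \<in> t \<and> (\<forall>u v. u @ v \<in> t \<longrightarrow> u \<in> t) \<and>
     (\<forall>u\<in>t. \<exists>k::enat. \<forall>i\<ge>1. u @ [i] \<in> t \<longleftrightarrow> enat i \<le> k)}"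

lemma root_in_ulam_trees: "{[]} \<in> ulam_trees"
proof -
  have "\<exists>k::enat. \<forall>i\<ge>1. \<not> enat i \<le> k"
    by (rule exI[of _ 0]) (auto simp: zero_enat_def)
  then show ?thesis
    by (simp add: ulam_trees_def words_def)
qed

typedef ulam_tree = ulam_trees
  morphisms vertices Abs_tree
  using root_in_ulam_trees by blast

text \<open>The number of children takes values in \<open>{-1, 0, 1, 2, \<dots>, \<infinity>}\<close>, seen inside \<^typ>\<open>ereal\<close>;
  the subspace topology there is that of the one-point compactification of the discrete
  space \<open>{-1, 0, 1, \<dots>}\<close>.\<close>

definition child_count :: "ulam_tree \<Rightarrow> word \<Rightarrow> ereal" where
  "child_count t u =
     (if u \<in> vertices t
      then ereal_of_enat (THE k. \<forall>i\<ge>1. u @ [i] \<in> vertices t \<longleftrightarrow> enat i \<le> k)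
      else -1)"

lemma enat_initial_segment_unique:
  fixes k l :: enat
  assumes "\<forall>i\<ge>1. enat i \<le> k \<longleftrightarrow> enat i \<le> l"
  shows "k = l"
proof -
  have *: "a \<le> b" if "\<forall>i\<ge>1. enat i \<le> a \<longrightarrow> enat i \<le> b" for a b :: enat
  proof (rule ccontr)
    assume "\<not> a \<le> b"
    then obtain m where m: "b = enat m" and "enat m < a"
      by (cases b) auto
    then have "enat (Suc m) \<le> a"
      by (metis Suc_ile_eq)
    with that m show False
      by (metis enat_ord_simps(1) le_add1 not_less_eq_eq plus_1_eq_Suc order_refl)
  qed
  show ?thesis
    using assms by (intro antisym *) auto
qed

lemma child_count_eq_iff:
  "child_count t u = ereal_of_enat k \<longleftrightarrow>
     u \<in> vertices t \<and> (\<forall>i\<ge>1. u @ [i] \<in> vertices t \<longleftrightarrow> enat i \<le> k)"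
proof (cases "u \<in> vertices t")
  case True
  let ?P = "\<lambda>k. \<forall>i\<ge>1. u @ [i] \<in> vertices t \<longleftrightarrow> enat i \<le> k"
  obtain l :: enat where l: "?P l"
    using True vertices[of t] unfolding ulam_trees_def by blast
  have "(THE k. ?P k) = l"
    by (rule the_equality) (use l enat_initial_segment_unique in auto)
  then have "child_count t u = ereal_of_enat l"
    using True by (simp add: child_count_def)
  moreover have "ereal_of_enat l = ereal_of_enat k \<longleftrightarrow> l = k"
    by (metis antisym ereal_of_enat_le_iff order_refl)
  moreover have "l = k \<longleftrightarrow> ?P k"
    using l enat_initial_segment_unique by auto
  ultimately show ?thesis
    using True by simp
next
  case False
  have "ereal_of_enat k \<noteq> -1"
    by (cases k) (auto simp: one_ereal_def)
  with False show ?thesis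
    by (auto simp: child_count_def)
qed

lemma child_count_eq_minus_one_iff: "child_count t u = -1 \<longleftrightarrow> u \<notin> vertices t"
proof -
  have "ereal_of_enat k \<noteq> -1" for k
    by (cases k) (auto simp: one_ereal_def)
  then show ?thesis
    by (simp add: child_count_def)
qed

text \<open>The coarsest topology making all the maps \<open>t \<mapsto> k\<^sub>u(t)\<close> continuous.\<close>

instantiation ulam_tree :: topological_space
begin

definition open_ulam_tree_def:
  "open = generate_topology {{t. child_count t u \<in> V} | u V. u \<in> words \<and> open V}"

instance
proof
  show "open (UNIV :: ulam_tree set)"
    unfolding open_ulam_tree_def by (rule generate_topology.UNIV)
next
  fix S T :: "ulam_tree set"
  assume "open S" "open T"
  then show "open (S \<inter> T)"
    unfolding open_ulam_tree_def by (rule generate_topology.Int)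
next
  fix K :: "ulam_tree set set"
  assume "\<forall>S\<in>K. open S"
  then show "open (\<Union>K)"
    unfolding open_ulam_tree_def by (intro generate_topology.UN) auto
qed

end


lemma tendsto_tree_iff:
  "(f \<longlongrightarrow> t) F \<longleftrightarrow> (\<forall>u\<in>words. ((\<lambda>x. child_count (f x) u) \<longlongrightarrow> child_count t u) F)"
proof
  assume f: "(f \<longlongrightarrow> t) F"
  show "\<forall>u\<in>words. ((\<lambda>x. child_count (f x) u) \<longlongrightarrow> child_count t u) F"
  proof (intro ballI topological_tendstoI)
    fix u V assume "u \<in> words" and "open V" and V: "child_count t u \<in> V"
    then have "open {t. child_count t u \<in> V}"
      unfolding open_ulam_tree_def by (intro generate_topology.Basis) auto
    from topological_tendstoD[OF f this] V
    show "\<forall>\<^sub>F x in F. child_count (f x) u \<in> V"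
      by simp
  qed
next
  assume *: "\<forall>u\<in>words. ((\<lambda>x. child_count (f x) u) \<longlongrightarrow> child_count t u) F"
  show "(f \<longlongrightarrow> t) F"
  proof (rule topological_tendstoI)
    fix S :: "ulam_tree set" assume "open S" "t \<in> S"
    then show "\<forall>\<^sub>F x in F. f x \<in> S"
      unfolding open_ulam_tree_def
    proof (induction rule: generate_topology.induct)
      case (Int a b)
      then show ?case by (auto elim: eventually_elim2)
    next
      case (UN K)
      then obtain k where "k \<in> K" "\<forall>\<^sub>F x in F. f x \<in> k" by auto
      then show ?case by (auto elim: eventually_mono)
    next
      case (Basis s)
      then show ?case using * by (auto dest!: topological_tendstoD)
    qed simp
  qed
qed

instance ulam_tree :: second_countable_topology
proof
  obtain B :: "ereal set set" where B: "countable B" "open = generate_topology B"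
    using ex_countable_subbasis by auto
  define C where "C = (\<lambda>(u, b). {t. child_count t u \<in> b}) ` (words \<times> B)"
  have "countable C"
    unfolding C_def using B(1) by (intro countable_image countable_SIGMA) auto
  moreover have "open S = generate_topology C S" for S :: "ulam_tree set"
  proof
    assume "open S"
    then show "generate_topology C S"
      unfolding open_ulam_tree_def
    proof (induction rule: generate_topology.induct)
      case (Basis s)
      then obtain u V where u: "u \<in> words" and "open V" and s: "s = {t. child_count t u \<in> V}"
        by auto
      then have "generate_topology B V" by (simp add: B)
      then have "generate_topology C {t. child_count t u \<in> V}"
      proof (induction rule: generate_topology.induct)
        case UNIV
        then show ?case by (simp add: generate_topology.UNIV)
      next
        case (Int a b)
        then show ?case
          using generate_topology.Int[of C "{t. child_count t u \<in> a}" "{t. child_count t u \<in> b}"]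
          by (simp add: Int_def)
      next
        case (UN K)
        have "generate_topology C (\<Union>k\<in>K. {t. child_count t u \<in> k})"
          by (rule generate_topology_Union) (use UN in auto)
        moreover have "(\<Union>k\<in>K. {t. child_count t u \<in> k}) = {t. child_count t u \<in> \<Union>K}"
          by auto
        ultimately show ?case by simp
      next
        case (Basis b)
        then show ?case using u by (intro generate_topology.Basis) (auto simp: C_def)
      qed
      then show ?case by (simp add: s)
    qed (auto intro: generate_topology.intros)
  next
    assume "generate_topology C S"
    then show "open S"
    proof (induction rule: generate_topology.induct)
      case (Basis s)
      then show ?case
        unfolding C_def open_ulam_tree_def
        by (intro generate_topology.Basis) (auto simp: B intro!: generate_topology.Basis)
    qed auto
  qed
  ultimately show "\<exists>B::ulam_tree set set. countable B \<and> open = generate_topology B"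
    by blast
qed

text \<open>Sets of words that are not trees are sent to the one-vertex tree.\<close>

definition tree_of :: "word set \<Rightarrow> ulam_tree" where
  "tree_of A = (if A \<in> ulam_trees then Abs_tree A else Abs_tree {[]})"

lemma vertices_tree_of: "vertices (tree_of A) = (if A \<in> ulam_trees then A else {[]})"
  by (simp add: tree_of_def Abs_tree_inverse root_in_ulam_trees)

lemma pred_ulam_trees:
  assumes [measurable]: "\<And>u. Measurable.pred M (\<lambda>x. u \<in> g x)"
  shows "Measurable.pred M (\<lambda>x. g x \<in> ulam_trees)"
proof -
  have eq: "g x \<in> ulam_trees \<longleftrightarrow> (\<forall>u. u \<in> g x \<longrightarrow> u \<in> words) \<and> [] \<in> g x \<and>
      (\<forall>u v. u @ v \<in> g x \<longrightarrow> u \<in> g x) \<and>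
      (\<forall>u. u \<in> g x \<longrightarrow> (\<exists>k::enat. \<forall>i. 1 \<le> i \<longrightarrow> (u @ [i] \<in> g x \<longleftrightarrow> enat i \<le> k)))" for x
    unfolding ulam_trees_def by blast
  show ?thesis
    unfolding eq by measurable
qed

lemma measurable_tree_of:
  assumes g[measurable]: "\<And>u. Measurable.pred M (\<lambda>x. u \<in> g x)"
  shows "(\<lambda>x. tree_of (g x)) \<in> M \<rightarrow>\<^sub>M borel"
proof -
  have [measurable]: "Measurable.pred M (\<lambda>x. g x \<in> ulam_trees)"
    using g by (rule pred_ulam_trees)
  have v[measurable]: "Measurable.pred M (\<lambda>x. u \<in> vertices (tree_of (g x)))" for u
  proof -
    define P where "P x \<longleftrightarrow> g x \<in> ulam_trees" for x
    have [measurable]: "Measurable.pred M P"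
      unfolding P_def[abs_def] by fact
    have eq: "u \<in> vertices (tree_of (g x)) \<longleftrightarrow> (P x \<and> u \<in> g x) \<or> (\<not> P x \<and> u = [])" for x
      by (simp add: vertices_tree_of P_def)
    show ?thesis
      unfolding eq by measurable
  qed
  have "(\<lambda>x. tree_of (g x)) \<in> M \<rightarrow>\<^sub>M
      sigma UNIV {{t. child_count t u \<in> V} | u V. u \<in> words \<and> open V}"
  proof (rule measurable_measure_of)
    fix S assume "S \<in> {{t. child_count t u \<in> V} | u V. u \<in> words \<and> open V}"
    then obtain u V where S: "S = {t. child_count t u \<in> V}" by auto
    have eq: "child_count t u \<in> V \<longleftrightarrow> (u \<notin> vertices t \<and> -1 \<in> V) \<or>
       (\<exists>k. ereal_of_enat k \<in> V \<and> u \<in> vertices t \<and>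
          (\<forall>i. 1 \<le> i \<longrightarrow> (u @ [i] \<in> vertices t \<longleftrightarrow> enat i \<le> k)))" for t
    proof -
      have "child_count t u = -1 \<or> (\<exists>k. child_count t u = ereal_of_enat k)"
        unfolding child_count_def by auto
      then have "child_count t u \<in> V \<longleftrightarrow> (child_count t u = -1 \<and> -1 \<in> V) \<or>
          (\<exists>k. ereal_of_enat k \<in> V \<and> child_count t u = ereal_of_enat k)"
        by auto
      then show ?thesis
        unfolding child_count_eq_iff child_count_eq_minus_one_iff .
    qed
    have "Measurable.pred M (\<lambda>x. child_count (tree_of (g x)) u \<in> V)"
      unfolding eq by measurable
    then show "(\<lambda>x. tree_of (g x)) -` S \<inter> space M \<in> sets M"
      by (simp add: S pred_def vimage_def Int_def conj_commute)
  qed auto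
  then show ?thesis
    using second_countable_borel_measurable[OF open_ulam_tree_def] by simp
qed

definition weakly_converges ::
  "('i \<Rightarrow> 'a::topological_space measure) \<Rightarrow> 'a measure \<Rightarrow> 'i filter \<Rightarrow> bool" where
  "weakly_converges \<nu> \<nu>\<^sub>0 F \<longleftrightarrow>
     (\<forall>f::'a \<Rightarrow> real. continuous_on UNIV f \<longrightarrow> bounded (range f) \<longrightarrow>
        ((\<lambda>i. \<integral>t. f t \<partial>\<nu> i) \<longlongrightarrow> (\<integral>t. f t \<partial>\<nu>\<^sub>0)) F)"


section \<open>Offspring distributions\<close>

definition geom_weight :: "real \<Rightarrow> real \<Rightarrow> nat \<Rightarrow> real" where
  "geom_weight \<eta> q k = (if k = 0 then 1 - \<eta> else \<eta> * q * (1 - q) ^ (k - 1))"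

definition geom_offspring :: "real \<Rightarrow> real \<Rightarrow> nat pmf" where
  "geom_offspring \<eta> q = embed_pmf (geom_weight \<eta> q)"

definition offspring_mean :: "real \<Rightarrow> real \<Rightarrow> real" where
  "offspring_mean \<eta> q = \<eta> / q"

definition kappa :: "real \<Rightarrow> real \<Rightarrow> real" where
  "kappa \<eta> q = (1 - \<eta>) / (1 - q)"

definition gamma1 :: "real \<Rightarrow> real" where
  "gamma1 q = 1 / (1 - q)"

text \<open>Only the values for \<open>n \<ge> 1\<close> are meaningful.\<close>

definition gamma_seq :: "real \<Rightarrow> real \<Rightarrow> nat \<Rightarrow> real" where
  "gamma_seq \<eta> q n =
     (let \<mu> = offspring_mean \<eta> q in
      if \<mu> \<noteq> 1 then (kappa \<eta> q - \<mu> ^ n) / (1 - \<mu> ^ n)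
      else 1 + (gamma1 q - 1) / real n)"

definition zeta :: "real \<Rightarrow> real \<Rightarrow> nat \<Rightarrow> real" where
  "zeta \<eta> q h =
     (let \<mu> = offspring_mean \<eta> q; \<kappa> = kappa \<eta> q in
      if \<mu> < 1 then \<mu> powi (- int h - 1) * (1 - \<mu>) * (\<kappa> - 1) / \<kappa>
      else if \<mu> = 1 then gamma1 q - 1
      else \<mu> ^ h * (\<mu> - 1) * (1 - \<kappa>))"

definition frak_offspring :: "real \<Rightarrow> real \<Rightarrow> nat pmf" where
  "frak_offspring \<eta> q =
     (if offspring_mean \<eta> q \<le> 1 then geom_offspring \<eta> q else geom_offspring q \<eta>)"

definition size_biased :: "real \<Rightarrow> real \<Rightarrow> nat \<Rightarrow> nat pmf" where
  "size_biased \<eta> q s = embed_pmf (\<lambda>n.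
     if s \<le> n then real (n choose s) * max q \<eta> ^ (s + 1) * (1 - max q \<eta>) ^ (n - s) else 0)"

definition tilde_weight :: "real \<Rightarrow> real \<Rightarrow> nat \<Rightarrow> nat \<Rightarrow> real" where
  "tilde_weight \<eta> q n k =
     gamma_seq \<eta> q (n + 1) ^ k / gamma_seq \<eta> q n * pmf (geom_offspring \<eta> q) k"

definition tilde_offspring :: "real \<Rightarrow> real \<Rightarrow> nat \<Rightarrow> enat pmf" where
  "tilde_offspring \<eta> q n =
     (if n = 0 then return_pmf \<infinity> else map_pmf enat (embed_pmf (tilde_weight \<eta> q n)))"


text \<open>\<^const>\<open>embed_pmf\<close> and \<^const>\<open>poisson_pmf\<close> are only meaningful for admissible arguments;
  the following lemmas show that all arguments used here are.\<close>

lemma pmf_embed_pmf_nat: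
  fixes f :: "nat \<Rightarrow> real"
  assumes "\<And>k. 0 \<le> f k" and "f sums 1"
  shows "pmf (embed_pmf f) k = f k"
proof (rule pmf_embed_pmf)
  show "(\<integral>\<^sup>+k. f k \<partial>count_space UNIV) = 1"
    using assms
    by (simp add: nn_integral_count_space_nat suminf_ennreal2 sums_iff)
qed (fact assms)

lemma geom_weight_nonneg: "0 \<le> \<eta> \<Longrightarrow> \<eta> \<le> 1 \<Longrightarrow> 0 \<le> q \<Longrightarrow> q \<le> 1 \<Longrightarrow> 0 \<le> geom_weight \<eta> q k"
  by (simp add: geom_weight_def)

lemma geom_weight_sums:
  assumes "\<bar>(1 - q) * z\<bar> < 1"
  shows "(\<lambda>k. z ^ k * geom_weight \<eta> q k) sums (1 - \<eta> + \<eta> * q * z / (1 - (1 - q) * z))"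
proof -
  have "(\<lambda>k. \<eta> * q * z * ((1 - q) * z) ^ k) sums (\<eta> * q * z * (1 / (1 - (1 - q) * z)))"
    using assms by (intro sums_mult geometric_sums) simp
  also have "(\<lambda>k. \<eta> * q * z * ((1 - q) * z) ^ k) = (\<lambda>k. z ^ Suc k * geom_weight \<eta> q (Suc k))"
    by (simp add: geom_weight_def power_mult_distrib mult_ac)
  finally have "(\<lambda>k. z ^ Suc k * geom_weight \<eta> q (Suc k)) sums (\<eta> * q * z / (1 - (1 - q) * z))"
    by simp
  from sums_Suc[OF this] show ?thesis
    by (simp add: geom_weight_def add.commute)
qed

lemma pmf_geom_offspring:
  assumes "0 \<le> \<eta>" "\<eta> \<le> 1" "0 < q" "q \<le> 1"
  shows "pmf (geom_offspring \<eta> q) k = geom_weight \<eta> q k"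
  unfolding geom_offspring_def
proof (rule pmf_embed_pmf_nat)
  show "geom_weight \<eta> q sums 1"
    using geom_weight_sums[of q 1 \<eta>] assms by simp
qed (use assms in \<open>simp add: geom_weight_nonneg\<close>)

lemma pmf_size_biased:
  assumes "0 < \<eta>" "\<eta> \<le> 1" "0 < q" "q < 1"
  shows "pmf (size_biased \<eta> q s) n =
     (if s \<le> n then real (n choose s) * max q \<eta> ^ (s + 1) * (1 - max q \<eta>) ^ (n - s) else 0)"
proof -
  define m where "m = max q \<eta>"
  have m: "m \<in> {0<..1}" using assms by (auto simp: m_def)
  define X where "X = map_pmf (\<lambda>k. k + s) (neg_binomial_pmf (s + 1) m)"
  have "pmf X n = (if s \<le> n then real (n choose s) * m ^ (s + 1) * (1 - m) ^ (n - s) else 0)" for n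
  proof (cases "s \<le> n")
    case True
    then have "pmf X n = pmf X ((n - s) + s)" by simp
    also have "\<dots> = pmf (neg_binomial_pmf (s + 1) m) (n - s)"
      unfolding X_def by (rule pmf_map_inj') (auto simp: inj_def)
    also have "\<dots> = real (n choose (n - s)) * m ^ (s + 1) * (1 - m) ^ (n - s)"
      using True by (subst pmf_neg_binomial[OF m]) simp
    finally show ?thesis
      using True by (simp add: binomial_symmetric[OF True])
  next
    case False
    then show ?thesis
      by (auto simp: X_def set_pmf_eq[symmetric] pmf_eq_0_set_pmf)
  qed
  then have eq: "(\<lambda>n. if s \<le> n then real (n choose s) * m ^ (s + 1) * (1 - m) ^ (n - s) else 0) = pmf X"
    by auto
  have "size_biased \<eta> q s = X"
    unfolding size_biased_def m_def[symmetric] eq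
    by (rule type_definition.Rep_inverse[OF td_pmf_embed_pmf])
  then show ?thesis
    using fun_cong[OF eq, of n] by (simp only: m_def)
qed

lemma gamma_seq_step:
  assumes "0 < \<eta>" "\<eta> \<le> 1" "0 < q" "q < 1" "1 \<le> n"
  defines "z \<equiv> gamma_seq \<eta> q (n + 1)"
  shows "0 < gamma_seq \<eta> q n" "\<bar>(1 - q) * z\<bar> < 1"
    "1 - \<eta> + \<eta> * q * z / (1 - (1 - q) * z) = gamma_seq \<eta> q n" "0 < z"
proof -
  define \<mu> where "\<mu> = \<eta> / q"
  have \<mu>: "0 < \<mu>" "\<eta> = \<mu> * q" using assms by (auto simp: \<mu>_def)
  have "0 < gamma_seq \<eta> q n \<and> 0 < z \<and> (1 - q) * z < 1 \<and>
    1 - \<eta> + \<eta> * q * z / (1 - (1 - q) * z) = gamma_seq \<eta> q n"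
  proof (cases "\<mu> = 1")
    case True
    then have eq: "\<eta> = q" using \<mu> by simp
    define r where "r = q / (1 - q)"
    have r: "0 < r" "q * (1 + r) = r" "(1 - q) * r = q"
      using assms by (auto simp: r_def field_simps)
    define x where "x = real n"
    have x: "0 < x" using assms by (simp add: x_def)
    have "gamma1 q - 1 = r"
      using assms by (simp add: gamma1_def r_def field_simps)
    then have gs: "gamma_seq \<eta> q m = 1 + r / real m" for m
      using True by (simp add: gamma_seq_def offspring_mean_def \<mu>_def)
    have g: "gamma_seq \<eta> q n = 1 + r / x" and z: "z = 1 + r / (x + 1)"
      unfolding z_def gs x_def by (simp_all add: add.commute)
    have "(1 - q) * z = 1 - q + q / (x + 1)"
      unfolding z distrib_left times_divide_eq_right r by simp
    moreover have "1 - q + q / (x + 1) = 1 - q * x / (x + 1)"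
      using x by (simp add: field_simps)
    ultimately have d: "(1 - q) * z = 1 - q * x / (x + 1)"
      by simp
    have "q * z * (x + 1) = q * x + q * (1 + r)"
      unfolding z using x by (simp add: field_simps)
    then have *: "q * z * (x + 1) = q * x + r"
      unfolding r .
    have "1 - \<eta> + \<eta> * q * z / (1 - (1 - q) * z) = 1 - q + q * z * (x + 1) / x"
      unfolding d eq using x assms by simp
    also have "\<dots> = 1 + r / x"
      unfolding * using x by (simp add: add_divide_distrib)
    finally have "1 - \<eta> + \<eta> * q * z / (1 - (1 - q) * z) = gamma_seq \<eta> q n"
      unfolding g .
    moreover have "0 < q * x / (x + 1)"
      using x assms by simp
    moreover have "0 < z" "0 < gamma_seq \<eta> q n"
      unfolding z g using x r by (auto intro: add_pos_pos)
    ultimately show ?thesis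
      unfolding d by simp
  next
    case False
    define \<kappa> where "\<kappa> = kappa \<eta> q"
    have \<kappa>: "0 \<le> \<kappa>" "(1 - q) * \<kappa> = 1 - \<eta>"
      using assms by (auto simp: \<kappa>_def kappa_def)
    define a where "a = \<mu> ^ n"
    have g: "gamma_seq \<eta> q n = (\<kappa> - a) / (1 - a)" and z: "z = (\<kappa> - \<mu> * a) / (1 - \<mu> * a)"
      using False by (auto simp: z_def gamma_seq_def offspring_mean_def \<mu>_def \<kappa>_def a_def Let_def)
    have cases: "(\<mu> < 1 \<and> 0 < a \<and> a < 1 \<and> 0 < \<mu> * a \<and> \<mu> * a < 1 \<and> 1 < \<kappa>) \<or> (1 < \<mu> \<and> 1 < a \<and> 1 < \<mu> * a \<and> \<kappa> < 1)"
    proof (cases "\<mu> < 1")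
      case True
      then have "\<eta> < q" using assms by (simp add: \<mu>_def field_simps)
      then have "1 < \<kappa>" using assms by (simp add: \<kappa>_def kappa_def field_simps)
      moreover have "0 < a" "a < 1"
        using True \<mu>(1) assms by (auto simp: a_def power_Suc_less_one intro: power_less_one_iff[THEN iffD2])
      moreover have "\<mu> * a < 1" "0 < \<mu> * a"
        using True \<mu>(1) \<open>0 < a\<close> \<open>a < 1\<close> by (auto intro: mult_strict_mono[of \<mu> 1 a 1, simplified])
      ultimately show ?thesis using True by simp
    next
      case F: False
      with False have "1 < \<mu>" by simp
      then have "q < \<eta>" using assms by (simp add: \<mu>_def field_simps)
      then have "\<kappa> < 1" using assms by (simp add: \<kappa>_def kappa_def field_simps)
      moreover have "1 < a"
        using \<open>1 < \<mu>\<close> assms by (auto simp: a_def)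
      moreover have "1 < \<mu> * a"
        using \<open>1 < \<mu>\<close> \<open>1 < a\<close> by (rule less_1_mult)
      ultimately show ?thesis using \<open>1 < \<mu>\<close> by simp
    qed
    then have ne: "1 - a \<noteq> 0" "1 - \<mu> * a \<noteq> 0" by auto
    have "(1 - q) * z = ((1 - q) * \<kappa> - (1 - q) * (\<mu> * a)) / (1 - \<mu> * a)"
      unfolding z by (simp add: right_diff_distrib)
    then have "1 - (1 - q) * z = (1 - \<mu> * a - (1 - \<eta>) + (1 - q) * (\<mu> * a)) / (1 - \<mu> * a)"
      unfolding \<kappa> using ne by (simp add: field_simps)
    also have "1 - \<mu> * a - (1 - \<eta>) + (1 - q) * (\<mu> * a) = \<eta> * (1 - a)"
      unfolding \<mu>(2) by (simp add: algebra_simps)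
    finally have d: "1 - (1 - q) * z = \<eta> * (1 - a) / (1 - \<mu> * a)" .
    have "\<eta> * q * z / (1 - (1 - q) * z) = q * (\<kappa> - \<mu> * a) / (1 - a)"
    proof -
      have "\<eta> * q * (c / m) / (\<eta> * b / m) = q * c / b" if "m \<noteq> 0" "b \<noteq> 0" for b c m
        using that assms(1) by (simp add: field_simps)
      from this[OF ne(2,1)] show ?thesis
        unfolding d unfolding z .
    qed
    then have "1 - \<eta> + \<eta> * q * z / (1 - (1 - q) * z) = ((1 - \<eta>) * (1 - a) + q * (\<kappa> - \<mu> * a)) / (1 - a)"
      using ne by (simp add: add_divide_distrib)
    also have "(1 - \<eta>) * (1 - a) + q * (\<kappa> - \<mu> * a) = (1 - \<eta>) + q * \<kappa> - a"
      using \<mu>(2) by (simp add: algebra_simps)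
    also have "(1 - \<eta>) + q * \<kappa> = \<kappa>"
      using \<kappa>(2) by (simp add: algebra_simps)
    finally have "1 - \<eta> + \<eta> * q * z / (1 - (1 - q) * z) = gamma_seq \<eta> q n"
      by (simp add: g)
    moreover have "(1 - q) * z < 1"
    proof -
      have "0 < \<eta> * (1 - a) / (1 - \<mu> * a)"
        using cases assms by (auto simp: zero_less_divide_iff mult_less_0_iff zero_less_mult_iff)
      then show ?thesis
        using d by linarith
    qed
    moreover have "0 < gamma_seq \<eta> q n" "0 < z"
      using cases unfolding g z by (auto simp: zero_less_divide_iff)
    ultimately show ?thesis
      by blast
  qed
  moreover from this have "0 < (1 - q) * z"
    using assms(4) by simp
  ultimately show "0 < gamma_seq \<eta> q n" "\<bar>(1 - q) * z\<bar> < 1"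
    "1 - \<eta> + \<eta> * q * z / (1 - (1 - q) * z) = gamma_seq \<eta> q n" "0 < z"
    by auto
qed

lemma pmf_tilde_offspring:
  assumes "0 < \<eta>" "\<eta> \<le> 1" "0 < q" "q < 1" "1 \<le> n"
  shows "pmf (tilde_offspring \<eta> q n) (enat k) = tilde_weight \<eta> q n k"
proof -
  note step = gamma_seq_step[OF assms]
  have "tilde_weight \<eta> q n = (\<lambda>k. gamma_seq \<eta> q (n + 1) ^ k * geom_weight \<eta> q k / gamma_seq \<eta> q n)"
    using assms by (simp add: fun_eq_iff tilde_weight_def pmf_geom_offspring)
  moreover have "(\<lambda>k. gamma_seq \<eta> q (n + 1) ^ k * geom_weight \<eta> q k / gamma_seq \<eta> q n) sums 1"
    using sums_divide[OF geom_weight_sums[OF step(2), of \<eta>], of "gamma_seq \<eta> q n"] step(1,3)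
    by simp
  ultimately have "tilde_weight \<eta> q n sums 1"
    by simp
  moreover have "0 \<le> tilde_weight \<eta> q n k" for k
    using step(1,4) by (simp add: tilde_weight_def)
  moreover have "pmf (map_pmf enat p) (enat k) = pmf p k" for p :: "nat pmf"
    by (rule pmf_map_inj') (auto simp: inj_def)
  ultimately show ?thesis
    using assms by (simp add: tilde_offspring_def pmf_embed_pmf_nat)
qed

lemma zeta_pos:
  assumes "0 < \<eta>" "\<eta> \<le> 1" "0 < q" "q < 1"
  shows "0 < zeta \<eta> q h"
proof -
  define \<mu> \<kappa> where "\<mu> = \<eta> / q" and "\<kappa> = (1 - \<eta>) / (1 - q)"
  have zeta: "zeta \<eta> q h =
      (if \<mu> < 1 then \<mu> powi (- int h - 1) * (1 - \<mu>) * (\<kappa> - 1) / \<kappa>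
       else if \<mu> = 1 then 1 / (1 - q) - 1
       else \<mu> ^ h * (\<mu> - 1) * (1 - \<kappa>))"
    by (simp add: zeta_def Let_def offspring_mean_def kappa_def gamma1_def \<mu>_def \<kappa>_def)
  have "0 < \<mu>" using assms by (simp add: \<mu>_def)
  consider "\<mu> < 1" | "\<mu> = 1" | "1 < \<mu>" by linarith
  then show ?thesis
  proof cases
    case 1
    then have "1 < \<kappa>" using assms by (simp add: \<mu>_def \<kappa>_def field_simps)
    then show ?thesis using 1 \<open>0 < \<mu>\<close> unfolding zeta by simp
  next
    case 2
    then show ?thesis using assms unfolding zeta by simp
  next
    case 3
    then have "\<kappa> < 1" using assms by (simp add: \<mu>_def \<kappa>_def field_simps)
    then show ?thesis using 3 \<open>0 < \<mu>\<close> unfolding zeta by simp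
  qed
qed


section \<open>The random tree \<open>\<tau>\<^sup>\<infinity>\<close>\<close>

text \<open>The law of the Galton--Watson tree with offspring law \<open>D h\<close> at generation \<open>h\<close>, built from
  independent child numbers \<open>N u\<close> attached to all words.\<close>

definition inhom_GW :: "(nat \<Rightarrow> enat pmf) \<Rightarrow> ulam_tree measure" where
  "inhom_GW D =
     distr (PiM words (\<lambda>u. measure_pmf (D (length u)))) borel
       (\<lambda>N. tree_of {u\<in>words. \<forall>v i w. u = v @ i # w \<longrightarrow> enat i \<le> N v})"

definition tau_infinity :: "real \<Rightarrow> real \<Rightarrow> ulam_tree measure" where
  "tau_infinity \<eta> q = inhom_GW (tilde_offspring \<eta> q)"


section \<open>The random tree \<open>\<tau>\<^sup>\<theta>\<close>\<close>

text \<open>A generation \<open>(L, S)\<close> consists of the set \<open>L\<close> of all vertices at some level and the set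
  \<open>S \<subseteq> L\<close> of those of type \<open>s\<close>; the vertices in \<open>L - S\<close> have type \<open>e\<close>. Given the whole past,
  the next generation depends on the current one only. Below, \<open>d\<close> is the increment of the number
  of vertices of type \<open>s\<close>, \<open>s u\<close> and \<open>k u\<close> are the numbers of children of type \<open>s\<close> and of all
  children of \<open>u\<close>, and \<open>c u\<close> is the set of the indices of the children of type \<open>s\<close>.\<close>

type_synonym generation = "word set \<times> word set"

definition next_generation :: "real \<Rightarrow> real \<Rightarrow> real \<Rightarrow> nat \<Rightarrow> generation \<Rightarrow> generation pmf" where
  "next_generation \<eta> q \<theta> h = (\<lambda>(L, S). do {
     d \<leftarrow> poisson_pmf (\<theta> * zeta \<eta> q h);
     s \<leftarrow> pmf_of_set {s \<in> S \<rightarrow>\<^sub>E {1::nat..}. (\<Sum>u\<in>S. s u) = card S + d};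
     k \<leftarrow> Pi_pmf L 0 (\<lambda>u. if u \<in> S then size_biased \<eta> q (s u) else frak_offspring \<eta> q);
     c \<leftarrow> Pi_pmf S {} (\<lambda>u. pmf_of_set {I. I \<subseteq> {1..k u} \<and> card I = s u});
     return_pmf ({u @ [i] |u i. u \<in> L \<and> i \<in> {1..k u}}, {u @ [i] |u i. u \<in> S \<and> i \<in> c u})
   })"

text \<open>Generation \<open>n\<close> given the generations \<open>\<omega> 0, \<dots>, \<omega> (n - 1)\<close>.\<close>

definition generation_kernel ::
    "real \<Rightarrow> real \<Rightarrow> real \<Rightarrow> nat \<Rightarrow> (nat \<Rightarrow> generation) \<Rightarrow> generation measure" where
  "generation_kernel \<eta> q \<theta> n \<omega> =
     (case n of
        0 \<Rightarrow> measure_pmf (return_pmf ({[]}, {[]}))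
      | Suc h \<Rightarrow> measure_pmf (next_generation \<eta> q \<theta> h (\<omega> h)))"

interpretation generations:
  Ionescu_Tulcea "generation_kernel \<eta> q \<theta>" "\<lambda>_. count_space UNIV" for \<eta> q \<theta> :: real
proof (rule Ionescu_Tulcea.intro)
  fix n :: nat
  have [measurable]: "(\<lambda>g. measure_pmf (next_generation \<eta> q \<theta> h g)) \<in>
      count_space UNIV \<rightarrow>\<^sub>M subprob_algebra (count_space UNIV)" for h
    by (simp add: measure_pmf_in_subprob_algebra)
  show "generation_kernel \<eta> q \<theta> n \<in>
      PiM {0..<n} (\<lambda>_. count_space UNIV) \<rightarrow>\<^sub>M subprob_algebra (count_space UNIV)"
    unfolding generation_kernel_def
    by (cases n) (auto simp: measure_pmf_in_subprob_algebra)
next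
  fix n :: nat and \<omega> :: "nat \<Rightarrow> generation"
  assume "\<omega> \<in> space (PiM {0..<n} (\<lambda>_. count_space UNIV))"
  show "prob_space (generation_kernel \<eta> q \<theta> n \<omega>)"
    by (cases n) (auto simp: generation_kernel_def measure_pmf.prob_space_axioms)
qed

definition generations_law :: "real \<Rightarrow> real \<Rightarrow> real \<Rightarrow> (nat \<Rightarrow> generation) measure" where
  "generations_law \<eta> q \<theta> = generations.PF.lim \<eta> q \<theta>"

definition tau :: "real \<Rightarrow> real \<Rightarrow> real \<Rightarrow> ulam_tree measure" where
  "tau \<eta> q \<theta> =
     distr (generations_law \<eta> q \<theta>) borel (\<lambda>\<omega>. tree_of (\<Union>h. fst (\<omega> h)))"


lemma prob_space_tau_infinity: "prob_space (tau_infinity \<eta> q)"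
proof -
  let ?M = "PiM words (\<lambda>u. measure_pmf (tilde_offspring \<eta> q (length u)))"
  interpret prob_space ?M
    by (intro prob_space_PiM measure_pmf.prob_space_axioms)
  have "Measurable.pred ?M
      (\<lambda>N. x \<in> {u\<in>words. \<forall>v i w. u = v @ i # w \<longrightarrow> enat i \<le> N v})" for x
  proof (cases "x \<in> words")
    case True
    have [measurable]: "(\<lambda>N. N v) \<in> ?M \<rightarrow>\<^sub>M count_space UNIV" if "v \<in> words" for v
      using measurable_component_singleton[OF that,
          of "\<lambda>u. measure_pmf (tilde_offspring \<eta> q (length u))"] by simp
    have "Measurable.pred ?M (\<lambda>N. x = v @ i # w \<longrightarrow> enat i \<le> N v)" for v i w
    proof (cases "x = v @ i # w")
      case eq: True
      with True have [measurable]: "v \<in> words" by (auto simp: words_def)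
      then show ?thesis using eq by simp
    qed simp
    then have "Measurable.pred ?M (\<lambda>N. \<forall>v i w. x = v @ i # w \<longrightarrow> enat i \<le> N v)"
      by (intro pred_intros_countable)
    then show ?thesis using True by simp
  qed simp
  then show ?thesis
    unfolding tau_infinity_def inhom_GW_def
    by (intro prob_space_distr measurable_tree_of)
qed

lemma prob_space_tau: "prob_space (tau \<eta> q \<theta>)"
proof -
  have sets: "sets (generations_law \<eta> q \<theta>) = sets (PiM UNIV (\<lambda>_. count_space UNIV))"
    unfolding generations_law_def by (rule generations.PF.sets_lim[of \<eta> q \<theta>])
  have "(\<lambda>\<omega>. restrict \<omega> {}) \<in> generations_law \<eta> q \<theta> \<rightarrow>\<^sub>M PiM {} (\<lambda>_. count_space UNIV)"
    unfolding measurable_cong_sets[OF sets refl] by (rule measurable_restrict_subset) simp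
  moreover have "prob_space (distr (generations_law \<eta> q \<theta>) (PiM {} (\<lambda>_. count_space UNIV)) (\<lambda>\<omega>. restrict \<omega> {}))"
    unfolding generations_law_def generations.distr_lim[of "{}" \<eta> q \<theta>, OF finite.emptyI]
    by (rule generations.PF.prob_space_P[of "{}" \<eta> q \<theta>]) auto
  ultimately interpret prob_space "generations_law \<eta> q \<theta>"
    by (rule prob_space_distrD)
  have coord: "(\<lambda>\<omega>. \<omega> h) \<in> generations_law \<eta> q \<theta> \<rightarrow>\<^sub>M count_space UNIV" for h
    unfolding measurable_cong_sets[OF sets refl] by (rule measurable_component_singleton) simp
  have "Measurable.pred (generations_law \<eta> q \<theta>) (\<lambda>\<omega>. u \<in> fst (\<omega> h))" for u h
    by (rule measurable_compose[OF coord]) simp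
  then have "Measurable.pred (generations_law \<eta> q \<theta>) (\<lambda>\<omega>. \<exists>h. u \<in> fst (\<omega> h))" for u
    by (intro pred_intros_countable)
  then have "Measurable.pred (generations_law \<eta> q \<theta>) (\<lambda>\<omega>. u \<in> (\<Union>h. fst (\<omega> h)))" for u
    by simp
  then show ?thesis
    unfolding tau_def by (intro prob_space_distr measurable_tree_of)
qed

end

theory Submission
  imports Defs "HOL-Real_Asymp.Real_Asymp"
begin

text \<open>Fix \<open>n\<close> and look at the first \<open>n\<close> subtrees of the root, up to some height. In \<open>\<tau>\<^sup>\<infinity>\<close> the root has
infinitely many children and all other vertices have finitely many, so such finite forests determine
the tree in the limit \<open>n \<rightarrow> \<infinity>\<close> (\<open>tendsto_tree_of_root_forests\<close>). Weak convergence then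
follows once the probability of every finite forest under \<open>\<tau>\<^sup>\<theta>\<close> is asymptotically at least its
probability under \<open>\<tau>\<^sup>\<infinity>\<close>: the latter probabilities sum to 1, so that no mass can be missing
(\<open>weakly_converges_cells\<close>). This is why only lower bounds are proved for \<open>\<tau>\<^sup>\<theta>\<close>.

The numbers of vertices of type \<open>s\<close> in successive generations have independent Poisson increments with
means \<open>\<theta> \<zeta>\<^sub>h\<close>. By Chebyshev's inequality the number in generation \<open>l\<close> is \<open>\<theta> Z\<^sub>l\<close> up to an error of order
\<open>\<theta>\<^bsup>3/4\<^esup>\<close>, where \<open>Z\<^sub>l = \<zeta>\<^sub>0 + \<dots> + \<zeta>\<^bsub>l-1\<^esub>\<close>. A uniform composition of a large number
into a proportional number of parts looks, at finitely many places, like independent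
geometric variables (\<open>composition_ratio\<close>); here their parameter is \<open>\<rho>\<^sub>l = Z\<^sub>l / Z\<^bsub>l+1\<^esub>\<close>. Hence the
first \<open>n\<close> subtrees behave in the limit like independent two-type branching processes, in which a vertex
of type \<open>s\<close> in generation \<open>l\<close> has a geometric number of children of type \<open>s\<close>. The root is different: among its
first \<open>n\<close> children the types are independent, each being \<open>s\<close> with probability \<open>m = max q \<eta>\<close>, and this
holds exactly, for every \<open>\<theta>\<close>, as long as there are enough vertices of type \<open>s\<close>
(\<open>size_biased_thinning\<close>).

It remains to forget the types. Let \<open>c = min 1 \<kappa>\<close> and \<open>\<alpha>\<^sub>l = 1 - c / \<gamma>\<^sub>l\<close>. If a vertex of generation \<open>l\<close>
has type \<open>s\<close> with probability \<open>\<alpha>\<^sub>l\<close>, then its number of children has the law of the offspring of generation \<open>l\<close> in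
\<open>\<tau>\<^sup>\<infinity>\<close>, and, given this number, the types of the children are independent and equal to
\<open>s\<close> with probability \<open>\<alpha>\<^bsub>l+1\<^esub>\<close> (\<open>vertex_weight_s\<close>, \<open>vertex_weight_e\<close>). As \<open>\<alpha>\<^sub>1 = m\<close>, the types remain independent
in all generations, and the probabilities of typed forests factorise into the weight of the
forest under \<open>\<tau>\<^sup>\<infinity>\<close> and a Bernoulli weight for the types of its last generation. This is the
induction behind \<open>typed_path_lower\<close>.\<close>

section \<open>Parameter identities\<close>

text \<open>The generating function \<open>z \<mapsto> 1 - \<eta> + \<eta> q z / (1 - (1 - q) z)\<close> of the offspring law, which maps
\<open>\<gamma>\<^bsub>l+1\<^esub>\<close> to \<open>\<gamma>\<^sub>l\<close>, has the fixed points 1 and \<open>\<kappa>\<close>; this is the smaller one.\<close>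

definition pgf_fixpoint :: "real \<Rightarrow> real \<Rightarrow> real" where
  "pgf_fixpoint \<eta> q = min 1 (kappa \<eta> q)"

text \<open>In generation \<open>l\<close> of \<open>\<tau>\<^sup>\<theta>\<close>, the number of vertices of type \<open>s\<close> is 1 plus a Poisson
variable with mean \<open>\<theta> * zeta_sum \<eta> q l\<close>.\<close>

definition zeta_sum :: "real \<Rightarrow> real \<Rightarrow> nat \<Rightarrow> real" where
  "zeta_sum \<eta> q l = (\<Sum>j<l. zeta \<eta> q j)"

text \<open>The limiting probability, as \<open>\<theta>\<close> tends to infinity, that a given vertex of generation \<open>l \<ge> 1\<close> has type \<open>s\<close>.\<close>

definition s_prob :: "real \<Rightarrow> real \<Rightarrow> nat \<Rightarrow> real" where
  "s_prob \<eta> q l = 1 - pgf_fixpoint \<eta> q / gamma_seq \<eta> q l"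

text \<open>The limiting ratio of the numbers of vertices of type \<open>s\<close> in the generations \<open>l\<close> and \<open>l + 1\<close>, and
so the limiting parameter of the geometric numbers of children of type \<open>s\<close>.\<close>

definition s_ratio :: "real \<Rightarrow> real \<Rightarrow> nat \<Rightarrow> real" where
  "s_ratio \<eta> q l = zeta_sum \<eta> q l / zeta_sum \<eta> q (Suc l)"

locale geometric_params =
  fixes \<eta> q :: real
  assumes eta: "0 < \<eta>" "\<eta> \<le> 1" and q: "0 < q" "q < 1"
begin

abbreviation m :: real where "m \<equiv> max q \<eta>"

lemma m_bounds: "0 < m" "m \<le> 1"
  using eta q by auto

lemma one_minus_m: "1 - m = (1 - q) * pgf_fixpoint \<eta> q"
proof (cases "\<eta> \<le> q")
  case True
  then have "1 \<le> kappa \<eta> q" using q by (simp add: kappa_def field_simps)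
  with True show ?thesis by (simp add: pgf_fixpoint_def)
next
  case False
  then have "kappa \<eta> q < 1" using q by (simp add: kappa_def field_simps)
  with False q show ?thesis by (simp add: pgf_fixpoint_def kappa_def)
qed

text \<open>This is the fixed point equation of the generating function after multiplication by its denominator,
which at the smaller fixed point is \<open>m\<close>, by \<open>one_minus_m\<close>.\<close>

lemma pgf_fixpoint_eq: "(1 - \<eta>) * m + \<eta> * q * pgf_fixpoint \<eta> q = pgf_fixpoint \<eta> q * m"
proof (cases "\<eta> \<le> q")
  case True
  then have "1 \<le> kappa \<eta> q" using q by (simp add: kappa_def field_simps)
  with True show ?thesis by (simp add: pgf_fixpoint_def algebra_simps)
next
  case False
  then have "kappa \<eta> q < 1" using q by (simp add: kappa_def field_simps)
  then have "pgf_fixpoint \<eta> q = kappa \<eta> q" by (simp add: pgf_fixpoint_def)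
  moreover have "(1 - q) * kappa \<eta> q = 1 - \<eta>" using q by (simp add: kappa_def)
  ultimately have "1 - \<eta> + q * pgf_fixpoint \<eta> q = pgf_fixpoint \<eta> q" by (simp add: algebra_simps)
  moreover have "(1 - \<eta>) * \<eta> + \<eta> * q * pgf_fixpoint \<eta> q = (1 - \<eta> + q * pgf_fixpoint \<eta> q) * \<eta>"
    by (simp add: algebra_simps)
  ultimately show ?thesis using False by simp
qed

lemma zeta_pos: "0 < zeta \<eta> q h"
  using zeta_pos[OF eta q] .

lemma zeta_Suc: "zeta \<eta> q (Suc h) * (\<eta> * q) = zeta \<eta> q h * m\<^sup>2"
proof -
  consider "\<eta> < q" | "\<eta> = q" | "\<eta> > q" by linarith
  then show ?thesis
  proof cases
    case 1
    then have mu: "offspring_mean \<eta> q < 1" "offspring_mean \<eta> q > 0"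
      using eta q by (auto simp: offspring_mean_def)
    have "offspring_mean \<eta> q powi (- int h - 1) = offspring_mean \<eta> q powi (- int (Suc h) - 1) * offspring_mean \<eta> q"
    proof -
      have "- int h - 1 = (- int (Suc h) - 1) + 1" by simp
      then show ?thesis using mu by (simp only:) (subst power_int_add_1, auto)
    qed
    moreover have "offspring_mean \<eta> q * q = \<eta>" using q by (simp add: offspring_mean_def)
    ultimately have "offspring_mean \<eta> q powi (- int (Suc h) - 1) * \<eta>
        = offspring_mean \<eta> q powi (- int h - 1) * q"
      by (simp add: mult.assoc)
    then show ?thesis using mu 1
      by (simp add: zeta_def Let_def power2_eq_square max_def)
  next
    case 2
    then show ?thesis using q
      by (simp add: zeta_def Let_def power2_eq_square offspring_mean_def)
  next
    case 3
    then have mu: "offspring_mean \<eta> q > 1" using q by (simp add: offspring_mean_def)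
    have "offspring_mean \<eta> q * q = \<eta>" using q by (simp add: offspring_mean_def)
    with mu 3 show ?thesis
      by (simp add: zeta_def Let_def power2_eq_square max_def mult_ac)
  qed
qed

lemma gamma_seq_1: "gamma_seq \<eta> q 1 = gamma1 q"
proof (cases "\<eta> = q")
  case True
  then show ?thesis using q by (simp add: gamma_seq_def offspring_mean_def)
next
  case False
  then have "q - \<eta> \<noteq> 0" by simp
  have "kappa \<eta> q - \<eta> / q = (q - \<eta>) / (q * (1 - q))"
    using q by (simp add: kappa_def field_simps)
  moreover have "1 - \<eta> / q = (q - \<eta>) / q" using q by (simp add: field_simps)
  ultimately show ?thesis
    using False q \<open>q - \<eta> \<noteq> 0\<close> by (simp add: gamma_seq_def offspring_mean_def gamma1_def)
qed

lemma zeta_sum_pos: "0 < l \<Longrightarrow> 0 < zeta_sum \<eta> q l"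
  unfolding zeta_sum_def by (intro sum_pos zeta_pos) auto

lemma zeta_sum_Suc: "zeta_sum \<eta> q (Suc l) = zeta_sum \<eta> q l + zeta \<eta> q l"
  by (simp add: zeta_sum_def)

text \<open>The gap between \<open>\<gamma>\<^bsub>l+1\<^esub>\<close> and the fixed point is proportional to \<open>\<zeta>\<^sub>l / Z\<^bsub>l+1\<^esub> = 1 - \<rho>\<^sub>l\<close>. This is the only
link between the sequences \<open>\<gamma>\<close> and \<open>\<zeta>\<close>. In terms of inverse gaps, the recursion of the \<open>\<gamma>\<^sub>l\<close> under the
generating function is affine, and it is the one of the \<open>Z\<^sub>l / \<zeta>\<^bsub>l-1\<^esub>\<close> up to a constant factor, in the subcritical, critical and
supercritical cases alike.\<close>

lemma gamma_seq_minus_pgf_fixpoint: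
  "(1 - q) * (gamma_seq \<eta> q (Suc l) - pgf_fixpoint \<eta> q) * zeta_sum \<eta> q (Suc l) = m * zeta \<eta> q l"
proof (induction l)
  case 0
  have "(1 - q) * gamma1 q = 1" using q by (simp add: gamma1_def)
  then have "(1 - q) * (gamma_seq \<eta> q (Suc 0) - pgf_fixpoint \<eta> q) = m"
    using gamma_seq_1 one_minus_m by (simp add: algebra_simps)
  then show ?case by (simp add: zeta_sum_def)
next
  case (Suc l)
  define z g f where "z = gamma_seq \<eta> q (Suc (Suc l))" and "g = gamma_seq \<eta> q (Suc l)"
    and "f = pgf_fixpoint \<eta> q"
  have step: "(1 - q) * z < 1" "1 - \<eta> + \<eta> * q * z / (1 - (1 - q) * z) = g"
    using gamma_seq_step[OF eta q, of "Suc l"] by (auto simp: z_def g_def)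
  have m: "1 - m = (1 - q) * f" "(1 - \<eta>) * m + \<eta> * q * f = f * m"
    using one_minus_m pgf_fixpoint_eq by (auto simp: f_def)
  let ?D = "1 - (1 - q) * z"
  have "(1 - \<eta>) * ?D + \<eta> * q * z = g * ?D"
    using step by (auto simp: field_simps)
  have D: "?D = m - (1 - q) * (z - f)" using m(1) by (simp add: algebra_simps)
  \<comment> \<open>The generating function is a Moebius map with \<open>z \<mapsto> g\<close> and \<open>f \<mapsto> f\<close>; the difference of the
    two values has the factor \<open>z - f\<close>.\<close>
  have key: "(g - f) * ?D * m = \<eta> * q * (z - f)"
  proof -
    have "(g - f) * ?D * m = (g * ?D) * m - (f * m) * ?D" by (simp add: algebra_simps)
    also have "\<dots> = ((1 - \<eta>) * ?D + \<eta> * q * z) * m - ((1 - \<eta>) * m + \<eta> * q * f) * ?D"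
      using \<open>_ = g * ?D\<close> m(2) by simp
    also have "\<dots> = \<eta> * q * (z * m - f * ?D)" by (simp add: algebra_simps)
    also have "z * m - f * ?D = z * m - f + f * (1 - q) * z" by (simp add: algebra_simps)
    also have "\<dots> = z * (m + (1 - q) * f) - f" by (simp add: algebra_simps)
    also have "m + (1 - q) * f = 1" using m(1) by simp
    finally show ?thesis by simp
  qed
  let ?Z = "zeta_sum \<eta> q (Suc l)" and ?z0 = "zeta \<eta> q l" and ?z1 = "zeta \<eta> q (Suc l)"
  have "(1 - q) * (z - f) * ?Z * (\<eta> * q) = (1 - q) * (\<eta> * q * (z - f)) * ?Z"
    by (simp add: mult_ac)
  also have "\<dots> = ((1 - q) * (g - f) * ?Z) * ?D * m"
    unfolding key[symmetric] by (simp add: mult_ac)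
  also have "\<dots> = m * ?z0 * ?D * m" using Suc by (simp add: g_def f_def)
  also have "\<dots> = ?z1 * ?D * (\<eta> * q)"
    using zeta_Suc[of l] by (simp add: power2_eq_square mult_ac)
  finally have "(1 - q) * (z - f) * ?Z = ?z1 * ?D" using eta q by simp
  then have "(1 - q) * (z - f) * (?Z + ?z1) = m * ?z1"
    unfolding D by (simp add: algebra_simps)
  then show ?case unfolding zeta_sum_Suc[of "Suc l"] z_def f_def .
qed

lemma gamma_seq_pos: "0 < gamma_seq \<eta> q (Suc l)"
  using gamma_seq_step(1)[OF eta q, of "Suc l"] by simp

lemma s_prob_1: "s_prob \<eta> q (Suc 0) = m"
proof -
  have "s_prob \<eta> q (Suc 0) = 1 - (1 - q) * pgf_fixpoint \<eta> q"
    using gamma_seq_1 by (simp add: s_prob_def gamma1_def mult.commute)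
  then show ?thesis using one_minus_m by linarith
qed

lemma one_minus_s_ratio: "1 - s_ratio \<eta> q l = zeta \<eta> q l / zeta_sum \<eta> q (Suc l)"
  using zeta_sum_pos[of "Suc l"] by (simp add: s_ratio_def zeta_sum_Suc field_simps)

text \<open>Off the degenerate case \<open>c = 0\<close>, this is the description of the offspring law of type \<open>e\<close> by exponential tilting
with the fixed point \<open>c\<close>.\<close>

lemma pmf_frak: "pgf_fixpoint \<eta> q * pmf (frak_offspring \<eta> q) k
    = pgf_fixpoint \<eta> q ^ k * pmf (geom_offspring \<eta> q) k"
proof (cases "\<eta> \<le> q")
  case True
  then have "1 \<le> kappa \<eta> q" "offspring_mean \<eta> q \<le> 1"
    using q by (auto simp: kappa_def offspring_mean_def field_simps)
  then show ?thesis by (simp add: pgf_fixpoint_def frak_offspring_def)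
next
  case False
  then have "kappa \<eta> q < 1" "\<not> offspring_mean \<eta> q \<le> 1"
    using q by (auto simp: kappa_def offspring_mean_def field_simps)
  then have f: "pgf_fixpoint \<eta> q = kappa \<eta> q" "frak_offspring \<eta> q = geom_offspring q \<eta>"
    by (auto simp: pgf_fixpoint_def frak_offspring_def)
  have "pmf (geom_offspring q \<eta>) k = geom_weight q \<eta> k"
    "pmf (geom_offspring \<eta> q) k = geom_weight \<eta> q k"
    using eta q by (auto intro!: pmf_geom_offspring)
  moreover have "kappa \<eta> q * geom_weight q \<eta> k = kappa \<eta> q ^ k * geom_weight \<eta> q k"
  proof (cases k)
    case 0
    then show ?thesis using q by (simp add: geom_weight_def kappa_def)
  next
    case (Suc j)
    have "1 - \<eta> = kappa \<eta> q * (1 - q)" using q by (simp add: kappa_def)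
    then show ?thesis using Suc by (simp add: geom_weight_def power_mult_distrib mult_ac)
  qed
  ultimately show ?thesis by (simp add: f)
qed

text \<open>A vertex of type \<open>e\<close> has children of type \<open>e\<close> only. Both sides are equal as \<open>1 - \<alpha>\<^sub>l = c / \<gamma>\<^sub>l\<close>, so that the
powers of \<open>\<gamma>\<^bsub>l+1\<^esub>\<close> in the tilted weight cancel.\<close>

lemma vertex_weight_e:
  "(1 - s_prob \<eta> q (Suc l)) * pmf (frak_offspring \<eta> q) k
     = tilde_weight \<eta> q (Suc l) k * (1 - s_prob \<eta> q (Suc (Suc l))) ^ k"
  using gamma_seq_pos[of l] gamma_seq_pos[of "Suc l"] pmf_frak[of k]
  by (simp add: s_prob_def tilde_weight_def power_divide)

text \<open>On the left, a vertex has type \<open>s\<close>, a geometric number \<open>s\<close> of children of type \<open>s\<close>, and given this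
a size-biased number \<open>k\<close> of children of which \<open>s\<close> prescribed ones have type \<open>s\<close>. On the right, it has
\<open>k\<close> children with independent types. Comparing the factors with exponents \<open>1\<close> and \<open>s - 1\<close> leads to the
two relations \<open>A\<close> and \<open>B\<close>, which both follow from \<open>gamma_seq_minus_pgf_fixpoint\<close>.\<close>

lemma vertex_weight_s:
  assumes "1 \<le> s" "s \<le> k"
  shows "s_prob \<eta> q (Suc l) * (s_ratio \<eta> q (Suc l) * (1 - s_ratio \<eta> q (Suc l)) ^ (s - 1))
       * (m ^ (s + 1) * (1 - m) ^ (k - s))
     = tilde_weight \<eta> q (Suc l) k
       * (s_prob \<eta> q (Suc (Suc l)) ^ s * (1 - s_prob \<eta> q (Suc (Suc l))) ^ (k - s))"
proof -
  define g z f where "g = gamma_seq \<eta> q (Suc l)" and "z = gamma_seq \<eta> q (Suc (Suc l))"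
    and "f = pgf_fixpoint \<eta> q"
  define r where "r = s_ratio \<eta> q (Suc l)"
  define Z where "Z = zeta_sum \<eta> q (Suc (Suc l))"
  have pos: "0 < g" "0 < z" "0 < Z"
    using gamma_seq_pos zeta_sum_pos by (auto simp: g_def z_def Z_def)
  have B: "(1 - r) * m = (1 - q) * (z - f)"
  proof -
    have "(1 - r) * m * Z = m * zeta \<eta> q (Suc l)"
      using pos one_minus_s_ratio[of "Suc l"] by (simp add: r_def Z_def)
    also have "\<dots> = (1 - q) * (z - f) * Z"
      using gamma_seq_minus_pgf_fixpoint[of "Suc l"] by (simp add: z_def f_def Z_def)
    finally show ?thesis using pos by simp
  qed
  have A: "(g - f) * r * m\<^sup>2 = \<eta> * q * (z - f)"
  proof -
    have "(1 - q) * ((g - f) * r * m\<^sup>2) * Z = (1 - q) * (g - f) * zeta_sum \<eta> q (Suc l) * m\<^sup>2"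
      using pos by (simp add: r_def s_ratio_def Z_def)
    also have "\<dots> = m * (zeta \<eta> q l * m\<^sup>2)"
      using gamma_seq_minus_pgf_fixpoint[of l] by (simp add: g_def f_def)
    also have "\<dots> = \<eta> * q * (m * zeta \<eta> q (Suc l))"
      using zeta_Suc[of l] by (simp add: mult_ac)
    also have "\<dots> = (1 - q) * (\<eta> * q * (z - f)) * Z"
      using gamma_seq_minus_pgf_fixpoint[of "Suc l"] by (simp add: z_def f_def Z_def mult_ac)
    finally show ?thesis using pos q by simp
  qed
  obtain j where j: "s = Suc j" using assms by (cases s) auto
  obtain i where i: "k = s + i" using assms le_Suc_ex by blast
  have p: "pmf (geom_offspring \<eta> q) k = \<eta> * q * (1 - q) ^ (j + i)"
    using eta q by (simp add: pmf_geom_offspring geom_weight_def i j)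
  have sp: "s_prob \<eta> q (Suc l) = (g - f) / g" "s_prob \<eta> q (Suc (Suc l)) = (z - f) / z"
    "1 - s_prob \<eta> q (Suc (Suc l)) = f / z"
    using pos by (auto simp: s_prob_def g_def z_def f_def field_simps)
  have "s_prob \<eta> q (Suc l) * (r * (1 - r) ^ (s - 1)) * (m ^ (s + 1) * (1 - m) ^ (k - s))
      = ((g - f) * r * m\<^sup>2) * ((1 - r) * m) ^ j * (1 - m) ^ i / g"
    by (simp add: sp j i power_mult_distrib power2_eq_square mult_ac)
  also have "\<dots> = \<eta> * q * (z - f) * ((1 - q) * (z - f)) ^ j * ((1 - q) * f) ^ i / g"
    unfolding A B one_minus_m f_def[symmetric] ..
  also have "\<dots> = \<eta> * q * (1 - q) ^ (j + i) * ((z - f) ^ s * f ^ i) / g"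
    by (simp add: j power_mult_distrib power_add mult_ac)
  also have "(z - f) ^ s * f ^ i = z ^ k * (((z - f) / z) ^ s * (f / z) ^ i)"
    using pos by (simp add: i power_add power_divide)
  also have "\<eta> * q * (1 - q) ^ (j + i) * (z ^ k * (((z - f) / z) ^ s * (f / z) ^ i)) / g
     = tilde_weight \<eta> q (Suc l) k * (((z - f) / z) ^ s * (f / z) ^ (k - s))"
    unfolding tilde_weight_def p by (simp add: z_def g_def i)
  finally show ?thesis by (subst sp(3), subst sp(2)) (simp only: r_def)
qed

end

section \<open>Concentration of Poisson variables\<close>

lemma poisson_variance:
  assumes "0 < c"
  shows "(\<lambda>k. (real k - c)\<^sup>2 * pmf (poisson_pmf c) k) sums c"
proof -
  define p where "p k = c ^ k / fact k * exp (- c)" for k :: nat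
  have p: "pmf (poisson_pmf c) = p" using assms by (intro ext) (simp add: p_def)
  have s0: "p sums 1"
    using sums_mult2[OF exp_converges[of c], of "exp (- c)"]
    by (simp add: p_def[abs_def] divide_inverse mult_ac exp_minus)
  have S: "real (Suc k) * p (Suc k) = c * p k" for k
    by (simp add: p_def divide_simps)
  have s1: "(\<lambda>k. real k * p k) sums c"
  proof -
    have "(\<lambda>k. real (Suc k) * p (Suc k)) sums (c * 1)"
      unfolding S by (intro sums_mult s0)
    from sums_Suc[OF this] show ?thesis by simp
  qed
  have s2: "(\<lambda>k. (real k)\<^sup>2 * p k) sums (c\<^sup>2 + c)"
  proof -
    have "(real (Suc k))\<^sup>2 * p (Suc k) = c * (real k * p k) + c * p k" for k
    proof -
      have "(real (Suc k))\<^sup>2 * p (Suc k) = real (Suc k) * (real (Suc k) * p (Suc k))"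
        by (simp only: power2_eq_square mult.assoc)
      also have "\<dots> = c * (real k * p k) + c * p k"
        unfolding S by (simp add: algebra_simps)
      finally show ?thesis .
    qed
    then have "(\<lambda>k. (real (Suc k))\<^sup>2 * p (Suc k)) sums (c * c + c * 1)"
      by (simp only:) (intro sums_add sums_mult s0 s1)
    from sums_Suc[OF this] show ?thesis by (simp add: power2_eq_square)
  qed
  have "(\<lambda>k. (real k)\<^sup>2 * p k - 2 * c * (real k * p k) + c\<^sup>2 * p k)
      sums ((c\<^sup>2 + c) - 2 * c * c + c\<^sup>2 * 1)"
    by (intro sums_add sums_diff sums_mult s0 s1 s2)
  then show ?thesis unfolding p by (simp add: algebra_simps power2_eq_square)
qed

lemma poisson_chebyshev:
  assumes "0 < c" "0 < r"
  shows "1 - c / r\<^sup>2 \<le> measure_pmf.prob (poisson_pmf c) {k. \<bar>real k - c\<bar> \<le> r}"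
proof -
  let ?P = "poisson_pmf c" and ?A = "{k. \<bar>real k - c\<bar> \<le> r}"
  have "emeasure ?P (- ?A) = (\<integral>\<^sup>+k. indicator (- ?A) k \<partial>?P)"
    by simp
  also have "\<dots> \<le> (\<integral>\<^sup>+k. ennreal ((real k - c)\<^sup>2 / r\<^sup>2) \<partial>?P)"
  proof (intro nn_integral_mono)
    fix k
    have "1 \<le> (real k - c)\<^sup>2 / r\<^sup>2" if "k \<notin> ?A"
      using that assms abs_le_square_iff[of r "real k - c"] by simp
    then show "indicator (- ?A) k \<le> ennreal ((real k - c)\<^sup>2 / r\<^sup>2)"
      by (auto simp: indicator_def ennreal_1[symmetric] intro!: ennreal_leI simp del: ennreal_1)
  qed
  also have "\<dots> = (\<integral>\<^sup>+k. ennreal ((real k - c)\<^sup>2 * pmf ?P k * (1 / r\<^sup>2)) \<partial>count_space UNIV)"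
    unfolding nn_integral_measure_pmf
    by (intro nn_integral_cong) (simp add: ennreal_mult[symmetric] mult_ac divide_inverse)
  also have "\<dots> = (\<Sum>k. ennreal ((real k - c)\<^sup>2 * pmf ?P k * (1 / r\<^sup>2)))"
    by (rule nn_integral_count_space_nat)
  also have "\<dots> = ennreal (c * (1 / r\<^sup>2))"
    using sums_mult2[OF poisson_variance[OF assms(1)], of "1 / r\<^sup>2"] assms
    by (intro suminf_ennreal_eq) (auto intro!: mult_nonneg_nonneg divide_nonneg_nonneg simp del: pmf_poisson)
  finally have "measure ?P (- ?A) \<le> c / r\<^sup>2"
    using assms by (simp add: measure_pmf.emeasure_eq_measure)
  moreover have "measure ?P (- ?A) = 1 - measure ?P ?A"
    using measure_pmf.prob_compl[of ?A ?P] by (simp add: Compl_eq_Diff_UNIV)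
  ultimately show ?thesis by simp
qed

section \<open>Uniform compositions\<close>

text \<open>The possible numbers of children of type \<open>s\<close> of the vertices in \<open>S\<close>, when the next generation has \<open>d\<close> more
vertices of type \<open>s\<close> than \<open>S\<close>.\<close>

definition compositions :: "'a set \<Rightarrow> nat \<Rightarrow> ('a \<Rightarrow> nat) set" where
  "compositions S d = {s \<in> S \<rightarrow>\<^sub>E {1..}. (\<Sum>u\<in>S. s u) = card S + d}"

text \<open>Stars and bars. Removing one index and summing over its value \<open>Suc j\<close> gives the parallel summation
of binomial coefficients.\<close>

lemma card_compositions:
  fixes S :: "'a set"
  assumes "finite S"
  shows "finite (compositions S d) \<and> card (compositions S d) = (card S + d - 1) choose d"
  using assms
proof (induction S arbitrary: d rule: finite_induct)
  case empty
  have "(compositions {} d :: ('a \<Rightarrow> nat) set) = (if d = 0 then {\<lambda>_. undefined} else {})"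
    by (auto simp: compositions_def)
  then show ?case by (cases d) (auto simp: binomial_eq_0)
next
  case (insert x S)
  have eq: "compositions (insert x S) d
      = (\<Union>j\<le>d. (\<lambda>s. s(x := Suc j)) ` compositions S (d - j))" (is "?l = ?r")
  proof (intro set_eqI iffI)
    fix s assume s: "s \<in> ?l"
    define t where "t = s(x := undefined)"
    have sum: "s x + (\<Sum>u\<in>S. s u) = Suc (card S) + d" and sx: "1 \<le> s x"
      and sS: "\<And>u. u \<in> S \<Longrightarrow> 1 \<le> s u" and ext: "s \<in> extensional (insert x S)"
      using s insert by (auto simp: compositions_def PiE_iff)
    have "card S \<le> (\<Sum>u\<in>S. s u)"
      using sum_mono[of S "\<lambda>_. 1" s] sS by simp
    then have le: "s x - 1 \<le> d" using sum sx by linarith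
    have "(\<Sum>u\<in>S. t u) = (\<Sum>u\<in>S. s u)"
      using insert by (intro sum.cong) (auto simp: t_def)
    then have "t \<in> compositions S (d - (s x - 1))"
      using sum sx le insert sS ext
      by (auto simp: compositions_def PiE_iff t_def extensional_def)
    moreover have "s = t(x := Suc (s x - 1))" using sx by (auto simp: t_def)
    ultimately show "s \<in> ?r" using le by blast
  next
    fix s assume "s \<in> ?r"
    then obtain j t where j: "j \<le> d" and t: "t \<in> compositions S (d - j)" and s: "s = t(x := Suc j)"
      by auto
    have "(\<Sum>u\<in>S. s u) = (\<Sum>u\<in>S. t u)"
      using insert by (intro sum.cong) (auto simp: s)
    then show "s \<in> ?l"
      using insert t j by (auto simp: compositions_def s PiE_iff extensional_def)
  qed
  have inj: "inj_on (\<lambda>s. s(x := Suc j)) (compositions S e)" for j e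
  proof (rule inj_onI)
    fix s t assume st: "s \<in> compositions S e" "t \<in> compositions S e" "s(x := Suc j) = t(x := Suc j)"
    have "s x = undefined" "t x = undefined"
      using st insert by (auto simp: compositions_def PiE_iff extensional_def)
    then show "s = t" using st(3) by (metis fun_upd_triv fun_upd_upd)
  qed
  have disj: "disjoint_family_on (\<lambda>j. (\<lambda>s. s(x := Suc j)) ` compositions S (d - j)) {..d}"
    unfolding disjoint_family_on_def
  proof (intro ballI impI)
    fix i j :: nat assume "i \<noteq> j"
    have "s(x := Suc i) \<noteq> t(x := Suc j)" for s t :: "'a \<Rightarrow> nat"
      using \<open>i \<noteq> j\<close> by (metis fun_upd_same nat.inject)
    then show "(\<lambda>s. s(x := Suc i)) ` compositions S (d - i) \<inter>
        (\<lambda>s. s(x := Suc j)) ` compositions S (d - j) = {}" by blast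
  qed
  have fin: "finite (compositions (insert x S) d)"
    unfolding eq using insert.IH by auto
  have "card (compositions (insert x S) d) = (\<Sum>j\<le>d. card ((\<lambda>s. s(x := Suc j)) ` compositions S (d - j)))"
    unfolding eq using insert.IH disj
    by (intro card_UN_disjoint) (auto simp: disjoint_family_on_def)
  also have "\<dots> = (\<Sum>j\<le>d. (card S + (d - j) - 1) choose (d - j))"
    using insert.IH inj by (simp add: card_image)
  also have "\<dots> = (\<Sum>j\<le>d. (card S + j - 1) choose j)"
    by (rule sum.reindex_bij_witness[where i="\<lambda>j. d - j" and j="\<lambda>j. d - j"]) auto
  also have "\<dots> = (card S + d) choose d"
  proof (cases "card S")
    case 0
    have "(\<Sum>j\<le>d. (j - 1) choose j) = (\<Sum>j\<le>d. if j = 0 then 1 else 0)"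
      by (intro sum.cong) (auto simp: binomial_eq_0)
    then show ?thesis using 0 by simp
  next
    case (Suc r)
    then show ?thesis using sum_choose_lower[of r d] by simp
  qed
  finally show ?case using insert fin by simp
qed

lemma card_compositions_prescribed:
  assumes "finite S" "T \<subseteq> S" and s0: "\<And>u. u \<in> T \<Longrightarrow> 1 \<le> s0 u"
    and a: "(\<Sum>u\<in>T. s0 u) = card T + a" and "a \<le> d"
  shows "card {s \<in> compositions S d. \<forall>u\<in>T. s u = s0 u}
    = (card S - card T + (d - a) - 1) choose (d - a)"
proof -
  let ?A = "{s \<in> compositions S d. \<forall>u\<in>T. s u = s0 u}"
  let ?B = "compositions (S - T) (d - a)"
  have fin: "finite T" using assms finite_subset by blast
  have card: "card S = card T + card (S - T)"
    using card_Diff_subset[OF fin assms(2)] card_mono[OF assms(1,2)] by simp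
  have split: "(\<Sum>u\<in>S. s u) = (\<Sum>u\<in>T. s u) + (\<Sum>u\<in>S - T. s u)" for s :: "'a \<Rightarrow> nat"
    using sum.subset_diff[OF assms(2,1), of s] by simp
  have "bij_betw (\<lambda>s. restrict s (S - T)) ?A ?B"
  proof (rule bij_betw_byWitness[where f'="\<lambda>t u. if u \<in> T then s0 u else t u"])
    show "\<forall>s\<in>?A. (\<lambda>u. if u \<in> T then s0 u else restrict s (S - T) u) = s"
      using assms(2) by (auto simp: compositions_def fun_eq_iff PiE_iff extensional_def)
    show "\<forall>t\<in>?B. restrict (\<lambda>u. if u \<in> T then s0 u else t u) (S - T) = t"
      by (auto simp: compositions_def fun_eq_iff PiE_iff extensional_def)
    show "(\<lambda>s. restrict s (S - T)) ` ?A \<subseteq> ?B"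
    proof safe
      fix s assume s: "s \<in> compositions S d" "\<forall>u\<in>T. s u = s0 u"
      have "(\<Sum>u\<in>T. s u) = card T + a" using a s(2) by simp
      then show "restrict s (S - T) \<in> ?B"
        using s(1) card assms split[of s] by (auto simp: compositions_def PiE_iff)
    qed
    show "(\<lambda>t u. if u \<in> T then s0 u else t u) ` ?B \<subseteq> ?A"
    proof safe
      fix t assume t: "t \<in> ?B"
      let ?s = "\<lambda>u. if u \<in> T then s0 u else t u"
      have "(\<Sum>u\<in>T. ?s u) = card T + a" "(\<Sum>u\<in>S-T. ?s u) = (\<Sum>u\<in>S-T. t u)"
        using a by auto
      then show "?s \<in> compositions S d"
        using t card assms split[of ?s] by (auto simp: compositions_def PiE_iff extensional_def)
    qed auto
  qed
  then have "card ?A = card ?B" by (rule bij_betw_same_card)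
  moreover have "card (S - T) = card S - card T" using card by simp
  ultimately show ?thesis using card_compositions[of "S - T"] assms(1) by simp
qed

text \<open>Lowering \<open>N\<close> by one multiplies the binomial coefficient by a factor of about \<open>N / (N + d)\<close>, and lowering \<open>d\<close>
by one multiplies it by about \<open>d / (N + d)\<close>; each of the \<open>b + a\<close> factors is at least the one written here. By
\<open>card_compositions_prescribed\<close>, this bounds below the probability that \<open>b\<close> parts of a uniform composition of \<open>N + d\<close> into
\<open>N\<close> parts have prescribed values of total excess \<open>a\<close>.\<close>

lemma composition_ratio:
  assumes "b < N" "a \<le> d"
  shows "real ((N + d - 1) choose d) * (((N - b) / (N + d)) ^ b * ((d - a) / (N + d)) ^ a)
     \<le> real ((N - b + (d - a) - 1) choose (d - a))"
proof -
  have 1: "real ((N + d - 1) choose d) * ((N - b) / (N + d)) ^ j \<le> real ((N - j + d - 1) choose d)"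
    if "j \<le> b" for j
    using that
  proof (induction j)
    case (Suc j)
    define n where "n = N - j + d - 1"
    have n: "n - 1 = N - Suc j + d - 1" "n - d = N - Suc j" "1 \<le> n" "n \<le> N + d"
      using Suc.prems assms by (auto simp: n_def)
    have "real ((N + d - 1) choose d) * ((N - b) / (N + d)) ^ Suc j
        \<le> real (n choose d) * ((N - b) / (N + d))"
      using mult_right_mono[OF Suc.IH, of "(N - b) / (N + d)"] Suc.prems
      by (simp add: n_def mult_ac)
    also have "\<dots> \<le> real (n choose d) * (real (n - d) / real n)"
      using n Suc.prems assms by (intro mult_left_mono frac_le) auto
    also have "\<dots> = real ((n - 1) choose d)"
    proof -
      have "real (n - d) * real (n choose d) = real n * real ((n - 1) choose d)"
        by (metis binomial_absorb_comp of_nat_mult)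
      then show ?thesis using n by (simp add: field_simps)
    qed
    finally show ?case unfolding n(1) .
  qed simp
  have 2: "real ((N - b + d - 1) choose d) * ((d - a) / (N + d)) ^ j
      \<le> real ((N - b + (d - j) - 1) choose (d - j))"
    if "j \<le> a" for j
    using that
  proof (induction j)
    case (Suc j)
    define n k where "n = N - b + (d - j) - 1" and "k = d - j"
    have n: "n - 1 = N - b + (d - Suc j) - 1" "k - 1 = d - Suc j" "1 \<le> k" "k \<le> n" "n \<le> N + d"
      using Suc.prems assms by (auto simp: n_def k_def)
    have "real ((N - b + d - 1) choose d) * ((d - a) / (N + d)) ^ Suc j
        \<le> real (n choose k) * ((d - a) / (N + d))"
      using mult_right_mono[OF Suc.IH, of "(d - a) / (N + d)"] Suc.prems
      by (simp add: n_def k_def mult_ac)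
    also have "\<dots> \<le> real (n choose k) * (real k / real n)"
      using n Suc.prems assms by (intro mult_left_mono frac_le) (auto simp: k_def)
    also have "\<dots> = real ((n - 1) choose (k - 1))"
    proof -
      have "n * ((n - 1) choose (k - 1)) = (n choose k) * k"
        using n(3,4) by (cases n; cases k) (simp_all only: Suc_times_binomial_eq diff_Suc_1)
      then have "real n * real ((n - 1) choose (k - 1)) = real (n choose k) * real k"
        by (metis of_nat_mult)
      then show ?thesis using n by (simp add: field_simps)
    qed
    finally show ?case unfolding n(1,2) .
  qed simp
  have "real ((N + d - 1) choose d) * (((N - b) / (N + d)) ^ b * ((d - a) / (N + d)) ^ a)
     \<le> real ((N - b + d - 1) choose d) * ((d - a) / (N + d)) ^ a"
    using mult_right_mono[OF 1[of b], of "((d - a) / (N + d)) ^ a"] by (simp add: mult_ac)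
  also have "\<dots> \<le> real ((N - b + (d - a) - 1) choose (d - a))"
    using 2[of a] by simp
  finally show ?thesis using assms by (simp add: of_nat_diff)
qed

section \<open>Weak convergence from lower bounds on cells\<close>

text \<open>Replace \<open>f\<close> by its infimum over the \<open>n\<close>-th cell of a point. This is a lower bound for \<open>f\<close> with
countably many values; it converges to \<open>f\<close> almost everywhere as the cells shrink, and its integral over finitely
many cells is controlled by the lower bounds for the probabilities of these cells.\<close>

lemma weakly_converges_liminf:
  fixes \<nu> :: "'i \<Rightarrow> 'a::topological_space measure" and \<nu>\<^sub>0 :: "'a measure"
    and cell :: "nat \<Rightarrow> 'a \<Rightarrow> 'b" and f :: "'a \<Rightarrow> real"
  assumes prob: "\<And>i. prob_space (\<nu> i)" "prob_space \<nu>\<^sub>0"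
    and sets: "\<And>i. sets (\<nu> i) = sets borel" "sets \<nu>\<^sub>0 = sets borel"
    and C: "countable C" and meas: "\<And>n c. c \<in> C \<Longrightarrow> {t. cell n t = c} \<in> sets borel"
    and inC: "AE t in \<nu>\<^sub>0. \<forall>n. cell n t \<in> C"
    and shrink: "AE t in \<nu>\<^sub>0. \<forall>x. (\<forall>n. cell n (x n) = cell n t) \<longrightarrow> x \<longlonglongrightarrow> t"
    and lower: "\<And>n c. c \<in> C \<Longrightarrow> \<exists>b. (b \<longlongrightarrow> measure \<nu>\<^sub>0 {t. cell n t = c}) F \<and>
        (\<forall>\<^sub>F i in F. b i \<le> measure (\<nu> i) {t. cell n t = c})"
    and f: "continuous_on UNIV f" "\<And>t. 0 \<le> f t" "\<And>t. f t \<le> B" and e: "0 < e"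
  shows "\<forall>\<^sub>F i in F. (\<integral>t. f t \<partial>\<nu>\<^sub>0) - e < (\<integral>t. f t \<partial>\<nu> i)"
proof -
  interpret N0: prob_space \<nu>\<^sub>0 by fact
  have fm: "f \<in> borel_measurable borel"
    using f(1) by (simp add: borel_measurable_continuous_onI)
  have [measurable_cong]: "sets \<nu>\<^sub>0 = sets borel" by fact
  note fm[measurable] meas[measurable]
  define G where "G n c = (if {t. cell n t = c} = {} then 0 else INF t\<in>{t. cell n t = c}. f t)" for n c
  have bdd: "bdd_below (f ` A)" for A using f(2) by (auto intro: bdd_belowI[of _ 0])
  have G0: "0 \<le> G n c" for n c
    unfolding G_def using f(2) by (auto intro!: cINF_greatest)
  have Gf: "G n (cell n t) \<le> f t" for n t
    unfolding G_def using bdd by (auto intro!: cINF_lower)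
  \<comment> \<open>\<open>h n\<close> is the infimum of \<open>f\<close> over the \<open>n\<close>-th cell, and \<open>s n m\<close> its restriction to the first \<open>m\<close> cells.\<close>
  define D where "D m = {c \<in> C. to_nat_on C c < m}" for m
  have finD: "finite (D m)" for m
  proof -
    have "inj_on (to_nat_on C) (D m)"
      using inj_on_to_nat_on[OF C] by (auto simp: D_def inj_on_def)
    moreover have "to_nat_on C ` D m \<subseteq> {..<m}" by (auto simp: D_def)
    ultimately show ?thesis using finite_imageD finite_subset by blast
  qed
  have DC: "D m \<subseteq> C" for m by (auto simp: D_def)
  define s where "s n m t = (\<Sum>c\<in>D m. G n c * indicator {t. cell n t = c} t)" for n m t
  define h where "h n t = (if cell n t \<in> C then G n (cell n t) else 0)" for n t
  have s_eq: "s n m t = (if cell n t \<in> D m then G n (cell n t) else 0)" for n m t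
    unfolding s_def using finD by (simp add: indicator_def if_distrib sum.delta cong: if_cong)
  have s_bounds: "0 \<le> s n m t" "s n m t \<le> f t" for n m t
    using G0 Gf f(2) by (auto simp: s_eq)
  have sm[measurable]: "s n m \<in> borel_measurable borel" for n m
    unfolding s_def[abs_def] using DC
    by (intro borel_measurable_sum borel_measurable_times borel_measurable_const
        borel_measurable_indicator meas) auto
  have sh: "(\<lambda>m. s n m t) \<longlonglongrightarrow> h n t" for n t
  proof (rule tendsto_eventually, rule eventually_sequentiallyI)
    fix m assume "Suc (to_nat_on C (cell n t)) \<le> m"
    then show "s n m t = h n t" by (auto simp: s_eq h_def D_def)
  qed
  have hm[measurable]: "h n \<in> borel_measurable borel" for n
    by (rule borel_measurable_LIMSEQ_real[OF sh sm])
  have h_bounds: "0 \<le> h n t" "h n t \<le> f t" for n t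
    using G0 Gf f(2) by (auto simp: h_def)
  have h_le_B: "h n t \<le> B" and s_le_B: "s n m t \<le> B" for n m t
    using order_trans[OF h_bounds(2) f(3)] order_trans[OF s_bounds(2) f(3)] by auto
  have "(\<lambda>n. \<integral>t. h n t \<partial>\<nu>\<^sub>0) \<longlonglongrightarrow> (\<integral>t. f t \<partial>\<nu>\<^sub>0)"
  proof (rule integral_dominated_convergence)
    show "integrable \<nu>\<^sub>0 (\<lambda>_. B)" by simp
    show "AE t in \<nu>\<^sub>0. (\<lambda>n. h n t) \<longlonglongrightarrow> f t"
      using inC shrink
    proof eventually_elim
      case (elim t)
      \<comment> \<open>Points that nearly realise the infimum over the cell of \<open>t\<close> converge to \<open>t\<close>.\<close>
      have "\<exists>x. cell n x = cell n t \<and> f x < h n t + 1 / real (Suc n)" for n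
      proof -
        have ne: "f ` {x. cell n x = cell n t} \<noteq> {}" by auto
        have "Inf (f ` {x. cell n x = cell n t}) < h n t + 1 / real (Suc n)"
        proof -
          have "{x. cell n x = cell n t} \<noteq> {}" by auto
          then have "h n t = Inf (f ` {x. cell n x = cell n t})"
            unfolding h_def G_def using spec[OF elim(1)] by (simp only: if_False if_True)
          then show ?thesis by simp
        qed
        then show ?thesis using cInf_lessD[OF ne] by auto
      qed
      then obtain x where x: "\<And>n. cell n (x n) = cell n t" "\<And>n. f (x n) < h n t + 1 / real (Suc n)"
        by metis
      then have "x \<longlonglongrightarrow> t" using elim by blast
      then have "(\<lambda>n. f (x n)) \<longlonglongrightarrow> f t"
        using f(1) by (intro continuous_on_tendsto_compose[OF f(1)]) auto
      then have "(\<lambda>n. f (x n) - 1 / real (Suc n)) \<longlonglongrightarrow> f t - 0"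
        by (intro tendsto_diff LIMSEQ_Suc[OF lim_1_over_n])
      then have "(\<lambda>n. f (x n) - 1 / real (Suc n)) \<longlonglongrightarrow> f t" by simp
      then show ?case
      proof (rule tendsto_sandwich[rotated 2])
        show "\<forall>\<^sub>F n in sequentially. f (x n) - 1 / real (Suc n) \<le> h n t"
          using x(2) by (intro always_eventually allI) (simp add: less_imp_le algebra_simps)
        show "\<forall>\<^sub>F n in sequentially. h n t \<le> f t" using h_bounds by simp
      qed simp
    qed
    show "AE t in \<nu>\<^sub>0. norm (h n t) \<le> B" for n
      using h_bounds h_le_B by simp
  qed measurable
  then have "\<forall>\<^sub>F n in sequentially. (\<integral>t. f t \<partial>\<nu>\<^sub>0) - e / 3 < (\<integral>t. h n t \<partial>\<nu>\<^sub>0)"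
    by (rule order_tendstoD(1)) (use e in simp)
  then obtain n where n: "(\<integral>t. f t \<partial>\<nu>\<^sub>0) - e / 3 < (\<integral>t. h n t \<partial>\<nu>\<^sub>0)"
    using eventually_happens'[OF sequentially_bot] by blast
  have "(\<lambda>m. \<integral>t. s n m t \<partial>\<nu>\<^sub>0) \<longlonglongrightarrow> (\<integral>t. h n t \<partial>\<nu>\<^sub>0)"
  proof (rule integral_dominated_convergence)
    show "integrable \<nu>\<^sub>0 (\<lambda>_. B)" by simp
    show "AE t in \<nu>\<^sub>0. norm (s n m t) \<le> B" for m
      using s_bounds s_le_B by simp
  qed (use sh in auto)
  then have "\<forall>\<^sub>F m in sequentially. (\<integral>t. h n t \<partial>\<nu>\<^sub>0) - e / 3 < (\<integral>t. s n m t \<partial>\<nu>\<^sub>0)"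
    by (rule order_tendstoD(1)) (use e in simp)
  then obtain m where m: "(\<integral>t. h n t \<partial>\<nu>\<^sub>0) - e / 3 < (\<integral>t. s n m t \<partial>\<nu>\<^sub>0)"
    using eventually_happens'[OF sequentially_bot] by blast
  have int_s: "(\<integral>t. s n m t \<partial>M) = (\<Sum>c\<in>D m. G n c * measure M {t. cell n t = c})"
    if "prob_space M" "sets M = sets borel" for M
  proof -
    interpret prob_space M by fact
    have "space M = UNIV" using sets_eq_imp_space_eq[OF that(2)] by simp
    then show ?thesis unfolding s_def
      using that(2) DC meas
      by (subst Bochner_Integration.integral_sum)
        (auto intro!: integrable_real_indicator emeasure_finite sum.cong simp: less_top[symmetric] subset_eq)
  qed
  have "\<forall>c\<in>D m. \<exists>b. (b \<longlongrightarrow> measure \<nu>\<^sub>0 {t. cell n t = c}) F \<and>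
        (\<forall>\<^sub>F i in F. b i \<le> measure (\<nu> i) {t. cell n t = c})"
    using lower DC by blast
  then obtain b where b: "\<And>c. c \<in> D m \<Longrightarrow> (b c \<longlongrightarrow> measure \<nu>\<^sub>0 {t. cell n t = c}) F"
    "\<And>c. c \<in> D m \<Longrightarrow> \<forall>\<^sub>F i in F. b c i \<le> measure (\<nu> i) {t. cell n t = c}"
    by metis
  have "((\<lambda>i. \<Sum>c\<in>D m. G n c * b c i) \<longlongrightarrow> (\<integral>t. s n m t \<partial>\<nu>\<^sub>0)) F"
    unfolding int_s[OF prob(2) sets(2)] using b(1) by (intro tendsto_sum tendsto_mult tendsto_const)
  then have "\<forall>\<^sub>F i in F. (\<integral>t. s n m t \<partial>\<nu>\<^sub>0) - e / 3 < (\<Sum>c\<in>D m. G n c * b c i)"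
    using e by (intro order_tendstoD(1)) auto
  moreover have "\<forall>\<^sub>F i in F. \<forall>c\<in>D m. b c i \<le> measure (\<nu> i) {t. cell n t = c}"
    using b(2) finD by (intro eventually_ball_finite) auto
  ultimately show ?thesis
  proof eventually_elim
    case (elim i)
    interpret Ni: prob_space "\<nu> i" by fact
    have [measurable_cong]: "sets (\<nu> i) = sets borel" by fact
    have int: "integrable (\<nu> i) g" if "g \<in> borel_measurable borel" "\<And>t. 0 \<le> g t" "\<And>t. g t \<le> B" for g
      using that by (intro Ni.integrable_const_bound[of _ B]) auto
    have "(\<Sum>c\<in>D m. G n c * b c i) \<le> (\<integral>t. s n m t \<partial>\<nu> i)"
      unfolding int_s[OF prob(1) sets(1)] using elim G0 by (intro sum_mono mult_left_mono) auto
    also have "\<dots> \<le> (\<integral>t. f t \<partial>\<nu> i)"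
      using s_bounds s_le_B f fm sm by (intro integral_mono int) auto
    finally show ?case using elim n m by linarith
  qed
qed

text \<open>Lower bounds for the probabilities of the cells are enough, since the limit measure
has total mass 1: for a bounded function \<open>f\<close>, the lower bound \<open>weakly_converges_liminf\<close> can be applied to both
\<open>B + f\<close> and \<open>B - f\<close>.\<close>

theorem weakly_converges_cells:
  fixes \<nu> :: "'i \<Rightarrow> 'a::topological_space measure" and \<nu>\<^sub>0 :: "'a measure"
    and cell :: "nat \<Rightarrow> 'a \<Rightarrow> 'b"
  assumes prob: "\<And>i. prob_space (\<nu> i)" "prob_space \<nu>\<^sub>0"
    and sets: "\<And>i. sets (\<nu> i) = sets borel" "sets \<nu>\<^sub>0 = sets borel"
    and cells: "countable C" "\<And>n c. c \<in> C \<Longrightarrow> {t. cell n t = c} \<in> sets borel"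
      "AE t in \<nu>\<^sub>0. \<forall>n. cell n t \<in> C"
      "AE t in \<nu>\<^sub>0. \<forall>x. (\<forall>n. cell n (x n) = cell n t) \<longrightarrow> x \<longlonglongrightarrow> t"
      "\<And>n c. c \<in> C \<Longrightarrow> \<exists>b. (b \<longlongrightarrow> measure \<nu>\<^sub>0 {t. cell n t = c}) F \<and>
        (\<forall>\<^sub>F i in F. b i \<le> measure (\<nu> i) {t. cell n t = c})"
  shows "weakly_converges \<nu> \<nu>\<^sub>0 F"
  unfolding weakly_converges_def
proof (intro allI impI)
  fix f :: "'a \<Rightarrow> real" assume f: "continuous_on UNIV f" "bounded (range f)"
  then obtain B where B: "\<And>t. \<bar>f t\<bar> \<le> B" by (auto simp: bounded_real)
  have shift: "(\<integral>t. c * f t + B \<partial>M) = c * (\<integral>t. f t \<partial>M) + B"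
    if "prob_space M" "sets M = sets borel" for M c
  proof -
    interpret prob_space M by fact
    have "f \<in> borel_measurable M"
      using f(1) borel_measurable_continuous_onI measurable_cong_sets[OF that(2) refl] by blast
    then have "integrable M f" using B by (intro integrable_const_bound[of _ B]) auto
    then show ?thesis by (simp add: prob_space)
  qed
  have ev: "\<forall>\<^sub>F i in F. (\<integral>t. c * f t + B \<partial>\<nu>\<^sub>0) - e < (\<integral>t. c * f t + B \<partial>\<nu> i)"
    if "c = 1 \<or> c = -1" "0 < e" for c e
  proof (rule weakly_converges_liminf[OF prob sets cells])
    show "continuous_on UNIV (\<lambda>t. c * f t + B)" by (intro continuous_intros f)
    show "0 \<le> c * f t + B" "c * f t + B \<le> 2 * B" for t
      using B[of t] that by (auto simp: abs_le_iff)
  qed (use that in auto)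
  show "((\<lambda>i. \<integral>t. f t \<partial>\<nu> i) \<longlongrightarrow> (\<integral>t. f t \<partial>\<nu>\<^sub>0)) F"
  proof (rule tendstoI)
    fix e :: real assume e: "0 < e"
    show "\<forall>\<^sub>F i in F. dist (\<integral>t. f t \<partial>\<nu> i) (\<integral>t. f t \<partial>\<nu>\<^sub>0) < e"
      using ev[of 1, OF disjI1[OF refl] e] ev[of "-1", OF disjI2[OF refl] e] unfolding shift[OF prob(1) sets(1)] shift[OF prob(2) sets(2)]
      by eventually_elim (auto simp: dist_real_def)
  qed
qed

section \<open>Local description of a tree with infinitely many children of the root\<close>

definition fan :: "nat \<Rightarrow> word set" where
  "fan n = {u. u \<noteq> [] \<and> hd u \<le> n}"

text \<open>One parameter bounds both the width at the root and the height, so that one sequence of cells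
exhausts the tree.\<close>

definition root_forest :: "nat \<Rightarrow> ulam_tree \<Rightarrow> word set" where
  "root_forest n t = {u \<in> vertices t. u \<in> fan n \<and> length u \<le> Suc n}"

lemma vertices_subset_words: "vertices t \<subseteq> words"
  using vertices[of t] by (auto simp: ulam_trees_def)

lemma root_in_vertices: "[] \<in> vertices t"
  using vertices[of t] by (auto simp: ulam_trees_def)

text \<open>The number of children is negative exactly at words that are not vertices.\<close>

lemma pred_vertices: "{t. u \<in> vertices t} \<in> sets borel"
proof (cases "u \<in> words")
  case True
  have "open {t. child_count t u \<in> {..< 0}}" "{t. child_count t u \<in> {..< 0}} = {t. u \<notin> vertices t}"
  proof -
    have "\<exists>v V. {t. child_count t u \<in> {..< 0}} = {t. child_count t v \<in> V} \<and> v \<in> words \<and> open V"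
      using True by (intro exI[of _ u] exI[of _ "{..< 0}"] conjI) simp_all
    then show "open {t. child_count t u \<in> {..< 0}}"
      unfolding open_ulam_tree_def by (intro generate_topology.Basis) (simp only: mem_Collect_eq)
    have "child_count t u < 0 \<longleftrightarrow> u \<notin> vertices t" for t
    proof (cases "u \<in> vertices t")
      case True
      then have "child_count t u = ereal_of_enat (THE k. \<forall>i\<ge>1. u @ [i] \<in> vertices t \<longleftrightarrow> enat i \<le> k)"
        by (simp add: child_count_def)
      also have "\<dots> \<ge> 0" by simp
      finally show ?thesis using True by simp
    next
      case False
      then show ?thesis by (simp add: child_count_def)
    qed
    then show "{t. child_count t u \<in> {..< 0}} = {t. u \<notin> vertices t}" by auto
  qed
  then have "{t. u \<notin> vertices t} \<in> sets borel" using borel_open by force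
  then have "UNIV - {t. u \<notin> vertices t} \<in> sets borel"
    using sets.compl_sets[of "{t. u \<notin> vertices t}" borel] by simp
  also have "UNIV - {t. u \<notin> vertices t} = {t. u \<in> vertices t}" by auto
  finally show ?thesis .
next
  case False
  then have "{t. u \<in> vertices t} = {}" using vertices_subset_words by auto
  then show ?thesis by simp
qed

lemma root_forest_measurable: "{t. root_forest n t = c} \<in> sets borel"
proof -
  have [measurable]: "Measurable.pred borel (\<lambda>t. u \<in> vertices t)" for u
    using pred_vertices[of u] by (simp add: pred_def)
  have "root_forest n t = c \<longleftrightarrow> (\<forall>u. u \<in> c \<longleftrightarrow> u \<in> vertices t \<and> u \<in> fan n \<and> length u \<le> Suc n)" for t
    by (auto simp: root_forest_def)
  moreover have "Measurable.pred borel (\<lambda>t. \<forall>u. u \<in> c \<longleftrightarrow> u \<in> vertices t \<and> u \<in> fan n \<and> length u \<le> Suc n)"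
    by measurable
  ultimately show ?thesis by (simp add: pred_def)
qed

text \<open>The number of children of a vertex other than the root is read off the forest as soon as \<open>n\<close> exceeds its
length and first letter. At the root, the forest only shows that there are at least \<open>n\<close> children,
which is enough, as infinity is the limit.\<close>

lemma tendsto_tree_of_root_forests:
  assumes inf: "\<And>i. 1 \<le> i \<Longrightarrow> [i] \<in> vertices t"
    and x: "\<And>n. root_forest n (x n) = root_forest n t"
  shows "x \<longlonglongrightarrow> t"
  unfolding tendsto_tree_iff
proof
  fix u :: word assume u: "u \<in> words"
  have v: "v \<in> vertices (x n) \<longleftrightarrow> v \<in> vertices t"
    if "v \<noteq> []" "hd v \<le> n" "length v \<le> Suc n" for v n
    using x[of n] that by (auto simp: root_forest_def fan_def)
  show "(\<lambda>n. child_count (x n) u) \<longlonglongrightarrow> child_count t u"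
  proof (cases "u = []")
    case True
    have "child_count t [] = ereal_of_enat \<infinity>"
      unfolding child_count_eq_iff using inf root_in_vertices by simp
    moreover have "(\<lambda>n. child_count (x n) []) \<longlonglongrightarrow> \<infinity>"
      unfolding tendsto_PInfty
    proof
      fix r :: real
      obtain N :: nat where N: "r < real N" using reals_Archimedean2 by blast
      show "\<forall>\<^sub>F n in sequentially. ereal r < child_count (x n) []"
      proof (rule eventually_sequentiallyI)
        fix n assume n: "Suc N \<le> n"
        obtain k where k: "child_count (x n) [] = ereal_of_enat k"
          using root_in_vertices by (auto simp: child_count_def)
        have "[n] \<in> vertices (x n)" using v[of "[n]" n] inf[of n] n by simp
        then have "enat n \<le> k" using k n unfolding child_count_eq_iff by auto
        then have "ereal_of_enat (enat n) \<le> ereal_of_enat k"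
          unfolding ereal_of_enat_le_iff .
        then have "ereal (real n) \<le> child_count (x n) []" using k by simp
        moreover have "ereal r < ereal (real n)" using N n by simp
        ultimately show "ereal r < child_count (x n) []" by (rule less_le_trans[rotated])
      qed
    qed
    ultimately show ?thesis using True by simp
  next
    case False
    show ?thesis
    proof (rule tendsto_eventually, rule eventually_sequentiallyI)
      fix n assume "max (hd u) (length u) \<le> n"
      then have "u \<in> vertices (x n) \<longleftrightarrow> u \<in> vertices t"
        "\<And>i. u @ [i] \<in> vertices (x n) \<longleftrightarrow> u @ [i] \<in> vertices t"
        using False v[of u n] v[of "u @ [_]" n] by auto
      then show "child_count (x n) u = child_count t u"
        by (simp add: child_count_def)
    qed
  qed
qed

section \<open>The Markov chain of generations\<close>

lemma sets_generations_law: "sets (generations_law \<eta> q \<theta>) = sets (PiM UNIV (\<lambda>_. count_space UNIV))"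
  unfolding generations_law_def by (rule generations.PF.sets_lim[of \<eta> q \<theta>])

lemma space_generations_law: "space (generations_law \<eta> q \<theta>) = UNIV"
  using sets_eq_imp_space_eq[OF sets_generations_law] by (auto simp: space_PiM)

lemma generation_measurable:
  "(\<lambda>\<omega>. \<omega> h) \<in> generations_law \<eta> q \<theta> \<rightarrow>\<^sub>M count_space UNIV"
  unfolding measurable_cong_sets[OF sets_generations_law refl]
  by (rule measurable_component_singleton) simp

lemma generations_cylinder_sets:
  "{\<omega>. \<forall>l<n. \<omega> l \<in> A l} \<in> sets (generations_law \<eta> q \<theta>)"
proof -
  note generation_measurable[measurable]
  have "Measurable.pred (generations_law \<eta> q \<theta>) (\<lambda>\<omega>. \<omega> l \<in> A l)" for l
    by (rule measurable_compose[OF generation_measurable]) simp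
  then have "Measurable.pred (generations_law \<eta> q \<theta>) (\<lambda>\<omega>. \<forall>l<n. \<omega> l \<in> A l)"
    by measurable
  then show ?thesis by (simp add: pred_def space_generations_law)
qed

lemma emeasure_generations_cylinder:
  "emeasure (generations_law \<eta> q \<theta>) {\<omega>. \<forall>l<n. \<omega> l \<in> A l}
     = emeasure (generations.C \<eta> q \<theta> 0 n (\<lambda>_. undefined)) (PiE {0..<n} A)"
proof -
  let ?M = "\<lambda>_::nat. count_space (UNIV :: generation set)"
  have X: "PiE {0..<n} A \<in> sets (PiM {0..<n} ?M)"
    by (intro sets_PiM_I_finite) auto
  have "prod_emb UNIV ?M {0..<n} (PiE {0..<n} A) = {\<omega>. \<forall>l<n. \<omega> l \<in> A l}"
    by (auto simp: prod_emb_def PiE_iff space_PiM)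
  moreover have "prod_emb {0..<n} ?M {0..<n} (PiE {0..<n} A) = PiE {0..<n} A"
    by (rule prod_emb_id) (auto simp: PiE_iff)
  ultimately show ?thesis
    using generations.lim[OF finite_atLeastLessThan X, of \<eta> q \<theta>]
      generations.emeasure_CI[OF subset_refl X, of \<eta> q \<theta>]
    unfolding generations_law_def by simp
qed

text \<open>The Markov property for cylinder sets, obtained by peeling off the last kernel of the Ionescu-Tulcea construction.\<close>

lemma emeasure_generations_cylinder_Suc:
  "emeasure (generations_law \<eta> q \<theta>) {\<omega>. \<forall>l<Suc n. \<omega> l \<in> A l}
     = (\<integral>\<^sup>+x. indicator (PiE {0..<n} A) x * emeasure (generation_kernel \<eta> q \<theta> n x) (A n)
          \<partial>generations.C \<eta> q \<theta> 0 n (\<lambda>_. undefined))"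
proof -
  let ?M = "\<lambda>_::nat. count_space (UNIV :: generation set)"
  let ?C = "generations.C \<eta> q \<theta> 0"
  have X: "PiE {0..<Suc n} A \<in> sets (PiM {0..<Suc n} ?M)"
    by (intro sets_PiM_I_finite) auto
  have sp: "space (?C n (\<lambda>_. undefined)) = space (PiM {0..<n} ?M)"
    using generations.space_C[of "\<lambda>_. undefined" 0 \<eta> q \<theta> n] by (simp add: space_PiM)
  have ne: "space (?C n (\<lambda>_. undefined)) \<noteq> {}"
    unfolding sp by (auto simp: space_PiM PiE_eq_empty_iff)
  have st: "sets (?C n (\<lambda>_. undefined)) = sets (PiM {0..<n} ?M)"
    using generations.sets_C[of "\<lambda>_. undefined" 0 \<eta> q \<theta> n] by (simp add: space_PiM)
  have meas: "generations.eP \<eta> q \<theta> n \<in> ?C n (\<lambda>_. undefined) \<rightarrow>\<^sub>M subprob_algebra (PiM {0..<Suc n} ?M)"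
    unfolding measurable_cong_sets[OF st refl] by (rule generations.measurable_eP)
  have "emeasure (generations_law \<eta> q \<theta>) {\<omega>. \<forall>l<Suc n. \<omega> l \<in> A l}
     = emeasure (?C (Suc n) (\<lambda>_. undefined)) (PiE {0..<Suc n} A)"
    by (rule emeasure_generations_cylinder)
  also have "\<dots> = (\<integral>\<^sup>+x. emeasure (generations.eP \<eta> q \<theta> n x) (PiE {0..<Suc n} A) \<partial>?C n (\<lambda>_. undefined))"
    using emeasure_bind[OF ne meas X] by simp
  also have "\<dots> = (\<integral>\<^sup>+x. indicator (PiE {0..<n} A) x * emeasure (generation_kernel \<eta> q \<theta> n x) (A n)
          \<partial>?C n (\<lambda>_. undefined))"
  proof (rule nn_integral_cong)
    fix x assume x: "x \<in> space (?C n (\<lambda>_. undefined))"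
    have e: "emeasure (generations.eP \<eta> q \<theta> n x) (PiE {0..<Suc n} A)
        = emeasure (generation_kernel \<eta> q \<theta> n x) (fun_upd x n -` PiE {0..<Suc n} A \<inter> space (count_space UNIV))"
      using generations.emeasure_eP[OF x[unfolded sp] X] .
    have xe: "x \<in> extensional {0..<n}" using x unfolding sp by (auto simp: space_PiM PiE_iff)
    have "fun_upd x n -` PiE {0..<Suc n} A = (if x \<in> PiE {0..<n} A then A n else {})"
    proof (cases "x \<in> PiE {0..<n} A")
      case True
      then show ?thesis by (auto simp: PiE_iff extensional_def atLeast0_lessThan_Suc)
    next
      case False
      then obtain l where "l < n" "x l \<notin> A l" using xe by (auto simp: PiE_iff)
      then have "x(n := y) \<notin> PiE {0..<Suc n} A" for y
        by (auto simp: PiE_iff intro!: bexI[of _ l])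
      then show ?thesis using False by auto
    qed
    then show "emeasure (generations.eP \<eta> q \<theta> n x) (PiE {0..<Suc n} A)
        = indicator (PiE {0..<n} A) x * emeasure (generation_kernel \<eta> q \<theta> n x) (A n)"
      unfolding e by auto
  qed
  finally show ?thesis .
qed

lemma prob_space_generations_law: "prob_space (generations_law \<eta> q \<theta>)"
proof (rule prob_spaceI)
  let ?C = "generations.C \<eta> q \<theta> 0 0 (\<lambda>_. undefined)"
  have "emeasure (generations_law \<eta> q \<theta>) {\<omega>. \<forall>l<0. \<omega> l \<in> UNIV} = emeasure ?C (PiE {0..<0} (\<lambda>_. UNIV))"
    by (rule emeasure_generations_cylinder)
  then show "emeasure (generations_law \<eta> q \<theta>) (space (generations_law \<eta> q \<theta>)) = 1"
    by (simp add: space_generations_law sets_PiM_empty)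
qed

lemma generations_step_lower:
  assumes c: "\<And>x. (\<And>l. l < n \<Longrightarrow> x l \<in> A l) \<Longrightarrow> c \<le> measure (generation_kernel \<eta> q \<theta> n x) (A n)"
    and "0 \<le> c"
  shows "measure (generations_law \<eta> q \<theta>) {\<omega>. \<forall>l<n. \<omega> l \<in> A l} * c
    \<le> measure (generations_law \<eta> q \<theta>) {\<omega>. \<forall>l<Suc n. \<omega> l \<in> A l}"
proof -
  let ?G = "generations_law \<eta> q \<theta>"
  let ?C = "generations.C \<eta> q \<theta> 0 n (\<lambda>_. undefined)"
  interpret prob_space ?G by (rule prob_space_generations_law)
  have st: "sets ?C = sets (PiM {0..<n} (\<lambda>_. count_space UNIV))"
    using generations.sets_C[of "\<lambda>_. undefined" 0 \<eta> q \<theta> n] by (simp add: space_PiM)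
  have X: "PiE {0..<n} A \<in> sets ?C"
    unfolding st by (intro sets_PiM_I_finite) auto
  have kf: "emeasure (generation_kernel \<eta> q \<theta> n x) B = ennreal (measure (generation_kernel \<eta> q \<theta> n x) B)" for x B
    by (cases n) (auto simp: generation_kernel_def measure_pmf.emeasure_eq_measure)
  have "emeasure ?G {\<omega>. \<forall>l<n. \<omega> l \<in> A l} * ennreal c
      = (\<integral>\<^sup>+x. indicator (PiE {0..<n} A) x * ennreal c \<partial>?C)"
    unfolding emeasure_generations_cylinder using X by (subst nn_integral_multc) auto
  also have "\<dots> \<le> (\<integral>\<^sup>+x. indicator (PiE {0..<n} A) x * emeasure (generation_kernel \<eta> q \<theta> n x) (A n) \<partial>?C)"
    unfolding kf using c by (intro nn_integral_mono) (auto simp: indicator_def PiE_iff intro!: ennreal_leI)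
  also have "\<dots> = emeasure ?G {\<omega>. \<forall>l<Suc n. \<omega> l \<in> A l}"
    by (rule emeasure_generations_cylinder_Suc[symmetric])
  finally show ?thesis
    using assms(2) by (simp add: emeasure_eq_measure ennreal_mult[symmetric])
qed

lemma generations_step_null:
  assumes "\<And>x. (\<And>l. l < n \<Longrightarrow> x l \<in> A l) \<Longrightarrow> measure (generation_kernel \<eta> q \<theta> n x) (A n) = 0"
  shows "emeasure (generations_law \<eta> q \<theta>) {\<omega>. \<forall>l<Suc n. \<omega> l \<in> A l} = 0"
proof -
  have kf: "emeasure (generation_kernel \<eta> q \<theta> n x) B = ennreal (measure (generation_kernel \<eta> q \<theta> n x) B)" for x B
    by (cases n) (auto simp: generation_kernel_def measure_pmf.emeasure_eq_measure)
  have "(\<integral>\<^sup>+x. indicator (PiE {0..<n} A) x * emeasure (generation_kernel \<eta> q \<theta> n x) (A n)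
      \<partial>generations.C \<eta> q \<theta> 0 n (\<lambda>_. undefined)) = (\<integral>\<^sup>+x. 0 \<partial>generations.C \<eta> q \<theta> 0 n (\<lambda>_. undefined))"
  proof (rule nn_integral_cong)
    fix x
    show "indicator (PiE {0..<n} A) x * emeasure (generation_kernel \<eta> q \<theta> n x) (A n) = 0"
    proof (cases "x \<in> PiE {0..<n} A")
      case True
      then have "measure (generation_kernel \<eta> q \<theta> n x) (A n) = 0"
        by (intro assms) (auto simp: PiE_iff)
      then show ?thesis by (simp add: kf)
    qed simp
  qed
  then show ?thesis unfolding emeasure_generations_cylinder_Suc by simp
qed

section \<open>One generation step\<close>

text \<open>Restricting the first draw to an event and bounding the second draw below on it. The bounds for
a generation step below are chains of this rule along the draws of the step.\<close>

lemma measure_bind_pmf_ge: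
  assumes "\<And>x. x \<in> set_pmf p \<Longrightarrow> x \<in> B \<Longrightarrow> a \<le> measure (measure_pmf (f x)) A" "0 \<le> a"
  shows "measure (measure_pmf p) B * a \<le> measure (measure_pmf (bind_pmf p f)) A"
proof -
  have "emeasure p B * ennreal a = (\<integral>\<^sup>+x. indicator B x * ennreal a \<partial>p)"
    by (simp add: nn_integral_multc)
  also have "\<dots> \<le> (\<integral>\<^sup>+x. emeasure (f x) A \<partial>p)"
    using assms by (intro nn_integral_mono_AE AE_pmfI)
      (auto simp: indicator_def measure_pmf.emeasure_eq_measure intro!: ennreal_leI)
  also have "\<dots> = emeasure (bind_pmf p f) A" by simp
  finally show ?thesis
    using assms(2) by (simp add: measure_pmf.emeasure_eq_measure ennreal_mult[symmetric]
        del: emeasure_bind_pmf)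
qed

lemma prob_Pi_pmf_prescribed:
  assumes "finite A" "B \<subseteq> A"
  shows "measure_pmf.prob (Pi_pmf A dflt p) {f. \<forall>x\<in>B. f x = g x} = (\<Prod>x\<in>B. pmf (p x) (g x))"
proof -
  have "{f. \<forall>x\<in>B. f x = g x} = Pi A (\<lambda>x. if x \<in> B then {g x} else UNIV)"
    using assms(2) by (auto simp: Pi_iff split: if_splits)
  then have "measure_pmf.prob (Pi_pmf A dflt p) {f. \<forall>x\<in>B. f x = g x}
      = (\<Prod>x\<in>A. measure_pmf.prob (p x) (if x \<in> B then {g x} else UNIV))"
    using measure_Pi_pmf_Pi[OF assms(1)] by metis
  also have "\<dots> = (\<Prod>x\<in>A. if x \<in> B then pmf (p x) (g x) else 1)"
    by (intro prod.cong) (auto simp: measure_pmf_single)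
  also have "\<dots> = (\<Prod>x\<in>B. pmf (p x) (g x))"
    using assms by (simp add: prod.If_cases Int_absorb1)
  finally show ?thesis .
qed

definition children :: "(word \<Rightarrow> nat) \<Rightarrow> word set \<Rightarrow> word set" where
  "children k A = {u @ [i] |u i. u \<in> A \<and> i \<in> {1..k u}}"

text \<open>Used for all children and for the children of type \<open>s\<close> alike; \<open>c u\<close> is the set of the indices that are kept
at \<open>u\<close>.\<close>

definition successors :: "(word \<Rightarrow> nat set) \<Rightarrow> word set \<Rightarrow> word set" where
  "successors c A = {u @ [i] |u i. u \<in> A \<and> i \<in> c u}"

lemma children_conv_successors: "children k A = successors (\<lambda>u. {1..k u}) A"
  by (simp add: children_def successors_def)

lemma successors_eq_image: "successors c A = (\<lambda>(u, i). u @ [i]) ` Sigma A c"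
  by (auto simp: successors_def)

lemma finite_successors: "finite A \<Longrightarrow> (\<And>u. u \<in> A \<Longrightarrow> finite (c u)) \<Longrightarrow> finite (successors c A)"
  unfolding successors_eq_image by auto

lemma card_successors:
  "finite A \<Longrightarrow> (\<And>u. u \<in> A \<Longrightarrow> finite (c u)) \<Longrightarrow> card (successors c A) = (\<Sum>u\<in>A. card (c u))"
  unfolding successors_eq_image by (subst card_image) (auto simp: inj_on_def)

text \<open>What holds almost surely in generation \<open>h\<close>; the size of \<open>snd g\<close> is at least 1, so that the compositions
in the next step exist.\<close>

definition wf_generation :: "nat \<Rightarrow> generation \<Rightarrow> bool" where
  "wf_generation h g \<longleftrightarrow> finite (fst g) \<and> snd g \<subseteq> fst g \<and> snd g \<noteq> {} \<and>
     (\<forall>u\<in>fst g. u \<in> words \<and> length u = h)"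

definition vertex_law :: "real \<Rightarrow> real \<Rightarrow> word set \<Rightarrow> (word \<Rightarrow> nat) \<Rightarrow> word \<Rightarrow> nat pmf" where
  "vertex_law \<eta> q S s u = (if u \<in> S then size_biased \<eta> q (s u) else frak_offspring \<eta> q)"

definition subsets_of_card :: "nat \<Rightarrow> nat \<Rightarrow> nat set set" where
  "subsets_of_card k s = {I. I \<subseteq> {1..k} \<and> card I = s}"

lemma card_subsets_of_card: "card (subsets_of_card k s) = k choose s"
  unfolding subsets_of_card_def using n_subsets[of "{1..k}" s] by simp

lemma finite_subsets_of_card: "finite (subsets_of_card k s)"
  unfolding subsets_of_card_def by simp

lemma next_generation_eq:
  "next_generation \<eta> q \<theta> h (L, S) =
     bind_pmf (poisson_pmf (\<theta> * zeta \<eta> q h)) (\<lambda>d.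
     bind_pmf (pmf_of_set (compositions S d)) (\<lambda>s.
     bind_pmf (Pi_pmf L 0 (vertex_law \<eta> q S s)) (\<lambda>k.
     bind_pmf (Pi_pmf S {} (\<lambda>u. pmf_of_set (subsets_of_card (k u) (s u)))) (\<lambda>c.
     return_pmf (children k L, successors c S)))))"
  by (simp add: next_generation_def compositions_def vertex_law_def[abs_def] subsets_of_card_def
      children_def successors_def)

context
  fixes \<eta> q :: real
  assumes par: "0 < \<eta>" "\<eta> \<le> 1" "0 < q" "q < 1"
begin

lemma next_generation_draws:
  assumes wf: "wf_generation h (L, S)"
    and s: "s \<in> set_pmf (pmf_of_set (compositions S d))"
    and k: "k \<in> set_pmf (Pi_pmf L 0 (vertex_law \<eta> q S s))"
  shows "s \<in> compositions S d" "\<And>u. u \<in> S \<Longrightarrow> 1 \<le> s u \<and> s u \<le> k u"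
    and "\<And>c. c \<in> set_pmf (Pi_pmf S {} (\<lambda>u. pmf_of_set (subsets_of_card (k u) (s u)))) \<Longrightarrow>
      (\<forall>u\<in>S. c u \<subseteq> {1..k u} \<and> card (c u) = s u) \<and>
      card (successors c S) = card S + d \<and>
      wf_generation (Suc h) (children k L, successors c S)"
proof -
  have S: "finite L" "S \<subseteq> L" "finite S" "0 < card S"
    using wf finite_subset by (auto simp: wf_generation_def card_gt_0_iff)
  have "0 < card (compositions S d)"
    using card_compositions[OF S(3), of d] S(4) by (simp add: zero_less_binomial_iff)
  then show s': "s \<in> compositions S d"
    using s set_pmf_of_set[of "compositions S d"] by (simp add: card_gt_0_iff)
  show sk: "1 \<le> s u \<and> s u \<le> k u" if "u \<in> S" for u
  proof -
    have "k u \<in> set_pmf (size_biased \<eta> q (s u))"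
      using k that S by (auto simp: set_Pi_pmf PiE_dflt_def vertex_law_def)
    then have "s u \<le> k u"
      by (auto simp: set_pmf_iff pmf_size_biased[OF par] split: if_splits)
    then show ?thesis using s' that by (auto simp: compositions_def)
  qed
  fix c assume c: "c \<in> set_pmf (Pi_pmf S {} (\<lambda>u. pmf_of_set (subsets_of_card (k u) (s u))))"
  have cu: "c u \<subseteq> {1..k u} \<and> card (c u) = s u" if "u \<in> S" for u
  proof -
    have "c u \<in> set_pmf (pmf_of_set (subsets_of_card (k u) (s u)))"
      using c that S by (auto simp: set_Pi_pmf PiE_dflt_def)
    moreover have "subsets_of_card (k u) (s u) \<noteq> {}"
      using sk[OF that] card_subsets_of_card[of "k u" "s u"] by (auto simp: binomial_eq_0_iff)
    ultimately have "c u \<in> subsets_of_card (k u) (s u)"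
      using set_pmf_of_set[OF _ finite_subsets_of_card] by blast
    then show ?thesis by (simp add: subsets_of_card_def)
  qed
  have fin: "finite (c u)" if "u \<in> S" for u using cu[OF that] finite_subset by blast
  have "card (successors c S) = (\<Sum>u\<in>S. s u)"
    using S fin cu by (simp add: card_successors)
  then have card: "card (successors c S) = card S + d"
    using s' by (simp add: compositions_def)
  have "successors c S \<noteq> {}" using card S(4) by auto
  moreover have "successors c S \<subseteq> children k L"
    using cu S by (fastforce simp: successors_def children_def)
  moreover have "finite (children k L)"
    unfolding children_conv_successors using S by (intro finite_successors) auto
  moreover have "\<forall>u\<in>children k L. u \<in> words \<and> length u = Suc h"
    using wf by (auto simp: children_def wf_generation_def words_def)
  ultimately show "(\<forall>u\<in>S. c u \<subseteq> {1..k u} \<and> card (c u) = s u) \<and>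
      card (successors c S) = card S + d \<and> wf_generation (Suc h) (children k L, successors c S)"
    using cu card by (simp add: wf_generation_def)
qed

lemma next_generation_support:
  assumes "wf_generation h g" "g' \<in> set_pmf (next_generation \<eta> q \<theta> h g)"
  shows "wf_generation (Suc h) g' \<and> (\<exists>k. fst g' = children k (fst g))"
proof -
  obtain L S where g: "g = (L, S)" by fastforce
  from assms(2) obtain d s k c where dskc:
    "s \<in> set_pmf (pmf_of_set (compositions S d))"
    "k \<in> set_pmf (Pi_pmf L 0 (vertex_law \<eta> q S s))"
    "c \<in> set_pmf (Pi_pmf S {} (\<lambda>u. pmf_of_set (subsets_of_card (k u) (s u))))"
    "g' = (children k L, successors c S)"
    unfolding g next_generation_eq by auto
  show ?thesis
    using next_generation_draws(3)[OF assms(1)[unfolded g] dskc(1,2,3)] dskc(4) g by auto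
qed

text \<open>The draws of a generation step are prescribed on the finite set \<open>A\<close> of vertices only: \<open>k0\<close> and \<open>c0\<close> give the numbers of
their children and the indices of those of type \<open>s\<close>. The factor \<open>r\<close> bounds below the probability that the composition takes the prescribed values
on \<open>A\<close>; all other draws are independent over the vertices, which gives the product.\<close>

lemma next_generation_prob_ge:
  assumes wf: "wf_generation h (L, S)"
    and A: "A \<subseteq> L" and c0: "\<And>u. u \<in> A \<Longrightarrow> c0 u \<subseteq> {1..k0 u}"
    and SA: "S \<inter> A = {u \<in> A. c0 u \<noteq> {}}"
    and r: "\<And>d. d \<in> D \<Longrightarrow> r * real ((card S + d - 1) choose d)
        \<le> real (card {s \<in> compositions S d. \<forall>u\<in>S \<inter> A. s u = card (c0 u)})" "0 \<le> r"
    and E: "\<And>k c d. wf_generation (Suc h) (children k L, successors c S) \<Longrightarrow>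
        (\<And>u. u \<in> A \<Longrightarrow> k u = k0 u) \<Longrightarrow> (\<And>u. u \<in> S \<inter> A \<Longrightarrow> c u = c0 u) \<Longrightarrow> d \<in> D \<Longrightarrow>
        card (successors c S) = card S + d \<Longrightarrow> (children k L, successors c S) \<in> E"
  shows "measure_pmf.prob (poisson_pmf (\<theta> * zeta \<eta> q h)) D * (r *
      (\<Prod>u\<in>A. if c0 u \<noteq> {}
        then pmf (size_biased \<eta> q (card (c0 u))) (k0 u) / real (k0 u choose card (c0 u))
        else pmf (frak_offspring \<eta> q) (k0 u)))
    \<le> measure_pmf.prob (next_generation \<eta> q \<theta> h (L, S)) E"
proof -
  have S: "finite L" "S \<subseteq> L" "finite S" "0 < card S"
    using wf finite_subset by (auto simp: wf_generation_def card_gt_0_iff)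
  have finA: "finite A" using A S finite_subset by blast
  let ?w = "\<lambda>u. if c0 u \<noteq> {}
        then pmf (size_biased \<eta> q (card (c0 u))) (k0 u) / real (k0 u choose card (c0 u))
        else pmf (frak_offspring \<eta> q) (k0 u)"
  have w0: "0 \<le> prod ?w A" by (intro prod_nonneg) auto
  show ?thesis
    unfolding next_generation_eq
  proof (rule measure_bind_pmf_ge)
    fix d assume d: "d \<in> D"
    let ?B = "{s. \<forall>u\<in>S \<inter> A. s u = card (c0 u)}"
    let ?cp = "compositions S d"
    have cp: "finite ?cp" "card ?cp = (card S + d - 1) choose d" "0 < card ?cp"
      using card_compositions[OF S(3), of d] S(4) by (auto simp: zero_less_binomial_iff)
    have "measure (pmf_of_set ?cp) ?B = real (card (?cp \<inter> ?B)) / real (card ?cp)"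
      using cp by (subst measure_pmf_of_set) auto
    moreover have "?cp \<inter> ?B = {s \<in> ?cp. \<forall>u\<in>S \<inter> A. s u = card (c0 u)}" by auto
    ultimately have "r \<le> measure (pmf_of_set ?cp) ?B"
      using r(1)[OF d] cp by (simp add: pos_le_divide_eq)
    then have "r * prod ?w A \<le> measure (pmf_of_set ?cp) ?B * prod ?w A"
      using w0 by (rule mult_right_mono)
    also have "\<dots> \<le> measure (bind_pmf (pmf_of_set ?cp) (\<lambda>s.
       bind_pmf (Pi_pmf L 0 (vertex_law \<eta> q S s)) (\<lambda>k.
       bind_pmf (Pi_pmf S {} (\<lambda>u. pmf_of_set (subsets_of_card (k u) (s u)))) (\<lambda>c.
       return_pmf (children k L, successors c S))))) E"
    proof (rule measure_bind_pmf_ge[OF _ w0])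
      fix s assume s: "s \<in> set_pmf (pmf_of_set ?cp)" and "s \<in> ?B"
      then have sB: "s u = card (c0 u)" if "u \<in> S \<inter> A" for u using that by auto
      let ?K = "{k. \<forall>u\<in>A. k u = k0 u}"
      let ?v = "\<Prod>u\<in>S \<inter> A. 1 / real (k0 u choose card (c0 u))"
      have "prod ?w A = (\<Prod>u\<in>A. pmf (vertex_law \<eta> q S s u) (k0 u))
          * (\<Prod>u\<in>A. if u \<in> S \<inter> A then 1 / real (k0 u choose card (c0 u)) else 1)"
        unfolding prod.distrib[symmetric]
      proof (intro prod.cong refl)
        fix u assume u: "u \<in> A"
        then have "u \<in> S \<longleftrightarrow> c0 u \<noteq> {}" using SA by auto
        with u sB[of u] show "?w u = pmf (vertex_law \<eta> q S s u) (k0 u)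
            * (if u \<in> S \<inter> A then 1 / real (k0 u choose card (c0 u)) else 1)"
          by (auto simp: vertex_law_def)
      qed
      also have "(\<Prod>u\<in>A. if u \<in> S \<inter> A then 1 / real (k0 u choose card (c0 u)) else 1) = ?v"
        using finA by (simp add: prod.If_cases Int_commute Int_left_commute)
      also have "(\<Prod>u\<in>A. pmf (vertex_law \<eta> q S s u) (k0 u))
          = measure (Pi_pmf L 0 (vertex_law \<eta> q S s)) ?K"
        by (rule prob_Pi_pmf_prescribed[OF S(1) A, symmetric])
      finally have weq: "prod ?w A = measure (Pi_pmf L 0 (vertex_law \<eta> q S s)) ?K * ?v" .
      show "prod ?w A \<le> measure (bind_pmf (Pi_pmf L 0 (vertex_law \<eta> q S s)) (\<lambda>k.
         bind_pmf (Pi_pmf S {} (\<lambda>u. pmf_of_set (subsets_of_card (k u) (s u)))) (\<lambda>c.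
         return_pmf (children k L, successors c S)))) E"
        unfolding weq
      proof (rule measure_bind_pmf_ge)
        fix k assume k: "k \<in> set_pmf (Pi_pmf L 0 (vertex_law \<eta> q S s))" and "k \<in> ?K"
        then have kk: "k u = k0 u" if "u \<in> A" for u using that by auto
        let ?P = "Pi_pmf S {} (\<lambda>u. pmf_of_set (subsets_of_card (k u) (s u)))"
        let ?C = "{c. \<forall>u\<in>S \<inter> A. c u = c0 u}"
        have "measure ?P ?C = (\<Prod>u\<in>S \<inter> A. pmf (pmf_of_set (subsets_of_card (k u) (s u))) (c0 u))"
          using S by (intro prob_Pi_pmf_prescribed) auto
        also have "\<dots> = ?v"
        proof (intro prod.cong refl)
          fix u assume u: "u \<in> S \<inter> A"
          then have "c0 u \<in> subsets_of_card (k u) (s u)"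
            using c0 kk sB[OF u] by (auto simp: subsets_of_card_def)
          then show "pmf (pmf_of_set (subsets_of_card (k u) (s u))) (c0 u) = 1 / real (k0 u choose card (c0 u))"
            using u kk sB[OF u] finite_subsets_of_card card_subsets_of_card
            by (subst pmf_of_set) (auto simp: indicator_def)
        qed
        finally have "?v = measure ?P ?C * 1" by simp
        also have "\<dots> \<le> measure (bind_pmf ?P (\<lambda>c. return_pmf (children k L, successors c S))) E"
        proof (rule measure_bind_pmf_ge)
          fix c assume "c \<in> set_pmf ?P" "c \<in> ?C"
          then have "(children k L, successors c S) \<in> E"
            using next_generation_draws(3)[OF wf s k] kk d by (intro E) auto
          then show "1 \<le> measure (return_pmf (children k L, successors c S)) E"
            by (simp add: measure_return_pmf)
        qed simp
        finally show "?v \<le> measure (bind_pmf ?P (\<lambda>c. return_pmf (children k L, successors c S))) E" .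
      qed (intro prod_nonneg, auto)
    qed
    finally show "r * prod ?w A \<le> measure (bind_pmf (pmf_of_set ?cp) (\<lambda>s.
       bind_pmf (Pi_pmf L 0 (vertex_law \<eta> q S s)) (\<lambda>k.
       bind_pmf (Pi_pmf S {} (\<lambda>u. pmf_of_set (subsets_of_card (k u) (s u)))) (\<lambda>c.
       return_pmf (children k L, successors c S))))) E" .
  qed (use w0 r in auto)
qed

end

lemma card_subsets_of_card_prescribed:
  assumes "I \<subseteq> {1..n}" "card I \<le> N" "n \<le> K"
  shows "card {J \<in> subsets_of_card K N. J \<inter> {1..n} = I} = (K - n) choose (N - card I)"
proof -
  have finI: "finite I" using assms(1) finite_subset by blast
  have "bij_betw (\<lambda>J. J \<union> I) {J. J \<subseteq> {n<..K} \<and> card J = N - card I}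
      {J \<in> subsets_of_card K N. J \<inter> {1..n} = I}"
  proof (rule bij_betw_byWitness[where f'="\<lambda>J. J - I"])
    show "\<forall>J\<in>{J. J \<subseteq> {n<..K} \<and> card J = N - card I}. J \<union> I - I = J"
      using assms by fastforce
    show "\<forall>J\<in>{J \<in> subsets_of_card K N. J \<inter> {1..n} = I}. J - I \<union> I = J" by auto
    show "(\<lambda>J. J \<union> I) ` {J. J \<subseteq> {n<..K} \<and> card J = N - card I}
        \<subseteq> {J \<in> subsets_of_card K N. J \<inter> {1..n} = I}"
    proof safe
      fix J assume J: "J \<subseteq> {n<..K}" "card J = N - card I"
      have "finite J" using J finite_subset by blast
      moreover have "J \<inter> I = {}" using J assms by fastforce
      ultimately have "card (J \<union> I) = N" using J finI assms by (simp add: card_Un_disjoint)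
      moreover have "J \<union> I \<subseteq> {1..K}" using J assms by fastforce
      ultimately show "J \<union> I \<in> subsets_of_card K N" by (simp add: subsets_of_card_def)
    qed (use assms in fastforce)+
    show "(\<lambda>J. J - I) ` {J \<in> subsets_of_card K N. J \<inter> {1..n} = I}
        \<subseteq> {J. J \<subseteq> {n<..K} \<and> card J = N - card I}"
      using finI by (auto simp: subsets_of_card_def card_Diff_subset)
  qed
  then have "card {J \<in> subsets_of_card K N. J \<inter> {1..n} = I}
      = card {J. J \<subseteq> {n<..K} \<and> card J = N - card I}"
    by (simp add: bij_betw_same_card)
  also have "\<dots> = (K - n) choose (N - card I)"
    using n_subsets[of "{n<..K}" "N - card I"] by simp
  finally show ?thesis .
qed

context
  fixes \<eta> q :: real
  assumes par: "0 < \<eta>" "\<eta> \<le> 1" "0 < q" "q < 1"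
begin

text \<open>In Bernoulli trials with success probability \<open>m\<close>, the number \<open>K\<close> of trials before the \<open>(N + 1)\<close>-st success has the
size-biased law of order \<open>N\<close>, and given \<open>K\<close>, the times of the first \<open>N\<close> successes are a uniform subset of \<open>{1..K}\<close>. So
the integral is the probability that the successes among the first \<open>n\<close> trials occur at \<open>j\<close> prescribed times, where
\<open>j \<le> N\<close> ensures \<open>n \<le> K\<close>. In the computation, removing the first \<open>n\<close> trials leaves the law of order \<open>N - j\<close>.\<close>

lemma size_biased_thinning:
  assumes "j \<le> n" "j \<le> N"
  shows "(\<integral>\<^sup>+K. ennreal (if n \<le> K then real ((K - n) choose (N - j)) / real (K choose N) else 0)
      \<partial>size_biased \<eta> q N) = ennreal (max q \<eta> ^ j * (1 - max q \<eta>) ^ (n - j))"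
proof -
  define m where "m = max q \<eta>"
  have m: "0 \<le> m" "0 \<le> 1 - m" using par by (auto simp: m_def)
  let ?g = "\<lambda>K. if n \<le> K then real ((K - n) choose (N - j)) / real (K choose N) else 0"
  let ?w = "m ^ j * (1 - m) ^ (n - j)"
  define X where "X = map_pmf (\<lambda>k. k + n) (size_biased \<eta> q (N - j))"
  have eq: "pmf (size_biased \<eta> q N) K * ?g K = ?w * pmf X K" for K
  proof (cases "n \<le> K")
    case False
    then have "K \<notin> set_pmf X" by (auto simp: X_def)
    then show ?thesis using False by (simp add: set_pmf_iff)
  next
    case True
    then obtain k where k: "K = k + n" using le_Suc_ex by (metis add.commute)
    have pX: "pmf X K = pmf (size_biased \<eta> q (N - j)) k"
      unfolding X_def k by (rule pmf_map_inj') (auto simp: inj_def)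
    show ?thesis
    proof (cases "N - j \<le> k")
      case False
      then show ?thesis unfolding pX using True k by (simp add: pmf_size_biased[OF par])
    next
      case le: True
      then have N: "N \<le> K" using k assms by simp
      have e: "N + 1 = j + (N - j + 1)" "K - N = (n - j) + (k - (N - j))"
        using le k assms by auto
      have "pmf (size_biased \<eta> q N) K * ?g K = real (k choose (N - j)) * m ^ (N + 1) * (1 - m) ^ (K - N)"
        using True N by (simp add: pmf_size_biased[OF par] k m_def[symmetric])
      also have "\<dots> = ?w * (real (k choose (N - j)) * m ^ (N - j + 1) * (1 - m) ^ (k - (N - j)))"
        unfolding e by (simp add: power_add mult_ac)
      also have "\<dots> = ?w * pmf X K"
        unfolding pX using le by (simp add: pmf_size_biased[OF par] m_def[symmetric])
      finally show ?thesis .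
    qed
  qed
  have "(\<integral>\<^sup>+K. ennreal (?g K) \<partial>size_biased \<eta> q N)
      = (\<integral>\<^sup>+K. ennreal (pmf (size_biased \<eta> q N) K * ?g K) \<partial>count_space UNIV)"
    unfolding nn_integral_measure_pmf by (intro nn_integral_cong) (simp add: ennreal_mult)
  also have "\<dots> = (\<integral>\<^sup>+K. ennreal ?w * ennreal (pmf X K) \<partial>count_space UNIV)"
    unfolding eq using m by (intro nn_integral_cong) (simp add: ennreal_mult)
  also have "\<dots> = ennreal ?w" by (simp add: nn_integral_cmult nn_integral_pmf_eq_1)
  finally show ?thesis by (simp add: m_def)
qed

text \<open>The first step differs from the others, as the root has too many children for its own number of children to
be prescribed; only the types of the first \<open>n\<close> children are.\<close>

lemma root_generation_prob_ge:
  assumes I: "I \<subseteq> {1..n}" and D: "\<And>d. d \<in> D \<Longrightarrow> card I \<le> Suc d"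
    and E: "\<And>k c d. wf_generation 1 (children k {[]}, successors c {[]}) \<Longrightarrow>
        n \<le> k [] \<Longrightarrow> c [] \<inter> {1..n} = I \<Longrightarrow> d \<in> D \<Longrightarrow>
        card (successors c {[]}) = Suc d \<Longrightarrow> (children k {[]}, successors c {[]}) \<in> E"
  shows "measure_pmf.prob (poisson_pmf (\<theta> * zeta \<eta> q 0)) D
      * (max q \<eta> ^ card I * (1 - max q \<eta>) ^ (n - card I))
    \<le> measure_pmf.prob (next_generation \<eta> q \<theta> 0 ({[]}, {[]})) E"
proof -
  let ?w = "max q \<eta> ^ card I * (1 - max q \<eta>) ^ (n - card I)"
  have w0: "0 \<le> ?w" using par by (intro mult_nonneg_nonneg zero_le_power) auto
  have In: "card I \<le> n" using card_mono[OF _ I] by simp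
  have wf: "wf_generation 0 ({[]}, {[]})" by (simp add: wf_generation_def words_def)
  show ?thesis
    unfolding next_generation_eq
  proof (rule measure_bind_pmf_ge[OF _ w0])
    fix d assume d: "d \<in> D"
    let ?cp = "pmf_of_set (compositions {[]} d) :: (word \<Rightarrow> nat) pmf"
    have "measure ?cp UNIV * ?w \<le> measure (bind_pmf ?cp (\<lambda>s.
       bind_pmf (Pi_pmf {[]} 0 (vertex_law \<eta> q {[]} s)) (\<lambda>k.
       bind_pmf (Pi_pmf {[]} {} (\<lambda>u. pmf_of_set (subsets_of_card (k u) (s u)))) (\<lambda>c.
       return_pmf (children k {[]}, successors c {[]}))))) E"
    proof (rule measure_bind_pmf_ge[OF _ w0])
      fix s assume s: "s \<in> set_pmf ?cp"
      let ?Pk = "Pi_pmf {[]} 0 (vertex_law \<eta> q {[]} s)"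
      let ?f = "\<lambda>k. bind_pmf (Pi_pmf {[]} {} (\<lambda>u. pmf_of_set (subsets_of_card (k u) (s u)))) (\<lambda>c.
       return_pmf (children k {[]}, successors c {[]}))"
      define N where "N = Suc d"
      have "compositions {[]} d \<noteq> ({} :: (word \<Rightarrow> nat) set)"
        using card_compositions[of "{[] :: word}" d] by auto
      then have "s \<in> compositions {[]} d"
        using s set_pmf_of_set[of "compositions {[] :: word} d"] card_compositions[of "{[] :: word}" d] by auto
      then have sN: "s [] = N" by (simp add: compositions_def N_def)
      have jN: "card I \<le> N" using D[OF d] by (simp add: N_def)
      let ?g = "\<lambda>K. if n \<le> K then real ((K - n) choose (N - card I)) / real (K choose N) else 0"
      have Pk: "?Pk = map_pmf (\<lambda>a b. if b = [] then a else 0) (size_biased \<eta> q N)"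
        unfolding Pi_pmf_singleton by (simp add: vertex_law_def sN)
      have "ennreal ?w = (\<integral>\<^sup>+k. ennreal (?g (k [])) \<partial>?Pk)"
        unfolding Pk nn_integral_map_pmf
        by (simp only: size_biased_thinning[OF In jN] if_True refl)
      also have "\<dots> \<le> (\<integral>\<^sup>+k. emeasure (?f k) E \<partial>?Pk)"
      proof (intro nn_integral_mono_AE AE_pmfI)
        fix k assume k: "k \<in> set_pmf ?Pk"
        have sk: "1 \<le> s [] \<and> s [] \<le> k []" using next_generation_draws(2)[OF par wf s k, of "[]"] by simp
        let ?P = "Pi_pmf {[]} {} (\<lambda>u. pmf_of_set (subsets_of_card (k u) (s u))) :: (word \<Rightarrow> nat set) pmf"
        have "?g (k []) \<le> measure (?f k) E"
        proof (cases "n \<le> k []")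
          case True
          have ne: "subsets_of_card (k []) N \<noteq> {}"
            using sk card_subsets_of_card[of "k []" N] by (auto simp: binomial_eq_0_iff sN)
          have "?P = Pi_pmf {[]} {} (\<lambda>u. pmf_of_set (subsets_of_card (k []) N))"
            by (intro Pi_pmf_cong) (auto simp: sN)
          moreover have "{c :: word \<Rightarrow> nat set. c [] \<inter> {1..n} = I} = Pi {[]} (\<lambda>_. {J. J \<inter> {1..n} = I})"
            by auto
          ultimately have "measure ?P {c. c [] \<inter> {1..n} = I}
              = measure (pmf_of_set (subsets_of_card (k []) N)) {J. J \<inter> {1..n} = I}"
            using measure_Pi_pmf_Pi[of "{[] :: word}" "{}" "\<lambda>u. pmf_of_set (subsets_of_card (k []) N)"
                "\<lambda>_. {J. J \<inter> {1..n} = I}"] by simp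
          also have "\<dots> = real (card (subsets_of_card (k []) N \<inter> {J. J \<inter> {1..n} = I}))
              / real (card (subsets_of_card (k []) N))"
            by (rule measure_pmf_of_set[OF ne finite_subsets_of_card])
          also have "subsets_of_card (k []) N \<inter> {J. J \<inter> {1..n} = I}
              = {J \<in> subsets_of_card (k []) N. J \<inter> {1..n} = I}" by auto
          finally have "?g (k []) = measure ?P {c. c [] \<inter> {1..n} = I} * 1"
            using True card_subsets_of_card_prescribed[OF I jN True] card_subsets_of_card by simp
          also have "\<dots> \<le> measure (?f k) E"
          proof (rule measure_bind_pmf_ge)
            fix c assume "c \<in> set_pmf ?P" "c \<in> {c. c [] \<inter> {1..n} = I}"
            then have "(children k {[]}, successors c {[]}) \<in> E"
              using next_generation_draws(3)[OF par wf s k] True d by (intro E) auto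
            then show "1 \<le> measure (return_pmf (children k {[]}, successors c {[]})) E"
              by (simp add: measure_return_pmf)
          qed simp
          finally show ?thesis .
        qed simp
        then show "ennreal (?g (k [])) \<le> emeasure (?f k) E"
          by (simp add: measure_pmf.emeasure_eq_measure del: emeasure_bind_pmf if_split)
      qed
      also have "\<dots> = emeasure (bind_pmf ?Pk ?f) E" by simp
      finally show "?w \<le> measure (bind_pmf ?Pk ?f) E"
        by (simp add: measure_pmf.emeasure_eq_measure del: emeasure_bind_pmf)
    qed
    then show "?w \<le> measure (bind_pmf ?cp (\<lambda>s.
       bind_pmf (Pi_pmf {[]} 0 (vertex_law \<eta> q {[]} s)) (\<lambda>k.
       bind_pmf (Pi_pmf {[]} {} (\<lambda>u. pmf_of_set (subsets_of_card (k u) (s u)))) (\<lambda>c.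
       return_pmf (children k {[]}, successors c {[]}))))) E" by simp
  qed
qed

end

section \<open>Local typed forests\<close>

text \<open>The vertices of generation \<open>h + 1\<close> (the children of the root being generation 1) in the forest with \<open>n\<close> roots
\<open>[1], \<dots>, [n]\<close> and numbers of children \<open>k\<close>.\<close>

primrec forest_level :: "nat \<Rightarrow> (word \<Rightarrow> nat) \<Rightarrow> nat \<Rightarrow> word set" where
  "forest_level n k 0 = (\<lambda>i. [i]) ` {1..n}"
| "forest_level n k (Suc h) = children k (forest_level n k h)"

lemma finite_forest_level: "finite (forest_level n k h)"
  by (induction h) (auto simp: children_conv_successors intro!: finite_successors)

lemma successors_Int_fan:
  assumes "[] \<notin> S"
  shows "successors c S \<inter> fan n = successors c (S \<inter> fan n)"
proof -
  have "u @ [i] \<in> fan n \<longleftrightarrow> u \<in> fan n" if "u \<in> S" for u i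
    using that assms by (cases u) (auto simp: fan_def)
  then show ?thesis by (auto simp: successors_def)
qed

lemma successors_cong:
  "(\<And>u. u \<in> A \<Longrightarrow> c u = d u) \<Longrightarrow> successors c A = successors d A"
  by (auto simp: successors_def)

text \<open>The event, for generation \<open>l\<close> alone, that the first \<open>n\<close> subtrees agree with the given forest in
that generation.\<close>

definition path_event :: "nat \<Rightarrow> (word \<Rightarrow> nat) \<Rightarrow> nat \<Rightarrow> generation set" where
  "path_event n k l = (case l of 0 \<Rightarrow> {({[]}, {[]})}
     | Suc h \<Rightarrow> {g. wf_generation (Suc h) g \<and> fst g \<inter> fan n = forest_level n k h})"

text \<open>In addition, the types in the forest are prescribed and the total number of vertices of type \<open>s\<close> is
near its limit. The tolerance grows linearly in \<open>l\<close>, as each Poisson increment may contribute an error of \<open>\<theta>\<^bsup>3/4\<^esup>\<close>;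
it is of smaller order than the mean, and larger than the standard deviation.\<close>

definition typed_event ::
    "real \<Rightarrow> real \<Rightarrow> real \<Rightarrow> nat \<Rightarrow> (word \<Rightarrow> nat) \<Rightarrow> word set \<Rightarrow> nat \<Rightarrow> generation set" where
  "typed_event \<eta> q \<theta> n k S l = {g \<in> path_event n k l. snd g \<inter> fan n = S \<and>
     \<bar>real (card (snd g)) - \<theta> * zeta_sum \<eta> q l\<bar> \<le> real (Suc l) * \<theta> powr (3/4)}"

text \<open>The probability of the forest under \<open>\<tau>\<^sup>\<infinity>\<close>; generation \<open>Suc l\<close> is \<open>forest_level n k l\<close>.\<close>

definition forest_weight :: "real \<Rightarrow> real \<Rightarrow> nat \<Rightarrow> (word \<Rightarrow> nat) \<Rightarrow> nat \<Rightarrow> real" where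
  "forest_weight \<eta> q n k h = (\<Prod>l<h. \<Prod>u\<in>forest_level n k l. tilde_weight \<eta> q (Suc l) (k u))"

definition type_weight :: "real \<Rightarrow> 'a set \<Rightarrow> 'a set \<Rightarrow> real" where
  "type_weight p A S = p ^ card S * (1 - p) ^ (card A - card S)"

lemma type_weight_conv_prod:
  assumes "finite A" "S \<subseteq> A"
  shows "type_weight p A S = (\<Prod>u\<in>A. if u \<in> S then p else 1 - p)"
proof -
  have "card (A - S) = card A - card S" using assms by (simp add: card_Diff_subset finite_subset)
  moreover have "A \<inter> {u. u \<in> S} = S" "A \<inter> - {u. u \<in> S} = A - S" using assms by auto
  ultimately show ?thesis using assms by (simp add: prod.If_cases type_weight_def)
qed

lemma sum_type_weight:
  assumes "finite A"
  shows "(\<Sum>S\<in>Pow A. type_weight p A S) = 1"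
proof -
  have "(\<Sum>S\<in>Pow A. type_weight p A S) = (\<Sum>S\<in>Pow A. (\<Prod>u\<in>S. p) * (\<Prod>u\<in>A - S. 1 - p))"
    using assms by (intro sum.cong) (auto simp: type_weight_def card_Diff_subset finite_subset)
  also have "\<dots> = (\<Prod>u\<in>A. p + (1 - p))"
    using prod_add[OF assms, of "\<lambda>_. p" "\<lambda>_. 1 - p"] by simp
  finally show ?thesis by simp
qed

context geometric_params
begin

text \<open>The two identities for a single vertex, multiplied over the vertices of a generation: independent types in
one generation lead to independent types in the next one.\<close>

lemma local_weight_identity:
  assumes fin: "finite A" and c0: "\<And>u. u \<in> A \<Longrightarrow> c0 u \<subseteq> {1..k u}"
  defines "S \<equiv> {u \<in> A. c0 u \<noteq> {}}"
  shows "type_weight (s_prob \<eta> q (Suc l)) A S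
     * (s_ratio \<eta> q (Suc l) ^ card S * (1 - s_ratio \<eta> q (Suc l)) ^ (card (successors c0 A) - card S)
       * (\<Prod>u\<in>A. if c0 u \<noteq> {}
           then pmf (size_biased \<eta> q (card (c0 u))) (k u) / real (k u choose card (c0 u))
           else pmf (frak_offspring \<eta> q) (k u)))
   = (\<Prod>u\<in>A. tilde_weight \<eta> q (Suc l) (k u))
     * type_weight (s_prob \<eta> q (Suc (Suc l))) (children k A) (successors c0 A)"
proof -
  let ?\<alpha> = "s_prob \<eta> q (Suc l)" and ?\<beta> = "s_prob \<eta> q (Suc (Suc l))" and ?\<rho> = "s_ratio \<eta> q (Suc l)"
  have finc: "finite (c0 u)" if "u \<in> A" for u using c0[OF that] finite_subset by blast
  have cle: "card (c0 u) \<le> k u" if "u \<in> A" for u using card_mono[OF _ c0[OF that]] by simp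
  have SA: "S \<subseteq> A" and finS: "finite S" using fin by (auto simp: S_def)
  have cs: "card (successors c0 A) = (\<Sum>u\<in>A. card (c0 u))"
    using fin finc by (rule card_successors)
  have ck: "card (children k A) = (\<Sum>u\<in>A. k u)"
    unfolding children_conv_successors using fin by (subst card_successors) auto
  have "(\<Sum>u\<in>A. card (c0 u)) = (\<Sum>u\<in>S. card (c0 u))"
    using fin by (intro sum.mono_neutral_right) (auto simp: S_def)
  also have "\<dots> = (\<Sum>u\<in>S. card (c0 u) - 1) + card S"
  proof -
    have "card (c0 u) = (card (c0 u) - 1) + 1" if "u \<in> S" for u
      using that finc[of u] by (cases "card (c0 u)") (auto simp: S_def)
    then have "(\<Sum>u\<in>S. card (c0 u)) = (\<Sum>u\<in>S. (card (c0 u) - 1) + 1)" by (rule sum.cong[OF refl])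
    then show ?thesis by (simp only: sum.distrib sum_constant) simp
  qed
  finally have sub: "card (successors c0 A) - card S = (\<Sum>u\<in>S. card (c0 u) - 1)"
    using cs by simp
  have sk: "card (children k A) - card (successors c0 A) = (\<Sum>u\<in>A. k u - card (c0 u))"
    using cs ck cle by (simp add: sum_subtractf_nat)
  have ind: "(\<Prod>u\<in>S. f u) = (\<Prod>u\<in>A. if c0 u \<noteq> {} then f u else 1)" for f :: "word \<Rightarrow> real"
    using fin by (simp add: prod.If_cases S_def Int_def)
  have "?\<rho> ^ card S * (1 - ?\<rho>) ^ (card (successors c0 A) - card S)
      = (\<Prod>u\<in>S. ?\<rho> * (1 - ?\<rho>) ^ (card (c0 u) - 1))"
    unfolding sub by (simp add: prod.distrib power_sum)
  also have "\<dots> = (\<Prod>u\<in>A. if c0 u \<noteq> {} then ?\<rho> * (1 - ?\<rho>) ^ (card (c0 u) - 1) else 1)"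
    by (rule ind)
  finally have r: "?\<rho> ^ card S * (1 - ?\<rho>) ^ (card (successors c0 A) - card S) = \<dots>" .
  have t: "type_weight ?\<beta> (children k A) (successors c0 A)
      = (\<Prod>u\<in>A. ?\<beta> ^ card (c0 u) * (1 - ?\<beta>) ^ (k u - card (c0 u)))"
    unfolding type_weight_def sk unfolding cs by (simp add: prod.distrib power_sum)
  show ?thesis
    unfolding r t type_weight_conv_prod[OF fin SA] prod.distrib[symmetric]
  proof (intro prod.cong refl)
    fix u assume u: "u \<in> A"
    show "(if u \<in> S then ?\<alpha> else 1 - ?\<alpha>)
      * ((if c0 u \<noteq> {} then ?\<rho> * (1 - ?\<rho>) ^ (card (c0 u) - 1) else 1)
        * (if c0 u \<noteq> {} then pmf (size_biased \<eta> q (card (c0 u))) (k u) / real (k u choose card (c0 u))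
           else pmf (frak_offspring \<eta> q) (k u)))
      = tilde_weight \<eta> q (Suc l) (k u) * (?\<beta> ^ card (c0 u) * (1 - ?\<beta>) ^ (k u - card (c0 u)))"
    proof (cases "c0 u = {}")
      case True
      then show ?thesis using vertex_weight_e[of l "k u"] by (simp add: S_def)
    next
      case False
      then have s1: "1 \<le> card (c0 u)" using finc[OF u] by (simp add: Suc_le_eq card_gt_0_iff)
      have "real (k u choose card (c0 u)) \<noteq> 0" using cle[OF u] by (simp add: binomial_eq_0_iff)
      then have "pmf (size_biased \<eta> q (card (c0 u))) (k u) / real (k u choose card (c0 u))
          = m ^ (card (c0 u) + 1) * (1 - m) ^ (k u - card (c0 u))"
        using cle[OF u] by (simp add: pmf_size_biased[OF eta q])
      then show ?thesis
        using False u vertex_weight_s[OF s1 cle[OF u], of l] by (simp add: S_def mult.assoc)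
    qed
  qed
qed

definition poisson_bound :: "nat \<Rightarrow> real \<Rightarrow> real" where
  "poisson_bound h \<theta> = 1 - \<theta> * zeta \<eta> q h / (\<theta> powr (3/4))\<^sup>2"

definition increments :: "nat \<Rightarrow> real \<Rightarrow> nat set" where
  "increments h \<theta> = {d. \<bar>real d - \<theta> * zeta \<eta> q h\<bar> \<le> \<theta> powr (3/4)}"

lemma poisson_bound: "0 < \<theta> \<Longrightarrow> poisson_bound h \<theta>
    \<le> measure_pmf.prob (poisson_pmf (\<theta> * zeta \<eta> q h)) (increments h \<theta>)"
  unfolding poisson_bound_def increments_def
  using poisson_chebyshev[of "\<theta> * zeta \<eta> q h" "\<theta> powr (3/4)"] zeta_pos[of h] by simp

lemma poisson_bound_tendsto: "(poisson_bound h \<longlongrightarrow> 1) at_top"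
  unfolding poisson_bound_def[abs_def] by real_asymp

definition ratio_bound :: "nat \<Rightarrow> nat \<Rightarrow> nat \<Rightarrow> real \<Rightarrow> real" where
  "ratio_bound l b a \<theta> =
     ((\<theta> * zeta_sum \<eta> q l - real (Suc l) * \<theta> powr (3/4) - real b)
        / (\<theta> * zeta_sum \<eta> q (Suc l) + real (Suc (Suc l)) * \<theta> powr (3/4))) ^ b
   * ((\<theta> * zeta \<eta> q l - \<theta> powr (3/4) - real a)
        / (\<theta> * zeta_sum \<eta> q (Suc l) + real (Suc (Suc l)) * \<theta> powr (3/4))) ^ a"

lemma ratio_bound_tendsto:
  assumes "0 < l"
  shows "(ratio_bound l b a \<longlongrightarrow> s_ratio \<eta> q l ^ b * (1 - s_ratio \<eta> q l) ^ a) at_top"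
proof -
  have *: "((\<lambda>\<theta>. (\<theta> * x - c * \<theta> powr (3/4) - e) / (\<theta> * y + d * \<theta> powr (3/4))) \<longlongrightarrow> x / y) at_top"
    if "0 < y" for x y c d e :: real
    using that unfolding divide_inverse[of x y] by real_asymp
  have Z: "0 < zeta_sum \<eta> q (Suc l)" by (rule zeta_sum_pos) simp
  show ?thesis
    unfolding ratio_bound_def[abs_def] one_minus_s_ratio unfolding s_ratio_def
    using *[OF Z, of "zeta_sum \<eta> q l"] *[OF Z, of "zeta \<eta> q l" 1]
    by (intro tendsto_mult tendsto_power) simp_all
qed

text \<open>The fluctuations of order \<open>\<theta>\<^bsup>3/4\<^esup>\<close> are negligible against a mean of order \<open>\<theta>\<close>.\<close>

lemma eventually_large:
  fixes x c K :: real
  assumes "0 < x"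
  shows "\<forall>\<^sub>F \<theta> in at_top. c < \<theta> * x - K * \<theta> powr (3/4)"
proof -
  have "filterlim (\<lambda>\<theta>. \<theta> * x - K * \<theta> powr (3/4)) at_top at_top"
    using assms by real_asymp
  then show ?thesis by (simp add: filterlim_at_top_dense)
qed

lemma composition_prob_ge:
  assumes S: "finite S" "T \<subseteq> S" and s0: "\<And>u. u \<in> T \<Longrightarrow> 1 \<le> s0 u"
    and a: "(\<Sum>u\<in>T. s0 u) = card T + a"
    and N: "\<bar>real (card S) - \<theta> * zeta_sum \<eta> q l\<bar> \<le> real (Suc l) * \<theta> powr (3/4)"
    and d: "d \<in> increments l \<theta>"
    and large: "real (card T) < \<theta> * zeta_sum \<eta> q l - real (Suc l) * \<theta> powr (3/4)"
      "real a < \<theta> * zeta \<eta> q l - \<theta> powr (3/4)" "0 < \<theta>"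
  shows "ratio_bound l (card T) a \<theta> * real ((card S + d - 1) choose d)
    \<le> real (card {s \<in> compositions S d. \<forall>u\<in>T. s u = s0 u})"
proof -
  let ?Nlo = "\<theta> * zeta_sum \<eta> q l - real (Suc l) * \<theta> powr (3/4)"
  let ?dlo = "\<theta> * zeta \<eta> q l - \<theta> powr (3/4)"
  let ?hi = "\<theta> * zeta_sum \<eta> q (Suc l) + real (Suc (Suc l)) * \<theta> powr (3/4)"
  have lo: "?Nlo \<le> real (card S)" "?dlo \<le> real d"
    using N d by (auto simp: increments_def abs_le_iff)
  have "real (card S) + real d \<le> (\<theta> * zeta_sum \<eta> q l + real (Suc l) * \<theta> powr (3/4))
      + (\<theta> * zeta \<eta> q l + \<theta> powr (3/4))"
    using N d by (auto simp: increments_def abs_le_iff)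
  also have "\<dots> = ?hi" by (simp add: zeta_sum_Suc algebra_simps)
  finally have hi: "real (card S + d) \<le> ?hi" by simp
  have bN: "card T < card S" and ad: "a \<le> d" using lo large by linarith+
  have pos: "0 < real (card S + d)" using bN by simp
  have "ratio_bound l (card T) a \<theta> \<le> ((real (card S) - real (card T)) / real (card S + d)) ^ card T
      * ((real d - real a) / real (card S + d)) ^ a"
    unfolding ratio_bound_def using lo hi large pos
    by (intro mult_mono power_mono frac_le zero_le_power divide_nonneg_nonneg) auto
  then have "ratio_bound l (card T) a \<theta> * real ((card S + d - 1) choose d)
      \<le> real ((card S + d - 1) choose d) * (((real (card S) - real (card T)) / real (card S + d)) ^ card T
      * ((real d - real a) / real (card S + d)) ^ a)"
    by (subst mult.commute) (intro mult_left_mono, auto)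
  also have "\<dots> \<le> real ((card S - card T + (d - a) - 1) choose (d - a))"
    using composition_ratio[OF bN ad] by simp
  also have "\<dots> = real (card {s \<in> compositions S d. \<forall>u\<in>T. s u = s0 u})"
    using card_compositions_prescribed[OF S s0 a ad] by simp
  finally show ?thesis .
qed

text \<open>Types and numbers are recorded in the last generation only. Since the types of a generation
determine those of the previous one, no summation over earlier types is necessary.\<close>

definition typed_path :: "real \<Rightarrow> nat \<Rightarrow> (word \<Rightarrow> nat) \<Rightarrow> nat \<Rightarrow> word set \<Rightarrow> (nat \<Rightarrow> generation) set" where
  "typed_path \<theta> n k h S = {\<omega>. \<forall>l<Suc (Suc h). \<omega> l \<in>
     (if l = Suc h then typed_event \<eta> q \<theta> n k S (Suc h) else path_event n k l)}"

lemma typed_path_sets: "typed_path \<theta> n k h S \<in> sets (generations_law \<eta> q \<theta>)"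
  unfolding typed_path_def by (rule generations_cylinder_sets)

lemma typed_path_base:
  assumes "S \<subseteq> forest_level n k 0"
  shows "\<exists>b. (b \<longlongrightarrow> forest_weight \<eta> q n k 0 * type_weight (s_prob \<eta> q (Suc 0)) (forest_level n k 0) S) at_top
     \<and> (\<forall>\<^sub>F \<theta> in at_top. b \<theta> \<le> measure (generations_law \<eta> q \<theta>) (typed_path \<theta> n k 0 S))"
proof -
  define I where "I = {i. [i] \<in> S}"
  have I: "I \<subseteq> {1..n}" and SI: "S = (\<lambda>i. [i]) ` I" using assms by (auto simp: I_def)
  have cS: "card S = card I" unfolding SI by (intro card_image) (auto simp: inj_on_def)
  have cL: "card (forest_level n k 0) = n" by (simp add: card_image inj_on_def)
  let ?w = "max q \<eta> ^ card I * (1 - max q \<eta>) ^ (n - card I)"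
  have w: "forest_weight \<eta> q n k 0 * type_weight (s_prob \<eta> q (Suc 0)) (forest_level n k 0) S = ?w"
    using s_prob_1 by (simp add: forest_weight_def type_weight_def cS cL del: forest_level.simps)
  have w0: "0 \<le> ?w" using m_bounds by simp
  have lim: "((\<lambda>\<theta>. poisson_bound 0 \<theta> * ?w) \<longlongrightarrow> ?w) at_top"
    using tendsto_mult[OF poisson_bound_tendsto tendsto_const[of ?w]] by simp
  have "\<forall>\<^sub>F \<theta> in at_top. poisson_bound 0 \<theta> * ?w
      \<le> measure (generations_law \<eta> q \<theta>) (typed_path \<theta> n k 0 S)"
    using eventually_large[OF zeta_pos, of "real (card I)" 0 1] eventually_ge_at_top[of 1]
  proof eventually_elim
    case (elim \<theta>)
    interpret prob_space "generations_law \<eta> q \<theta>" by (rule prob_space_generations_law)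
    define A where "A l = (if l = Suc 0 then typed_event \<eta> q \<theta> n k S (Suc 0) else path_event n k l)" for l
    let ?D = "increments 0 \<theta>"
    have D: "card I \<le> Suc d" if "d \<in> ?D" for d
    proof -
      have "real (card I) < real d" using that elim by (auto simp: increments_def abs_le_iff)
      then show ?thesis by simp
    qed
    have th: "1 \<le> \<theta> powr (3/4)" using elim by (simp add: ge_one_powr_ge_zero)
    have "poisson_bound 0 \<theta> * ?w \<le> measure_pmf.prob (poisson_pmf (\<theta> * zeta \<eta> q 0)) ?D * ?w"
      using poisson_bound[of \<theta> 0] elim w0 by (intro mult_right_mono) auto
    also have "\<dots> \<le> measure_pmf.prob (next_generation \<eta> q \<theta> 0 ({[]}, {[]})) (A 1)"
    proof (rule root_generation_prob_ge[OF eta q I D])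
      fix kk c d
      assume wf: "wf_generation 1 (children kk {[]}, successors c {[]})" and n: "n \<le> kk []"
        and c: "c [] \<inter> {1..n} = I" and d: "d \<in> ?D" and card: "card (successors c {[]}) = Suc d"
      have ckk: "c [] \<subseteq> {1..kk []}" using wf by (auto simp: wf_generation_def successors_def children_def)
      have "children kk {[]} \<inter> fan n = (\<lambda>i. [i]) ` {1..n}"
        using n by (auto simp: children_def fan_def)
      moreover have "successors c {[]} \<inter> fan n = S"
        unfolding SI c[symmetric] using ckk by (auto simp: successors_def fan_def)
      moreover have "\<bar>real (Suc d) - \<theta> * zeta \<eta> q 0\<bar> \<le> 2 * \<theta> powr (3/4)"
        using d th by (auto simp: increments_def abs_le_iff)
      ultimately show "(children kk {[]}, successors c {[]}) \<in> A 1"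
        using wf card by (simp add: A_def typed_event_def path_event_def zeta_sum_def)
    qed
    finally have step: "poisson_bound 0 \<theta> * ?w \<le> measure_pmf.prob (next_generation \<eta> q \<theta> 0 ({[]}, {[]})) (A 1)" .
    have "measure (generations_law \<eta> q \<theta>) {\<omega>. \<forall>l<0. \<omega> l \<in> A l} * 1
        \<le> measure (generations_law \<eta> q \<theta>) {\<omega>. \<forall>l<Suc 0. \<omega> l \<in> A l}"
      by (rule generations_step_lower)
        (auto simp: generation_kernel_def A_def path_event_def measure_return_pmf)
    then have one: "measure (generations_law \<eta> q \<theta>) {\<omega>. \<forall>l<Suc 0. \<omega> l \<in> A l} = 1"
      using prob_space prob_le_1 by (simp add: space_generations_law order_antisym)
    show ?case
    proof (cases "0 \<le> poisson_bound 0 \<theta> * ?w")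
      case True
      have "measure (generations_law \<eta> q \<theta>) {\<omega>. \<forall>l<Suc 0. \<omega> l \<in> A l} * (poisson_bound 0 \<theta> * ?w)
        \<le> measure (generations_law \<eta> q \<theta>) {\<omega>. \<forall>l<Suc (Suc 0). \<omega> l \<in> A l}"
      proof (rule generations_step_lower[OF _ True])
        fix x assume "\<And>l. l < Suc 0 \<Longrightarrow> x l \<in> A l"
        then have "x 0 = ({[]}, {[]})" by (auto simp: A_def path_event_def)
        then show "poisson_bound 0 \<theta> * ?w \<le> measure (generation_kernel \<eta> q \<theta> (Suc 0) x) (A (Suc 0))"
          using step by (simp add: generation_kernel_def)
      qed
      then show ?thesis unfolding one by (simp add: typed_path_def A_def)
    next
      case False
      then show ?thesis using measure_nonneg order_trans by (metis linorder_le_cases)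
    qed
  qed
  then show ?thesis unfolding w using lim by blast
qed

text \<open>The set \<open>S'\<close> determines, for each vertex of the previous generation, the indices \<open>c0\<close> of its children of type \<open>s\<close>,
and thereby the set \<open>S\<close> of the vertices of type \<open>s\<close> in that generation, since vertices of type \<open>s\<close> are those
with at least one child of type \<open>s\<close>. The new bound is the old bound for \<open>S\<close> times the bound \<open>c\<close> for one step, and
the limits match by \<open>local_weight_identity\<close>.\<close>

lemma typed_path_step:
  assumes IH: "\<And>S. S \<subseteq> forest_level n k h \<Longrightarrow>
      \<exists>b. (b \<longlongrightarrow> forest_weight \<eta> q n k h * type_weight (s_prob \<eta> q (Suc h)) (forest_level n k h) S) at_top
     \<and> (\<forall>\<^sub>F \<theta> in at_top. b \<theta> \<le> measure (generations_law \<eta> q \<theta>) (typed_path \<theta> n k h S))"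
    and S': "S' \<subseteq> forest_level n k (Suc h)"
  shows "\<exists>b. (b \<longlongrightarrow> forest_weight \<eta> q n k (Suc h) * type_weight (s_prob \<eta> q (Suc (Suc h))) (forest_level n k (Suc h)) S') at_top
     \<and> (\<forall>\<^sub>F \<theta> in at_top. b \<theta> \<le> measure (generations_law \<eta> q \<theta>) (typed_path \<theta> n k (Suc h) S'))"
proof -
  define A where "A = forest_level n k h"
  define c0 where "c0 u = {i. u @ [i] \<in> S'}" for u
  define S where "S = {u \<in> A. c0 u \<noteq> {}}"
  define a where "a = card (successors c0 A) - card S"
  define W where "W = (\<Prod>u\<in>A. if c0 u \<noteq> {}
           then pmf (size_biased \<eta> q (card (c0 u))) (k u) / real (k u choose card (c0 u))
           else pmf (frak_offspring \<eta> q) (k u))"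
  have finA: "finite A" by (simp add: A_def finite_forest_level)
  have c0: "c0 u \<subseteq> {1..k u}" for u
    using S' by (auto simp: c0_def children_def)
  have finc: "finite (c0 u)" for u using c0[of u] finite_subset by blast
  have S'eq: "S' = successors c0 A"
    using S' by (auto simp: c0_def children_def successors_def A_def)
  have S'S: "successors c0 A = successors c0 S" by (auto simp: successors_def S_def)
  have SA: "S \<subseteq> A" and finS: "finite S" using finA by (auto simp: S_def)
  have c1: "1 \<le> card (c0 u)" if "u \<in> S" for u
    using that finc[of u] by (auto simp: S_def Suc_le_eq card_gt_0_iff)
  have sum: "(\<Sum>u\<in>S. card (c0 u)) = card S + a"
  proof -
    have "card (successors c0 A) = (\<Sum>u\<in>S. card (c0 u))"
      unfolding S'S using finS finc by (intro card_successors)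
    moreover have "card S \<le> (\<Sum>u\<in>S. card (c0 u))"
      using sum_mono[of S "\<lambda>_. 1" "\<lambda>u. card (c0 u)"] c1 by simp
    ultimately show ?thesis by (simp add: a_def)
  qed
  have W0: "0 \<le> W" unfolding W_def by (intro prod_nonneg) auto
  obtain b where b: "(b \<longlongrightarrow> forest_weight \<eta> q n k h * type_weight (s_prob \<eta> q (Suc h)) A S) at_top"
    "\<forall>\<^sub>F \<theta> in at_top. b \<theta> \<le> measure (generations_law \<eta> q \<theta>) (typed_path \<theta> n k h S)"
    using IH SA by (auto simp: A_def)
  \<comment> \<open>Lower bound for one step: a typical increment, the composition, and the independent draws.\<close>
  define c where "c \<theta> = poisson_bound (Suc h) \<theta> * (ratio_bound (Suc h) (card S) a \<theta> * W)" for \<theta>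
  let ?\<rho> = "s_ratio \<eta> q (Suc h)"
  have "((\<lambda>\<theta>. b \<theta> * c \<theta>) \<longlongrightarrow> forest_weight \<eta> q n k h * type_weight (s_prob \<eta> q (Suc h)) A S
      * (1 * (?\<rho> ^ card S * (1 - ?\<rho>) ^ a * W))) at_top"
    unfolding c_def by (intro tendsto_mult b poisson_bound_tendsto ratio_bound_tendsto tendsto_const) simp
  also have "forest_weight \<eta> q n k h * type_weight (s_prob \<eta> q (Suc h)) A S
      * (1 * (?\<rho> ^ card S * (1 - ?\<rho>) ^ a * W))
    = forest_weight \<eta> q n k h * ((\<Prod>u\<in>A. tilde_weight \<eta> q (Suc h) (k u))
     * type_weight (s_prob \<eta> q (Suc (Suc h))) (children k A) (successors c0 A))"
    using local_weight_identity[OF finA, of c0 k h, OF c0, folded S_def, folded a_def W_def]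
    by (simp add: mult.assoc)
  also have "\<dots> = forest_weight \<eta> q n k (Suc h) * type_weight (s_prob \<eta> q (Suc (Suc h))) (forest_level n k (Suc h)) S'"
    by (simp add: forest_weight_def A_def S'eq)
  finally have lim: "((\<lambda>\<theta>. b \<theta> * c \<theta>) \<longlongrightarrow> \<dots>) at_top" .
  have "0 < zeta_sum \<eta> q (Suc h)" by (rule zeta_sum_pos) simp
  from eventually_large[OF this, of "real (card S)" "real (Suc (Suc h))"]
    eventually_large[OF zeta_pos, of "real a" "Suc h" 1] eventually_gt_at_top[of 0] b(2)
    order_tendstoD(1)[OF poisson_bound_tendsto zero_less_one, of "Suc h"]
  have "\<forall>\<^sub>F \<theta> in at_top. b \<theta> * c \<theta> \<le> measure (generations_law \<eta> q \<theta>) (typed_path \<theta> n k (Suc h) S')"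
  proof eventually_elim
    case (elim \<theta>)
    interpret prob_space "generations_law \<eta> q \<theta>" by (rule prob_space_generations_law)
    define B where "B l = (if l = Suc (Suc h) then typed_event \<eta> q \<theta> n k S' (Suc (Suc h))
      else if l = Suc h then typed_event \<eta> q \<theta> n k S (Suc h) else path_event n k l)" for l
    let ?D = "increments (Suc h) \<theta>"
    let ?r = "ratio_bound (Suc h) (card S) a \<theta>"
    have r0: "0 \<le> ?r"
      unfolding ratio_bound_def using elim zeta_sum_pos[of "Suc (Suc h)"]
      by (intro mult_nonneg_nonneg zero_le_power divide_nonneg_nonneg add_nonneg_nonneg) auto
    have cpos: "0 \<le> c \<theta>" unfolding c_def using elim r0 W0 by (intro mult_nonneg_nonneg) auto
    have step: "c \<theta> \<le> measure_pmf.prob (next_generation \<eta> q \<theta> (Suc h) g) (B (Suc (Suc h)))"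
      if g: "g \<in> typed_event \<eta> q \<theta> n k S (Suc h)" for g
    proof -
      obtain L T where gLT: "g = (L, T)" by fastforce
      have wf: "wf_generation (Suc h) (L, T)" and LA: "L \<inter> fan n = A" and TS: "T \<inter> fan n = S"
        and cT: "\<bar>real (card T) - \<theta> * zeta_sum \<eta> q (Suc h)\<bar> \<le> real (Suc (Suc h)) * \<theta> powr (3/4)"
        using g by (auto simp: typed_event_def path_event_def gLT A_def)
      have T: "T \<subseteq> L" "finite T" "[] \<notin> L"
        using wf finite_subset by (auto simp: wf_generation_def)
      have TA: "T \<inter> A = S" using T LA TS by auto
      have "c \<theta> \<le> measure_pmf.prob (poisson_pmf (\<theta> * zeta \<eta> q (Suc h))) ?D * (?r * W)"
        unfolding c_def using poisson_bound[of \<theta> "Suc h"] elim r0 W0 by (intro mult_right_mono) auto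
      also have "\<dots> \<le> measure_pmf.prob (next_generation \<eta> q \<theta> (Suc h) (L, T)) (B (Suc (Suc h)))"
        unfolding W_def
      proof (rule next_generation_prob_ge[OF eta q wf])
        show "A \<subseteq> L" using LA by auto
        show "T \<inter> A = {u \<in> A. c0 u \<noteq> {}}" unfolding TA S_def ..
        show "?r * real (card T + d - 1 choose d)
            \<le> real (card {s \<in> compositions T d. \<forall>u\<in>T \<inter> A. s u = card (c0 u)})" if "d \<in> ?D" for d
          unfolding TA
          by (rule composition_prob_ge[OF T(2) _ c1 sum cT that]) (use elim TA in auto)
        fix kk cc d
        assume wf': "wf_generation (Suc (Suc h)) (children kk L, successors cc T)"
          and kk: "\<And>u. u \<in> A \<Longrightarrow> kk u = k u" and cc: "\<And>u. u \<in> T \<inter> A \<Longrightarrow> cc u = c0 u"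
          and d: "d \<in> ?D" and card: "card (successors cc T) = card T + d"
        have "children kk L \<inter> fan n = children k A"
          unfolding children_conv_successors successors_Int_fan[OF T(3)] LA
          using kk by (intro successors_cong) simp
        moreover have "successors cc T \<inter> fan n = S'"
        proof -
          have "[] \<notin> T" using T by blast
          then have "successors cc T \<inter> fan n = successors cc S"
            using successors_Int_fan[of T cc n] TS by simp
          also have "\<dots> = successors c0 S" using cc TA by (intro successors_cong) blast
          finally show ?thesis using S'eq S'S by simp
        qed
        moreover have "\<bar>real (card T + d) - \<theta> * zeta_sum \<eta> q (Suc (Suc h))\<bar>
            \<le> real (Suc (Suc (Suc h))) * \<theta> powr (3/4)"
        proof -
          have "\<bar>(real (card T) - \<theta> * zeta_sum \<eta> q (Suc h)) + (real d - \<theta> * zeta \<eta> q (Suc h))\<bar>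
            \<le> real (Suc (Suc h)) * \<theta> powr (3/4) + \<theta> powr (3/4)"
            using cT d by (intro order_trans[OF abs_triangle_ineq] add_mono) (auto simp: increments_def)
          then show ?thesis unfolding zeta_sum_Suc[of "Suc h"] by (simp add: algebra_simps)
        qed
        ultimately show "(children kk L, successors cc T) \<in> B (Suc (Suc h))"
          using wf' card by (simp add: B_def typed_event_def path_event_def A_def)
      qed (use c0 r0 in auto)
      finally show ?thesis unfolding gLT .
    qed
    have "b \<theta> * c \<theta> \<le> measure (generations_law \<eta> q \<theta>) (typed_path \<theta> n k h S) * c \<theta>"
      using elim cpos by (intro mult_right_mono)
    also have "typed_path \<theta> n k h S = {\<omega>. \<forall>l<Suc (Suc h). \<omega> l \<in> B l}"
      by (auto simp: typed_path_def B_def)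
    also have "measure (generations_law \<eta> q \<theta>) {\<omega>. \<forall>l<Suc (Suc h). \<omega> l \<in> B l} * c \<theta>
        \<le> measure (generations_law \<eta> q \<theta>) {\<omega>. \<forall>l<Suc (Suc (Suc h)). \<omega> l \<in> B l}"
    proof (rule generations_step_lower[OF _ cpos])
      fix x assume "\<And>l. l < Suc (Suc h) \<Longrightarrow> x l \<in> B l"
      from this[of "Suc h"] have "x (Suc h) \<in> typed_event \<eta> q \<theta> n k S (Suc h)" by (simp add: B_def)
      from step[OF this]
      show "c \<theta> \<le> measure (generation_kernel \<eta> q \<theta> (Suc (Suc h)) x) (B (Suc (Suc h)))"
        by (simp add: generation_kernel_def)
    qed
    also have "\<dots> \<le> measure (generations_law \<eta> q \<theta>) (typed_path \<theta> n k (Suc h) S')"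
    proof (rule finite_measure_mono)
      show "typed_path \<theta> n k (Suc h) S' \<in> sets (generations_law \<eta> q \<theta>)"
        by (rule typed_path_sets)
      show "{\<omega>. \<forall>l<Suc (Suc (Suc h)). \<omega> l \<in> B l} \<subseteq> typed_path \<theta> n k (Suc h) S'"
      proof
        fix \<omega> assume "\<omega> \<in> {\<omega>. \<forall>l<Suc (Suc (Suc h)). \<omega> l \<in> B l}"
        then have \<omega>: "\<omega> l \<in> B l" if "l < Suc (Suc (Suc h))" for l using that by blast
        have "B (Suc h) \<subseteq> path_event n k (Suc h)" by (auto simp: B_def typed_event_def)
        with \<omega>[of "Suc h"] have Sh: "\<omega> (Suc h) \<in> path_event n k (Suc h)" by auto
        show "\<omega> \<in> typed_path \<theta> n k (Suc h) S'"
          unfolding typed_path_def mem_Collect_eq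
        proof (intro allI impI)
          fix l assume "l < Suc (Suc (Suc h))"
          from \<omega>[OF this] Sh show "\<omega> l \<in> (if l = Suc (Suc h)
              then typed_event \<eta> q \<theta> n k S' (Suc (Suc h)) else path_event n k l)"
            by (cases "l = Suc h") (simp_all add: B_def split: if_splits)
        qed
      qed
    qed
    finally show ?case .
  qed
  then show ?thesis using lim by blast
qed

lemma typed_path_lower:
  "S \<subseteq> forest_level n k h \<Longrightarrow>
      \<exists>b. (b \<longlongrightarrow> forest_weight \<eta> q n k h * type_weight (s_prob \<eta> q (Suc h)) (forest_level n k h) S) at_top
     \<and> (\<forall>\<^sub>F \<theta> in at_top. b \<theta> \<le> measure (generations_law \<eta> q \<theta>) (typed_path \<theta> n k h S))"
proof (induction h arbitrary: S)
  case 0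
  then show ?case by (rule typed_path_base)
next
  case (Suc h)
  from Suc.IH Suc.prems show ?case by (rule typed_path_step)
qed

text \<open>Sum over all types of the last generation; their Bernoulli weights sum to 1.\<close>

lemma path_lower:
  "\<exists>b. (b \<longlongrightarrow> forest_weight \<eta> q n k h) at_top
     \<and> (\<forall>\<^sub>F \<theta> in at_top. b \<theta> \<le> measure (generations_law \<eta> q \<theta>) {\<omega>. \<forall>l<Suc (Suc h). \<omega> l \<in> path_event n k l})"
proof -
  let ?A = "forest_level n k h"
  have "\<forall>S\<in>Pow ?A. \<exists>b. (b \<longlongrightarrow> forest_weight \<eta> q n k h * type_weight (s_prob \<eta> q (Suc h)) ?A S) at_top
     \<and> (\<forall>\<^sub>F \<theta> in at_top. b \<theta> \<le> measure (generations_law \<eta> q \<theta>) (typed_path \<theta> n k h S))"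
    using typed_path_lower by blast
  from bchoice[OF this] obtain b where b: "\<And>S. S \<in> Pow ?A \<Longrightarrow>
      (b S \<longlongrightarrow> forest_weight \<eta> q n k h * type_weight (s_prob \<eta> q (Suc h)) ?A S) at_top"
    "\<And>S. S \<in> Pow ?A \<Longrightarrow> \<forall>\<^sub>F \<theta> in at_top. b S \<theta> \<le> measure (generations_law \<eta> q \<theta>) (typed_path \<theta> n k h S)"
    by auto
  have fin: "finite (Pow ?A)" by (simp add: finite_forest_level)
  have "((\<lambda>\<theta>. \<Sum>S\<in>Pow ?A. b S \<theta>) \<longlongrightarrow>
      (\<Sum>S\<in>Pow ?A. forest_weight \<eta> q n k h * type_weight (s_prob \<eta> q (Suc h)) ?A S)) at_top"
    using b(1) by (rule tendsto_sum)
  also have "(\<Sum>S\<in>Pow ?A. forest_weight \<eta> q n k h * type_weight (s_prob \<eta> q (Suc h)) ?A S) = forest_weight \<eta> q n k h"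
    unfolding sum_distrib_left[symmetric] sum_type_weight[OF finite_forest_level] by simp
  finally have lim: "((\<lambda>\<theta>. \<Sum>S\<in>Pow ?A. b S \<theta>) \<longlongrightarrow> forest_weight \<eta> q n k h) at_top" .
  have "\<forall>\<^sub>F \<theta> in at_top. \<forall>S\<in>Pow ?A. b S \<theta> \<le> measure (generations_law \<eta> q \<theta>) (typed_path \<theta> n k h S)"
    using b(2) fin by (intro eventually_ball_finite) auto
  then have "\<forall>\<^sub>F \<theta> in at_top. (\<Sum>S\<in>Pow ?A. b S \<theta>)
      \<le> measure (generations_law \<eta> q \<theta>) {\<omega>. \<forall>l<Suc (Suc h). \<omega> l \<in> path_event n k l}"
  proof eventually_elim
    case (elim \<theta>)
    interpret prob_space "generations_law \<eta> q \<theta>" by (rule prob_space_generations_law)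
    have "(\<Sum>S\<in>Pow ?A. b S \<theta>) \<le> (\<Sum>S\<in>Pow ?A. measure (generations_law \<eta> q \<theta>) (typed_path \<theta> n k h S))"
      using elim by (intro sum_mono) auto
    also have "\<dots> = measure (generations_law \<eta> q \<theta>) (\<Union>S\<in>Pow ?A. typed_path \<theta> n k h S)"
    proof (rule finite_measure_finite_Union[symmetric, OF fin])
      show "typed_path \<theta> n k h ` Pow ?A \<subseteq> sets (generations_law \<eta> q \<theta>)"
        using typed_path_sets by blast
      show "disjoint_family_on (typed_path \<theta> n k h) (Pow ?A)"
        by (auto simp: disjoint_family_on_def typed_path_def typed_event_def)
    qed
    also have "\<dots> \<le> measure (generations_law \<eta> q \<theta>) {\<omega>. \<forall>l<Suc (Suc h). \<omega> l \<in> path_event n k l}"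
      by (intro finite_measure_mono generations_cylinder_sets)
        (auto simp: typed_path_def typed_event_def split: if_splits)
    finally show ?case .
  qed
  with lim show ?thesis by blast
qed

end

section \<open>The tree of the generations\<close>

lemma AE_generations_wf:
  assumes par: "0 < \<eta>" "\<eta> \<le> 1" "0 < q" "q < 1"
  shows "AE \<omega> in generations_law \<eta> q \<theta>. \<omega> 0 = ({[]}, {[]}) \<and> (\<forall>h. wf_generation h (\<omega> h))"
proof -
  interpret prob_space "generations_law \<eta> q \<theta>" by (rule prob_space_generations_law)
  define A where "A l = (if l = 0 then {({[]}, {[]})} else {g. wf_generation l g})" for l
  have wf0: "wf_generation 0 ({[]}, {[]})" by (simp add: wf_generation_def words_def)
  have one: "1 \<le> prob {\<omega>. \<forall>l<n. \<omega> l \<in> A l}" for n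
  proof (induction n)
    case 0
    then show ?case using prob_space by (simp add: space_generations_law)
  next
    case (Suc n)
    have "prob {\<omega>. \<forall>l<n. \<omega> l \<in> A l} * 1 \<le> prob {\<omega>. \<forall>l<Suc n. \<omega> l \<in> A l}"
    proof (rule generations_step_lower)
      fix x assume x: "\<And>l. l < n \<Longrightarrow> x l \<in> A l"
      show "1 \<le> measure (generation_kernel \<eta> q \<theta> n x) (A n)"
      proof (cases n)
        case 0
        then show ?thesis by (simp add: generation_kernel_def A_def measure_return_pmf)
      next
        case (Suc h)
        have "wf_generation h (x h)" using x[of h] wf0 Suc by (auto simp: A_def split: if_splits)
        then have "g' \<in> A (Suc h)" if "g' \<in> set_pmf (next_generation \<eta> q \<theta> h (x h))" for g'
          using next_generation_support[OF par _ that] by (simp add: A_def)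
        then have "set_pmf (next_generation \<eta> q \<theta> h (x h)) \<subseteq> A (Suc h)" by blast
        then have "measure_pmf.prob (next_generation \<eta> q \<theta> h (x h)) (A (Suc h)) = 1"
          by (intro measure_pmf.prob_eq_1[THEN iffD2]) (auto simp: AE_measure_pmf_iff)
        then show ?thesis using Suc by (simp add: generation_kernel_def)
      qed
    qed simp
    then show ?case using Suc by simp
  qed
  have "AE \<omega> in generations_law \<eta> q \<theta>. \<forall>l<n. \<omega> l \<in> A l" for n
    using AE_prob_1[of "{\<omega>. \<forall>l<n. \<omega> l \<in> A l}"] one[of n] prob_le_1 by (simp add: order_antisym)
  then have "AE \<omega> in generations_law \<eta> q \<theta>. \<forall>n. \<forall>l<n. \<omega> l \<in> A l"
    by (simp add: AE_all_countable)
  then show ?thesis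
  proof eventually_elim
    case (elim \<omega>)
    then have "\<omega> l \<in> A l" for l using lessI by blast
    then show ?case using wf0 unfolding A_def by (metis (full_types) mem_Collect_eq singletonD)
  qed
qed

text \<open>Well-formed generations form a countable set, so that it is enough to exclude, for each of them, the transition to
a generation that does not consist of children.\<close>

lemma AE_generations_children:
  assumes par: "0 < \<eta>" "\<eta> \<le> 1" "0 < q" "q < 1"
  shows "AE \<omega> in generations_law \<eta> q \<theta>. \<forall>h. \<exists>k. fst (\<omega> (Suc h)) = children k (fst (\<omega> h))"
proof -
  let ?G = "generations_law \<eta> q \<theta>"
  define W where "W h = {g. wf_generation h g}" for h
  have "countable (Collect finite \<times> Collect finite :: generation set)"
    by (intro countable_SIGMA countable_Collect_finite)
  then have W: "countable (W h)" for h
    by (rule countable_subset[rotated]) (auto simp: W_def wf_generation_def finite_subset)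
  have "AE \<omega> in ?G. \<omega> h = g \<longrightarrow> (\<exists>k. fst (\<omega> (Suc h)) = children k (fst g))" if g: "g \<in> W h" for h g
  proof -
    let ?A = "\<lambda>l. if l = Suc h then {g'. \<nexists>k. fst g' = children k (fst g)} else if l = h then {g} else UNIV"
    have "emeasure ?G {\<omega>. \<forall>l<Suc (Suc h). \<omega> l \<in> ?A l} = 0"
    proof (rule generations_step_null)
      fix x assume "\<And>l. l < Suc h \<Longrightarrow> x l \<in> ?A l"
      from this[of h] have "x h = g" by simp
      moreover have "\<exists>k. fst g' = children k (fst g)"
        if "g' \<in> set_pmf (next_generation \<eta> q \<theta> h g)" for g'
        using next_generation_support[OF par _ that] g by (simp add: W_def)
      then have "set_pmf (next_generation \<eta> q \<theta> h g) \<inter> {g'. \<nexists>k. fst g' = children k (fst g)} = {}"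
        by blast
      ultimately show "measure (generation_kernel \<eta> q \<theta> (Suc h) x) (?A (Suc h)) = 0"
        by (simp add: generation_kernel_def measure_pmf_zero_iff)
    qed
    then have "{\<omega>. \<forall>l<Suc (Suc h). \<omega> l \<in> ?A l} \<in> null_sets ?G"
      using generations_cylinder_sets by (intro null_setsI) auto
    from AE_not_in[OF this] show ?thesis
    proof eventually_elim
      case (elim \<omega>)
      show ?case
      proof (rule impI, rule ccontr)
        assume *: "\<omega> h = g" "\<nexists>k. fst (\<omega> (Suc h)) = children k (fst g)"
        have "\<omega> \<in> {\<omega>. \<forall>l<Suc (Suc h). \<omega> l \<in> ?A l}" using * by simp
        then show False using elim by blast
      qed
    qed
  qed
  then have "AE \<omega> in ?G. \<forall>g\<in>W h. \<omega> h = g \<longrightarrow> (\<exists>k. fst (\<omega> (Suc h)) = children k (fst g))" for h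
    using W by (subst AE_ball_countable) auto
  then have "AE \<omega> in ?G. \<forall>h. \<forall>g\<in>W h. \<omega> h = g \<longrightarrow> (\<exists>k. fst (\<omega> (Suc h)) = children k (fst g))"
    by (simp add: AE_all_countable)
  with AE_generations_wf[OF par] show ?thesis
    by eventually_elim (auto simp: W_def)
qed

lemma ulam_tree_of_levels:
  fixes L :: "nat \<Rightarrow> word set"
  assumes L0: "L 0 = {[]}" and LS: "\<And>h. \<exists>k. L (Suc h) = children k (L h)"
  shows "(\<Union>h. L h) \<in> ulam_trees" "u \<in> (\<Union>h. L h) \<longleftrightarrow> u \<in> L (length u)"
proof -
  have len: "u \<in> L h \<Longrightarrow> length u = h \<and> u \<in> words" for u h
  proof (induction h arbitrary: u)
    case 0
    then show ?case using L0 by (simp add: words_def)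
  next
    case (Suc h)
    obtain k where "L (Suc h) = children k (L h)" using LS by blast
    with Suc show ?case by (fastforce simp: children_def words_def)
  qed
  show mem: "u \<in> (\<Union>h. L h) \<longleftrightarrow> u \<in> L (length u)" for u using len by blast
  have par: "u \<in> (\<Union>h. L h)" if "u @ [i] \<in> (\<Union>h. L h)" for u i
  proof -
    obtain k where "L (Suc (length u)) = children k (L (length u))" using LS by blast
    then show ?thesis using that unfolding mem by (auto simp: children_def)
  qed
  have pre: "u @ v \<in> (\<Union>h. L h) \<Longrightarrow> u \<in> (\<Union>h. L h)" for u v
  proof (induction v rule: rev_induct)
    case (snoc i v)
    then show ?case using par[of "u @ v" i] by simp
  qed simp
  have ch: "\<exists>k::enat. \<forall>i\<ge>1. u @ [i] \<in> (\<Union>h. L h) \<longleftrightarrow> enat i \<le> k" if "u \<in> (\<Union>h. L h)" for u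
  proof -
    obtain k where k: "L (Suc (length u)) = children k (L (length u))" using LS by blast
    show ?thesis
      using that unfolding mem by (intro exI[of _ "enat (k u)"]) (auto simp: k children_def)
  qed
  show "(\<Union>h. L h) \<in> ulam_trees"
    unfolding ulam_trees_def
  proof (intro CollectI conjI allI impI ballI)
    show "(\<Union>h. L h) \<subseteq> words" using len by blast
    show "[] \<in> (\<Union>h. L h)" using L0 by blast
  qed (fact pre, fact ch)
qed

definition forest :: "nat \<Rightarrow> (word \<Rightarrow> nat) \<Rightarrow> word set" where
  "forest n k = (\<Union>l\<le>n. forest_level n k l)"

lemma finite_forest: "finite (forest n k)"
  by (simp add: forest_def finite_forest_level)

lemma length_forest_level: "u \<in> forest_level n k l \<Longrightarrow> length u = Suc l"
  by (induction l arbitrary: u) (auto simp: children_def)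

lemma forest_level_fan: "u \<in> forest_level n k l \<Longrightarrow> u \<in> fan n"
proof (induction l arbitrary: u)
  case (Suc l)
  then obtain v i where "u = v @ [i]" "v \<in> forest_level n k l" by (auto simp: children_def)
  with Suc.IH[of v] show ?case by (auto simp: fan_def)
qed (auto simp: fan_def)

lemma mem_forest_iff: "length u = Suc l \<Longrightarrow> l \<le> n \<Longrightarrow> u \<in> forest n k \<longleftrightarrow> u \<in> forest_level n k l"
  using length_forest_level by (fastforce simp: forest_def)

definition gen_tree :: "(nat \<Rightarrow> generation) \<Rightarrow> ulam_tree" where
  "gen_tree \<omega> = tree_of (\<Union>h. fst (\<omega> h))"

lemma gen_tree_measurable: "gen_tree \<in> generations_law \<eta> q \<theta> \<rightarrow>\<^sub>M borel"
proof -
  have "Measurable.pred (generations_law \<eta> q \<theta>) (\<lambda>\<omega>. u \<in> fst (\<omega> h))" for u h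
    by (rule measurable_compose[OF generation_measurable]) simp
  then have "Measurable.pred (generations_law \<eta> q \<theta>) (\<lambda>\<omega>. \<exists>h. u \<in> fst (\<omega> h))" for u
    by (intro pred_intros_countable)
  then have "Measurable.pred (generations_law \<eta> q \<theta>) (\<lambda>\<omega>. u \<in> (\<Union>h. fst (\<omega> h)))" for u
    by simp
  then show ?thesis unfolding gen_tree_def[abs_def] by (rule measurable_tree_of)
qed

lemma root_forest_gen_tree:
  assumes "\<omega> 0 = ({[]}, {[]})" "\<And>h. \<exists>k. fst (\<omega> (Suc h)) = children k (fst (\<omega> h))"
    and path: "\<And>l. l < Suc (Suc n) \<Longrightarrow> \<omega> l \<in> path_event n k l"
  shows "root_forest n (gen_tree \<omega>) = forest n k"
proof (rule set_eqI)
  fix u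
  have L: "(\<Union>h. fst (\<omega> h)) \<in> ulam_trees" "\<And>u. u \<in> (\<Union>h. fst (\<omega> h)) \<longleftrightarrow> u \<in> fst (\<omega> (length u))"
    using ulam_tree_of_levels[of "\<lambda>h. fst (\<omega> h)"] assms(1,2) by auto
  have v: "u \<in> vertices (gen_tree \<omega>) \<longleftrightarrow> u \<in> fst (\<omega> (length u))"
    unfolding gen_tree_def vertices_tree_of using L by simp
  show "u \<in> root_forest n (gen_tree \<omega>) \<longleftrightarrow> u \<in> forest n k"
  proof (cases "\<exists>l\<le>n. length u = Suc l")
    case True
    then obtain l where l: "l \<le> n" "length u = Suc l" by blast
    have "fst (\<omega> (Suc l)) \<inter> fan n = forest_level n k l"
      using path[of "Suc l"] l by (simp add: path_event_def)
    then show ?thesis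
      using l mem_forest_iff[OF l(2,1)] v by (auto simp: root_forest_def)
  next
    case False
    then have "u = [] \<or> Suc n < length u" by (cases "length u") auto
    then have "u \<notin> root_forest n (gen_tree \<omega>)" by (auto simp: root_forest_def fan_def)
    moreover have "u \<notin> forest n k" using False length_forest_level by (fastforce simp: forest_def)
    ultimately show ?thesis by simp
  qed
qed

text \<open>Almost surely the generations are the levels of a tree, and the generations up to \<open>n + 1\<close> show its first \<open>n\<close> subtrees
up to the height of \<open>root_forest n\<close>.\<close>

lemma tau_forest_ge_path:
  assumes par: "0 < \<eta>" "\<eta> \<le> 1" "0 < q" "q < 1"
  shows "measure (generations_law \<eta> q \<theta>) {\<omega>. \<forall>l<Suc (Suc n). \<omega> l \<in> path_event n k l}
    \<le> measure (tau \<eta> q \<theta>) {t. root_forest n t = forest n k}"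
proof -
  interpret prob_space "generations_law \<eta> q \<theta>" by (rule prob_space_generations_law)
  have tau: "tau \<eta> q \<theta> = distr (generations_law \<eta> q \<theta>) borel gen_tree"
    by (simp add: tau_def gen_tree_def[abs_def])
  have "measure (generations_law \<eta> q \<theta>) {\<omega>. \<forall>l<Suc (Suc n). \<omega> l \<in> path_event n k l}
    \<le> measure (generations_law \<eta> q \<theta>) (gen_tree -` {t. root_forest n t = forest n k} \<inter> space (generations_law \<eta> q \<theta>))"
  proof (rule finite_measure_mono_AE)
    show "AE \<omega> in generations_law \<eta> q \<theta>. \<omega> \<in> {\<omega>. \<forall>l<Suc (Suc n). \<omega> l \<in> path_event n k l} \<longrightarrow>
        \<omega> \<in> gen_tree -` {t. root_forest n t = forest n k} \<inter> space (generations_law \<eta> q \<theta>)"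
      using AE_generations_wf[OF par] AE_generations_children[OF par]
    proof eventually_elim
      case (elim \<omega>)
      then show ?case using root_forest_gen_tree[of \<omega> n k] by (auto simp: space_generations_law)
    qed
    show "gen_tree -` {t. root_forest n t = forest n k} \<inter> space (generations_law \<eta> q \<theta>) \<in> sets (generations_law \<eta> q \<theta>)"
      by (rule measurable_sets[OF gen_tree_measurable root_forest_measurable])
  qed
  then show ?thesis
    unfolding tau measure_distr[OF gen_tree_measurable root_forest_measurable] .
qed

section \<open>The limit tree\<close>

abbreviation child_numbers :: "real \<Rightarrow> real \<Rightarrow> (word \<Rightarrow> enat) measure" where
  "child_numbers \<eta> q \<equiv> PiM words (\<lambda>u. measure_pmf (tilde_offspring \<eta> q (length u)))"

definition count_tree :: "(word \<Rightarrow> enat) \<Rightarrow> ulam_tree" where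
  "count_tree N = tree_of {u\<in>words. \<forall>v i w. u = v @ i # w \<longrightarrow> enat i \<le> N v}"

lemma count_tree_measurable: "count_tree \<in> child_numbers \<eta> q \<rightarrow>\<^sub>M borel"
proof -
  let ?M = "child_numbers \<eta> q"
  have "Measurable.pred ?M
      (\<lambda>N. x \<in> {u\<in>words. \<forall>v i w. u = v @ i # w \<longrightarrow> enat i \<le> N v})" for x
  proof (cases "x \<in> words")
    case True
    have coord[measurable]: "(\<lambda>N. N v) \<in> ?M \<rightarrow>\<^sub>M count_space UNIV" if "v \<in> words" for v
      using measurable_component_singleton[OF that,
          of "\<lambda>u. measure_pmf (tilde_offspring \<eta> q (length u))"]
      unfolding measurable_cong_sets[OF refl sets_measure_pmf_count_space] .
    have "Measurable.pred ?M (\<lambda>N. x = v @ i # w \<longrightarrow> enat i \<le> N v)" for v i w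
    proof (cases "x = v @ i # w")
      case eq: True
      with True have [measurable]: "v \<in> words" by (auto simp: words_def)
      then have "Measurable.pred ?M (\<lambda>N. enat i \<le> N v)" by measurable
      then show ?thesis using eq by simp
    qed simp
    then have "Measurable.pred ?M (\<lambda>N. \<forall>v i w. x = v @ i # w \<longrightarrow> enat i \<le> N v)"
      by (intro pred_intros_countable)
    then show ?thesis using True by simp
  qed simp
  then show ?thesis unfolding count_tree_def[abs_def] by (rule measurable_tree_of)
qed

text \<open>Every step from a prefix \<open>v\<close> to its \<open>i\<close>-th child is allowed by the child numbers.\<close>

definition admissible :: "(word \<Rightarrow> enat) \<Rightarrow> word \<Rightarrow> bool" where
  "admissible N u \<longleftrightarrow> (\<forall>v i w. u = v @ i # w \<longrightarrow> enat i \<le> N v)"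

lemma admissible_snoc: "admissible N (u @ [i]) \<longleftrightarrow> admissible N u \<and> enat i \<le> N u"
proof
  assume l: "admissible N (u @ [i])"
  have "enat j \<le> N v" if "u = v @ j # w" for v j w
    using l[unfolded admissible_def, rule_format, of v j "w @ [i]"] that by simp
  then show "admissible N u \<and> enat i \<le> N u"
    using l unfolding admissible_def by blast
next
  assume r: "admissible N u \<and> enat i \<le> N u"
  show "admissible N (u @ [i])"
    unfolding admissible_def
  proof (intro allI impI)
    fix v j w assume e: "u @ [i] = v @ j # w"
    show "enat j \<le> N v"
    proof (cases w rule: rev_cases)
      case Nil
      then show ?thesis using e r by simp
    next
      case (snoc w' x)
      then have "u = v @ j # w'" using e by simp
      then show ?thesis using r unfolding admissible_def by blast
    qed
  qed
qed

lemma admissible_prefix: "admissible N (u @ v) \<Longrightarrow> admissible N u"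
proof (induction v rule: rev_induct)
  case (snoc i v)
  then show ?case using admissible_snoc[of N "u @ v" i] by simp
qed simp

lemma words_snoc: "u @ [i] \<in> words \<longleftrightarrow> u \<in> words \<and> 1 \<le> i"
  by (auto simp: words_def)

lemma vertices_count_tree: "vertices (count_tree N) = {u \<in> words. admissible N u}"
proof -
  define T where "T = {u \<in> words. admissible N u}"
  have mem: "u \<in> T \<longleftrightarrow> u \<in> words \<and> admissible N u" for u by (simp add: T_def)
  have pre: "u \<in> T" if "u @ v \<in> T" for u v
    using that admissible_prefix[of N u v] unfolding mem by (simp add: words_def)
  have ch: "\<exists>k::enat. \<forall>i\<ge>1. u @ [i] \<in> T \<longleftrightarrow> enat i \<le> k" if "u \<in> T" for u
    using that unfolding mem by (intro exI[of _ "N u"]) (simp add: admissible_snoc words_snoc)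
  have "T \<in> ulam_trees"
    unfolding ulam_trees_def
  proof (intro CollectI conjI allI impI ballI)
    show "T \<subseteq> words" by (auto simp: mem)
    show "[] \<in> T" by (simp add: mem words_def admissible_def)
  qed (fact pre, fact ch)
  moreover have "{u\<in>words. \<forall>v i w. u = v @ i # w \<longrightarrow> enat i \<le> N v} = T"
    by (simp add: T_def admissible_def)
  ultimately show ?thesis by (simp add: count_tree_def vertices_tree_of T_def)
qed

lemma snoc_in_count_tree:
  "1 \<le> i \<Longrightarrow> u @ [i] \<in> vertices (count_tree N) \<longleftrightarrow> u \<in> vertices (count_tree N) \<and> enat i \<le> N u"
  unfolding vertices_count_tree by (simp add: admissible_snoc words_snoc)

lemma root_forest_count_tree:
  assumes N: "N [] = \<infinity>" "\<And>u. u \<in> words \<Longrightarrow> u \<noteq> [] \<Longrightarrow> N u = enat (k u)"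
  shows "root_forest n (count_tree N) = forest n k"
proof -
  let ?V = "vertices (count_tree N)"
  have lev: "{u \<in> ?V. u \<in> fan n \<and> length u = Suc l} = forest_level n k l" for l
  proof (induction l)
    case 0
    have one: "[i] \<in> ?V \<longleftrightarrow> 1 \<le> i" for i
    proof (cases "1 \<le> i")
      case True
      then show ?thesis using snoc_in_count_tree[OF True, of "[]" N] root_in_vertices N by simp
    next
      case False
      then have "[i] \<notin> words" using words_snoc[of "[]" i] by simp
      then show ?thesis using False vertices_subset_words by blast
    qed
    have "u \<in> ?V \<and> u \<in> fan n \<and> length u = Suc 0 \<longleftrightarrow> u \<in> forest_level n k 0" for u
    proof (cases "\<exists>i. u = [i]")
      case True
      then obtain i where u: "u = [i]" by blast
      show ?thesis unfolding u using one[of i] by (auto simp: fan_def)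
    next
      case False
      then have "length u \<noteq> Suc 0" by (cases u) auto
      then show ?thesis using False by auto
    qed
    then show ?case by blast
  next
    case (Suc l)
    have "u \<in> ?V \<and> u \<in> fan n \<and> length u = Suc (Suc l) \<longleftrightarrow> u \<in> children k (forest_level n k l)" for u
    proof (cases u rule: rev_cases)
      case Nil
      then show ?thesis by (auto simp: children_def)
    next
      case (snoc v i)
      have i1: "1 \<le> i" if "u \<in> ?V"
        using that vertices_subset_words[of "count_tree N"] words_snoc[of v i] snoc by blast
      have Nv: "N v = enat (k v)" if "v \<in> ?V" "length v = Suc l"
        using that vertices_subset_words[of "count_tree N"] N(2)[of v] by fastforce
      have "u \<in> ?V \<and> u \<in> fan n \<and> length u = Suc (Suc l)
          \<longleftrightarrow> (v \<in> ?V \<and> v \<in> fan n \<and> length v = Suc l) \<and> 1 \<le> i \<and> i \<le> k v"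
        using snoc_in_count_tree[of i v N] i1 Nv snoc by (cases v) (auto simp: fan_def)
      also have "(v \<in> ?V \<and> v \<in> fan n \<and> length v = Suc l) \<longleftrightarrow> v \<in> forest_level n k l"
        using Suc by auto
      finally show ?thesis using snoc by (auto simp: children_def)
    qed
    then show ?case by (simp add: set_eq_iff)
  qed
  have "u \<in> root_forest n (count_tree N) \<longleftrightarrow> (\<exists>l\<le>n. u \<in> {u \<in> ?V. u \<in> fan n \<and> length u = Suc l})" for u
    by (cases u) (auto simp: root_forest_def fan_def)
  then show ?thesis unfolding lev by (auto simp: forest_def)
qed

lemma child_number_eq:
  assumes c: "root_forest n (count_tree N) = forest n k" and u: "u \<in> forest_level n k l" "l < n"
  shows "N u = enat (k u)"
proof (rule enat_initial_segment_unique, intro allI impI)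
  fix i :: nat assume i: "1 \<le> i"
  have len: "length u = Suc l" and fan: "u \<in> fan n" "u @ [i] \<in> fan n"
    using length_forest_level[OF u(1)] forest_level_fan[OF u(1)] by (auto simp: fan_def)
  have "u \<in> forest n k" using u by (auto simp: forest_def)
  then have uV: "u \<in> vertices (count_tree N)" unfolding c[symmetric] by (simp add: root_forest_def)
  have "enat i \<le> N u \<longleftrightarrow> u @ [i] \<in> root_forest n (count_tree N)"
    using snoc_in_count_tree[OF i, of u N] uV fan len u by (simp add: root_forest_def)
  also have "\<dots> \<longleftrightarrow> u @ [i] \<in> forest_level n k (Suc l)"
    unfolding c using len u by (intro mem_forest_iff) auto
  also have "\<dots> \<longleftrightarrow> enat i \<le> enat (k u)" using u i by (auto simp: children_def)
  finally show "enat i \<le> N u \<longleftrightarrow> enat i \<le> enat (k u)" .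
qed

lemma forest_level_subset_words: "forest_level n k l \<subseteq> words"
proof (induction l)
  case 0
  then show ?case by (auto simp: words_def)
next
  case (Suc l)
  then show ?case by (auto simp: children_def words_snoc)
qed

lemma AE_child_numbers:
  "AE N in child_numbers \<eta> q. N [] = \<infinity> \<and> (\<forall>u\<in>words. u \<noteq> [] \<longrightarrow> N u = enat (the_enat (N u)))"
proof -
  have "AE N in child_numbers \<eta> q. if u = [] then N u = \<infinity> else N u = enat (the_enat (N u))"
    if u: "u \<in> words" for u
  proof (rule AE_PiM_component[OF _ u])
    show "AE x in measure_pmf (tilde_offspring \<eta> q (length u)).
        if u = [] then x = \<infinity> else x = enat (the_enat x)"
      by (auto simp: AE_measure_pmf_iff tilde_offspring_def)
  qed (rule measure_pmf.prob_space_axioms)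
  then have "AE N in child_numbers \<eta> q. \<forall>u\<in>words. if u = [] then N u = \<infinity> else N u = enat (the_enat (N u))"
    by (subst AE_ball_countable) auto
  then show ?thesis
  proof eventually_elim
    case (elim N)
    moreover have "[] \<in> words" by (simp add: words_def)
    ultimately show ?case by auto
  qed
qed

lemma tau_infinity_eq: "tau_infinity \<eta> q = distr (child_numbers \<eta> q) borel count_tree"
  by (simp add: tau_infinity_def inhom_GW_def count_tree_def[abs_def])

context geometric_params
begin

text \<open>The forest determines the child numbers of its vertices in the generations 1 to \<open>n\<close>, which are independent.\<close>

lemma tau_infinity_forest_le:
  "measure (tau_infinity \<eta> q) {t. root_forest n t = forest n k} \<le> forest_weight \<eta> q n k n"
proof -
  let ?M = "\<lambda>u::word. measure_pmf (tilde_offspring \<eta> q (length u))"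
  let ?P = "child_numbers \<eta> q"
  interpret product_prob_space ?M words by unfold_locales
  let ?U = "\<Union>l<n. forest_level n k l"
  have U: "finite ?U" "?U \<subseteq> words"
    using finite_forest_level forest_level_subset_words by blast+
  have disj: "forest_level n k i \<inter> forest_level n k j = {}" if "i \<noteq> j" for i j
    using that by (auto dest!: length_forest_level)
  have "measure (tau_infinity \<eta> q) {t. root_forest n t = forest n k}
     = measure ?P (count_tree -` {t. root_forest n t = forest n k} \<inter> space ?P)"
    unfolding tau_infinity_eq by (rule measure_distr[OF count_tree_measurable root_forest_measurable])
  also have "\<dots> \<le> measure ?P (prod_emb words ?M ?U (PiE ?U (\<lambda>u. {enat (k u)})))"
  proof (rule finite_measure_mono)
    show "prod_emb words ?M ?U (PiE ?U (\<lambda>u. {enat (k u)})) \<in> sets ?P"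
      using U by (intro sets_PiM_I) auto
    show "count_tree -` {t. root_forest n t = forest n k} \<inter> space ?P
        \<subseteq> prod_emb words ?M ?U (PiE ?U (\<lambda>u. {enat (k u)}))"
      using child_number_eq by (auto simp: prod_emb_def space_PiM)
  qed
  also have "\<dots> = (\<Prod>u\<in>?U. measure (?M u) {enat (k u)})"
    using U by (intro measure_PiM_emb) auto
  also have "\<dots> = (\<Prod>l<n. \<Prod>u\<in>forest_level n k l. measure (?M u) {enat (k u)})"
    using disj by (intro prod.UNION_disjoint) (auto simp: finite_forest_level)
  also have "\<dots> = forest_weight \<eta> q n k n"
    unfolding forest_weight_def
    using length_forest_level
    by (intro prod.cong refl) (simp add: measure_pmf_single pmf_tilde_offspring[OF eta q])
  finally show ?thesis .
qed

text \<open>Almost every tree of the limit law has forests of the form \<open>forest n k\<close>, so other finite sets are null.\<close>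

lemma forest_lower:
  assumes "finite c"
  shows "\<exists>b. (b \<longlongrightarrow> measure (tau_infinity \<eta> q) {t. root_forest n t = c}) at_top \<and>
     (\<forall>\<^sub>F \<theta> in at_top. b \<theta> \<le> measure (tau \<eta> q \<theta>) {t. root_forest n t = c})"
proof (cases "\<exists>k. c = forest n k")
  case True
  then obtain k where c: "c = forest n k" by blast
  obtain b where b: "(b \<longlongrightarrow> forest_weight \<eta> q n k n) at_top"
    "\<forall>\<^sub>F \<theta> in at_top. b \<theta> \<le> measure (generations_law \<eta> q \<theta>) {\<omega>. \<forall>l<Suc (Suc n). \<omega> l \<in> path_event n k l}"
    using path_lower by blast
  let ?v = "measure (tau_infinity \<eta> q) {t. root_forest n t = c}"
  \<comment> \<open>The limit of \<open>b\<close> is at least \<open>?v\<close>; the minimum makes it equal.\<close>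
  have "((\<lambda>\<theta>. min (b \<theta>) ?v) \<longlongrightarrow> min (forest_weight \<eta> q n k n) ?v) at_top"
    by (intro tendsto_min b tendsto_const)
  then have "((\<lambda>\<theta>. min (b \<theta>) ?v) \<longlongrightarrow> ?v) at_top"
    using tau_infinity_forest_le[of n k] by (simp add: c min_absorb2)
  moreover have "\<forall>\<^sub>F \<theta> in at_top. min (b \<theta>) ?v \<le> measure (tau \<eta> q \<theta>) {t. root_forest n t = c}"
    using b(2)
  proof eventually_elim
    case (elim \<theta>)
    have "min (b \<theta>) ?v \<le> b \<theta>" by simp
    also note elim
    also note tau_forest_ge_path[OF eta q]
    finally show ?case unfolding c .
  qed
  ultimately show ?thesis by blast
next
  case False
  have "measure (tau_infinity \<eta> q) {t. root_forest n t = c} = 0"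
  proof -
    interpret prob_space "child_numbers \<eta> q"
      by (intro prob_space_PiM measure_pmf.prob_space_axioms)
    have "AE N in child_numbers \<eta> q. root_forest n (count_tree N) \<noteq> c"
      using AE_child_numbers
    proof eventually_elim
      case (elim N)
      then have "root_forest n (count_tree N) = forest n (\<lambda>u. the_enat (N u))"
        by (intro root_forest_count_tree) auto
      then show ?case using False by auto
    qed
    moreover have "measure (tau_infinity \<eta> q) {t. root_forest n t = c}
        = measure (child_numbers \<eta> q) (count_tree -` {t. root_forest n t = c} \<inter> space (child_numbers \<eta> q))"
      unfolding tau_infinity_eq by (rule measure_distr[OF count_tree_measurable root_forest_measurable])
    ultimately show ?thesis
      using finite_measure_mono_AE[of "count_tree -` {t. root_forest n t = c} \<inter> space (child_numbers \<eta> q)" "{}"]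
      by (simp add: order_antisym)
  qed
  then show ?thesis by (intro exI[of _ "\<lambda>_. 0"]) simp
qed

end

lemma AE_tau_infinity:
  "AE t in tau_infinity \<eta> q. (\<forall>n. finite (root_forest n t)) \<and> (\<forall>i\<ge>1. [i] \<in> vertices t)"
proof -
  have fin: "AE t in tau_infinity \<eta> q. finite (root_forest n t)" for n
    unfolding tau_infinity_eq
  proof (subst AE_distr_iff[OF count_tree_measurable])
    have "{t. finite (root_forest n t)} = (\<Union>c\<in>Collect finite. {t. root_forest n t = c})" by auto
    also have "\<dots> \<in> sets borel"
      using root_forest_measurable by (intro sets.countable_UN'' countable_Collect_finite)
    finally show "{t \<in> space borel. finite (root_forest n t)} \<in> sets borel" by simp
    show "AE N in child_numbers \<eta> q. finite (root_forest n (count_tree N))"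
      using AE_child_numbers
    proof eventually_elim
      case (elim N)
      then have "root_forest n (count_tree N) = forest n (\<lambda>u. the_enat (N u))"
        by (intro root_forest_count_tree) auto
      then show ?case by (simp add: finite_forest)
    qed
  qed
  have inf: "AE t in tau_infinity \<eta> q. [i] \<in> vertices t" if i: "1 \<le> i" for i
    unfolding tau_infinity_eq
  proof (subst AE_distr_iff[OF count_tree_measurable])
    show "{t \<in> space borel. [i] \<in> vertices t} \<in> sets borel" using pred_vertices by simp
    show "AE N in child_numbers \<eta> q. [i] \<in> vertices (count_tree N)"
      using AE_child_numbers
    proof eventually_elim
      case (elim N)
      then show ?case using snoc_in_count_tree[OF i, of "[]" N] root_in_vertices by simp
    qed
  qed
  have "AE t in tau_infinity \<eta> q. \<forall>n. finite (root_forest n t)"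
    using fin by (simp add: AE_all_countable)
  moreover have "AE t in tau_infinity \<eta> q. \<forall>i. 1 \<le> i \<longrightarrow> [i] \<in> vertices t"
    using inf by (simp add: AE_all_countable)
  ultimately show ?thesis by eventually_elim auto
qed

theorem proposition6p3:
  fixes \<eta> q :: real
  assumes "0 < \<eta>" and "\<eta> \<le> 1" and "0 < q" and "q < 1"
  shows "weakly_converges (\<lambda>\<theta>. tau \<eta> q \<theta>) (tau_infinity \<eta> q) at_top"
proof (rule weakly_converges_cells[where cell = root_forest and C = "Collect finite"])
  interpret geometric_params \<eta> q using assms by unfold_locales
  show "prob_space (tau \<eta> q \<theta>)" for \<theta> by (rule prob_space_tau)
  show "prob_space (tau_infinity \<eta> q)" by (rule prob_space_tau_infinity)
  show "sets (tau \<eta> q \<theta>) = sets borel" for \<theta> by (simp add: tau_def)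
  show "sets (tau_infinity \<eta> q) = sets borel" by (simp add: tau_infinity_eq)
  show "countable (Collect finite :: word set set)" by (rule countable_Collect_finite)
  show "{t. root_forest n t = c} \<in> sets borel" for n c by (rule root_forest_measurable)
  show "AE t in tau_infinity \<eta> q. \<forall>n. root_forest n t \<in> Collect finite"
    using AE_tau_infinity by eventually_elim simp
  show "AE t in tau_infinity \<eta> q. \<forall>x. (\<forall>n. root_forest n (x n) = root_forest n t) \<longrightarrow> x \<longlonglongrightarrow> t"
    using AE_tau_infinity by eventually_elim (blast intro: tendsto_tree_of_root_forests)
  show "\<exists>b. (b \<longlongrightarrow> measure (tau_infinity \<eta> q) {t. root_forest n t = c}) at_top \<and>
     (\<forall>\<^sub>F \<theta> in at_top. b \<theta> \<le> measure (tau \<eta> q \<theta>) {t. root_forest n t = c})"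
    if "c \<in> Collect finite" for n c
    using that by (intro forest_lower) simp
qed

end
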